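(* Let $\mathcal{A}$ and $\mathcal{S}$ be finite posets with connected Hasse diagrams, and let $\mathcal{S}$ be a poset of Class W. Then each of the following conditions is sufficient for monotonicity equivalence to hold for $(\mathcal{A},\mathcal{S})$: (i) $\mathcal{A}$ is a synchronizable poset; (ii) $\mathcal{S}$ is in Class $\mathrm{W}_\star$ and $\mathcal{A}$ is a synchronizable poset for Class $\mathrm{W}_\star$; (iii) $\mathcal{S}$ is in Class $\mathrm{W}^\star$ and $\mathcal{A}$ is a synchronizable poset for Class $\mathrm{W}^\star$.
   Context: The Hasse diagram of a finite poset is regarded as an undirected graph (edges are the covering pairs). Classes of posets. A Y-poset is the four-element poset $\{w,z,x,y\}$ with $z$ covered by $w$ and $z$ covering $x$ and $y$ ($x,y$ incomparable), or its dual. A $\mathrm{W}^\star$-poset is the four-element poset $\{w,x,y,z\}$ whose only strict relations are $w<x$, $w<y$, $w<z$; a $\mathrm{W}_\star$-poset is its dual ($x,y,z<w$). A poset $\mathcal{S}$ is of Class W if its Hasse diagram is a tree and it has no induced Y-poset. A poset of Class W is an up-down poset if it has no induced $\mathrm{W}^\star$-poset and no induced $\mathrm{W}_\star$-poset. A poset of Class W that is not an up-down poset is in Class $\mathrm{W}_\star$ if it contains only $\mathrm{W}_\star$-posets (no induced $\mathrm{W}^\star$-poset), and in Class $\mathrm{W}^\star$ if it contains only $\mathrm{W}^\star$-posets (no induced $\mathrm{W}_\star$-poset). Synchronizability. Let $D_{\mathcal{A}}$ be the set of minimal elements of $\mathcal{A}$, and let $G_{\mathcal{A}}=(D_{\mathcal{A}},E_{\mathcal{A}})$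 be the graph in which distinct $\beta,\beta'\in D_{\mathcal{A}}$ are joined by an edge iff there is $\alpha\in\mathcal{A}$ with $\beta,\beta'<\alpha$. For $\alpha\in\mathcal{A}$ put $D_{\mathcal{A}}(\alpha)=\{\beta\in D_{\mathcal{A}}:\beta\le\alpha\}$. A spanning tree $T$ of $G_{\mathcal{A}}$ is locally connected if for every $\alpha\in\mathcal{A}$ the subgraph of $T$ induced on $D_{\mathcal{A}}(\alpha)$ is connected. $\mathcal{A}$ is synchronizable for Class $\mathrm{W}_\star$ if $G_{\mathcal{A}}$ has a locally connected spanning tree; it is synchronizable for Class $\mathrm{W}^\star$ if the dual poset $\mathcal{A}^*$ is synchronizable for Class $\mathrm{W}_\star$; it is synchronizable if both hold. Monotonicity. For probability measures $P,P'$ on $\mathcal{S}$, $P\preceq P'$ means $P(U)\le P'(U)$ for every up-set $U$ of $\mathcal{S}$. A system $(P_\gamma:\gamma\in\mathcal{A})$ of probability measures on $\mathcal{S}$ is stochastically monotone if $P_\alpha\preceq P_\beta$ whenever $\alpha<\beta$ in $\mathcal{A}$. It is realizably monotone if there are $\mathcal{S}$-valued random variables $(X_\gamma:\gamma\in\mathcal{A})$ on a common probability space such that $X_\gamma$ has distribution $P_\gamma$ for each $\gamma$ and $X_\alpha\le X_\beta$ in $\mathcal{S}$ whenever $\alpha<\beta$ in $\mathcal{A}$. Monotonicity equivalence holds for $(\mathcal{A},\mathcal{S})$ if, for systems of probability measures on $\mathcal{S}$ indexed by $\mathcal{A}$, stochastic monotonicity and realizable monotonicity are equivalent. *)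

theory Defs
  imports "HOL-Probability.Probability" "Graph_Theory.Graph_Theory"
begin

text \<open>
  A poset is given by a carrier \<open>A\<close> and an order \<open>r\<close> with \<open>partial_order_on A r\<close>, where
  \<open>(x, y) \<in> r\<close> means \<open>x \<le> y\<close>; its dual is \<open>r\<inverse>\<close> on the same carrier.
  Undirected graphs are symmetric loop-free pair digraphs.
\<close>

definition strictly_below :: "'a rel \<Rightarrow> 'a \<Rightarrow> 'a \<Rightarrow> bool" where
  "strictly_below r x y \<longleftrightarrow> (x, y) \<in> r \<and> x \<noteq> y"

definition covered_by :: "'a rel \<Rightarrow> 'a \<Rightarrow> 'a \<Rightarrow> bool" where
  "covered_by r x y \<longleftrightarrow>
     strictly_below r x y \<and> \<not> (\<exists>z. strictly_below r x z \<and> strictly_below r z y)"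

definition hasse_diagram :: "'a set \<Rightarrow> 'a rel \<Rightarrow> 'a pair_pre_digraph" where
  "hasse_diagram A r =
     \<lparr> pverts = A, parcs = {(x, y) \<in> A \<times> A. covered_by r x y \<or> covered_by r y x} \<rparr>"

text \<open>
  The library predicate \<open>tree\<close> is about directed cycles: it counts \<open>u, v, u\<close> as a cycle, so a
  symmetric digraph with an arc never satisfies it. In a symmetric loop-free graph the cycles of
  the undirected graph are the directed cycles with at least three arcs. The name \<open>connected\<close>
  has to be qualified to distinguish it from the topological notion.
\<close>

definition undirected_tree :: "'a pair_pre_digraph \<Rightarrow> bool" where
  "undirected_tree G \<longleftrightarrow>
     Digraph_Component.connected (with_proj G) \<and>
     \<not> (\<exists>p. pre_digraph.cycle (with_proj G) p \<and> 3 \<le> length p)"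

definition undirected_spanning_tree :: "'a pair_pre_digraph \<Rightarrow> 'a pair_pre_digraph \<Rightarrow> bool" where
  "undirected_spanning_tree T G \<longleftrightarrow>
     pair_graph T \<and> spanning (with_proj T) (with_proj G) \<and> undirected_tree T"


definition Y_shape :: "'a set \<Rightarrow> 'a rel \<Rightarrow> bool" where
  "Y_shape B r \<longleftrightarrow>
     (\<exists>w z x y. distinct [w, z, x, y] \<and> B = {w, z, x, y} \<and>
        covered_by r z w \<and> covered_by r x z \<and> covered_by r y z \<and> (x, y) \<notin> r \<and> (y, x) \<notin> r)"

definition Y_poset :: "'a set \<Rightarrow> 'a rel \<Rightarrow> bool" where
  "Y_poset B r \<longleftrightarrow> Y_shape B r \<or> Y_shape B (r\<inverse>)"

definition W_upper_star_poset :: "'a set \<Rightarrow> 'a rel \<Rightarrow> bool" where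
  "W_upper_star_poset B r \<longleftrightarrow>
     (\<exists>w x y z. distinct [w, x, y, z] \<and> B = {w, x, y, z} \<and> r - Id = {(w, x), (w, y), (w, z)})"

definition W_lower_star_poset :: "'a set \<Rightarrow> 'a rel \<Rightarrow> bool" where
  "W_lower_star_poset B r \<longleftrightarrow> W_upper_star_poset B (r\<inverse>)"

definition has_induced :: "('a set \<Rightarrow> 'a rel \<Rightarrow> bool) \<Rightarrow> 'a set \<Rightarrow> 'a rel \<Rightarrow> bool" where
  "has_induced K S r \<longleftrightarrow> (\<exists>B \<subseteq> S. K B (Restr r B))"

definition class_W :: "'a set \<Rightarrow> 'a rel \<Rightarrow> bool" where
  "class_W S r \<longleftrightarrow> undirected_tree (hasse_diagram S r) \<and> \<not> has_induced Y_poset S r"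

definition up_down_poset :: "'a set \<Rightarrow> 'a rel \<Rightarrow> bool" where
  "up_down_poset S r \<longleftrightarrow>
     class_W S r \<and> \<not> has_induced W_upper_star_poset S r \<and> \<not> has_induced W_lower_star_poset S r"

definition class_W_lower_star :: "'a set \<Rightarrow> 'a rel \<Rightarrow> bool" where
  "class_W_lower_star S r \<longleftrightarrow>
     class_W S r \<and> \<not> up_down_poset S r \<and> \<not> has_induced W_upper_star_poset S r"

definition class_W_upper_star :: "'a set \<Rightarrow> 'a rel \<Rightarrow> bool" where
  "class_W_upper_star S r \<longleftrightarrow>
     class_W S r \<and> \<not> up_down_poset S r \<and> \<not> has_induced W_lower_star_poset S r"


definition minimal_elements :: "'a set \<Rightarrow> 'a rel \<Rightarrow> 'a set" where
  "minimal_elements A r = {b \<in> A. \<not> (\<exists>c \<in> A. strictly_below r c b)}"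

definition minimal_below :: "'a set \<Rightarrow> 'a rel \<Rightarrow> 'a \<Rightarrow> 'a set" where
  "minimal_below A r a = {b \<in> minimal_elements A r. (b, a) \<in> r}"

definition sync_graph :: "'a set \<Rightarrow> 'a rel \<Rightarrow> 'a pair_pre_digraph" where
  "sync_graph A r =
     \<lparr> pverts = minimal_elements A r,
       parcs = {(b, b') \<in> minimal_elements A r \<times> minimal_elements A r.
                  b \<noteq> b' \<and> (\<exists>a \<in> A. strictly_below r b a \<and> strictly_below r b' a)} \<rparr>"

definition locally_connected :: "'a set \<Rightarrow> 'a rel \<Rightarrow> 'a pair_pre_digraph \<Rightarrow> bool" where
  "locally_connected A r T \<longleftrightarrow>
     (\<forall>a \<in> A. Digraph_Component.connected (with_proj T \<restriction> minimal_below A r a))"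

definition synchronizable_lower_star :: "'a set \<Rightarrow> 'a rel \<Rightarrow> bool" where
  "synchronizable_lower_star A r \<longleftrightarrow>
     (\<exists>T. undirected_spanning_tree T (sync_graph A r) \<and> locally_connected A r T)"

definition synchronizable_upper_star :: "'a set \<Rightarrow> 'a rel \<Rightarrow> bool" where
  "synchronizable_upper_star A r \<longleftrightarrow> synchronizable_lower_star A (r\<inverse>)"

definition synchronizable :: "'a set \<Rightarrow> 'a rel \<Rightarrow> bool" where
  "synchronizable A r \<longleftrightarrow> synchronizable_lower_star A r \<and> synchronizable_upper_star A r"


definition up_set :: "'b set \<Rightarrow> 'b rel \<Rightarrow> 'b set \<Rightarrow> bool" where
  "up_set S s U \<longleftrightarrow> U \<subseteq> S \<and> (\<forall>x \<in> U. \<forall>y \<in> S. (x, y) \<in> s \<longrightarrow> y \<in> U)"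

text \<open>
  As \<open>S\<close> is finite, the probability measures on \<open>S\<close> are the mass functions with support in \<open>S\<close>.
\<close>

definition measure_system :: "'a set \<Rightarrow> 'b set \<Rightarrow> ('a \<Rightarrow> 'b pmf) \<Rightarrow> bool" where
  "measure_system A S P \<longleftrightarrow> (\<forall>a \<in> A. set_pmf (P a) \<subseteq> S)"

definition stochastically_le :: "'b set \<Rightarrow> 'b rel \<Rightarrow> 'b pmf \<Rightarrow> 'b pmf \<Rightarrow> bool" where
  "stochastically_le S s P P' \<longleftrightarrow>
     (\<forall>U. up_set S s U \<longrightarrow> measure_pmf.prob P U \<le> measure_pmf.prob P' U)"

definition stochastically_monotone ::
  "'a set \<Rightarrow> 'a rel \<Rightarrow> 'b set \<Rightarrow> 'b rel \<Rightarrow> ('a \<Rightarrow> 'b pmf) \<Rightarrow> bool" where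
  "stochastically_monotone A r S s P \<longleftrightarrow>
     (\<forall>a \<in> A. \<forall>b \<in> A. strictly_below r a b \<longrightarrow> stochastically_le S s (P a) (P b))"

definition monotone_realization ::
  "'a set \<Rightarrow> 'a rel \<Rightarrow> 'b set \<Rightarrow> 'b rel \<Rightarrow> ('a \<Rightarrow> 'b pmf) \<Rightarrow> 'w measure \<Rightarrow> ('a \<Rightarrow> 'w \<Rightarrow> 'b) \<Rightarrow> bool"
where
  "monotone_realization A r S s P M X \<longleftrightarrow>
     prob_space M \<and>
     (\<forall>a \<in> A. X a \<in> M \<rightarrow>\<^sub>M count_space S \<and>
              distr M (count_space UNIV) (X a) = measure_pmf (P a)) \<and>
     (\<forall>a \<in> A. \<forall>b \<in> A. strictly_below r a b \<longrightarrow> (\<forall>\<omega> \<in> space M. (X a \<omega>, X b \<omega>) \<in> s))"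

text \<open>
  HOL cannot quantify over the type of sample points inside a formula, so the probability space
  lives on \<open>'a \<Rightarrow> 'b\<close>. The lemma after the definition shows that nothing is lost: a
  realization on any probability space can be transported there.
\<close>

definition realizably_monotone ::
  "'a set \<Rightarrow> 'a rel \<Rightarrow> 'b set \<Rightarrow> 'b rel \<Rightarrow> ('a \<Rightarrow> 'b pmf) \<Rightarrow> bool" where
  "realizably_monotone A r S s P \<longleftrightarrow>
     (\<exists>(M :: ('a \<Rightarrow> 'b) measure) X. monotone_realization A r S s P M X)"

lemma realizably_monotoneI:
  fixes M :: "'w measure" and P :: "'a \<Rightarrow> 'b pmf"
  assumes "finite S" and MX: "monotone_realization A r S s P M X"
  shows "realizably_monotone A r S s P"
proof -
  interpret prob_space M using MX by (simp add: monotone_realization_def)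
  have X: "X a \<in> M \<rightarrow>\<^sub>M count_space S" if "a \<in> A" for a
    using MX that by (simp add: monotone_realization_def)
  define \<Omega> where "\<Omega> = {f. \<forall>a \<in> A. \<forall>b \<in> A. strictly_below r a b \<longrightarrow> (f a, f b) \<in> s}"
  define N where "N = restrict_space (PiM A (\<lambda>_. count_space S)) \<Omega>"
  define Y where "Y \<omega> = (\<lambda>a\<in>A. X a \<omega>)" for \<omega>
  have "Y \<in> M \<rightarrow>\<^sub>M PiM A (\<lambda>_. count_space S)"
    unfolding Y_def by (rule measurable_restrict) (rule X)
  moreover have "Y \<in> space M \<rightarrow> \<Omega>"
    using MX by (auto simp: Y_def \<Omega>_def monotone_realization_def)
  ultimately have Y: "Y \<in> M \<rightarrow>\<^sub>M N"
    unfolding N_def by (intro measurable_restrict_space2) auto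
  have proj: "(\<lambda>f. f a) \<in> N \<rightarrow>\<^sub>M count_space S" if "a \<in> A" for a
    unfolding N_def using that by (intro measurable_restrict_space1 measurable_component_singleton)
  have incl: "id \<in> count_space S \<rightarrow>\<^sub>M count_space UNIV"
    by simp
  have "monotone_realization A r S s P (distr M N Y) (\<lambda>a f. f a)"
    unfolding monotone_realization_def
  proof (intro conjI ballI impI)
    show "prob_space (distr M N Y)"
      using Y by (rule prob_space_distr)
  next
    fix a assume a: "a \<in> A"
    show "(\<lambda>f. f a) \<in> distr M N Y \<rightarrow>\<^sub>M count_space S"
      using proj[OF a] by simp
    have "(\<lambda>f. f a) \<in> N \<rightarrow>\<^sub>M count_space UNIV"
      using measurable_comp[OF proj[OF a] incl] by (simp add: o_def)
    then have "distr (distr M N Y) (count_space UNIV) (\<lambda>f. f a) =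
        distr M (count_space UNIV) ((\<lambda>f. f a) \<circ> Y)"
      using Y by (rule distr_distr)
    also have "(\<lambda>f. f a) \<circ> Y = X a"
      using a by (simp add: Y_def o_def)
    also have "distr M (count_space UNIV) (X a) = measure_pmf (P a)"
      using MX a by (simp add: monotone_realization_def)
    finally show "distr (distr M N Y) (count_space UNIV) (\<lambda>f. f a) = measure_pmf (P a)" .
  next
    fix a b f assume "a \<in> A" "b \<in> A" "strictly_below r a b" "f \<in> space (distr M N Y)"
    then show "(f a, f b) \<in> s"
      by (auto simp: N_def \<Omega>_def space_restrict_space)
  qed
  then show ?thesis
    unfolding realizably_monotone_def by blast
qed

definition monotonicity_equivalence :: "'a set \<Rightarrow> 'a rel \<Rightarrow> 'b set \<Rightarrow> 'b rel \<Rightarrow> bool" where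
  "monotonicity_equivalence A r S s \<longleftrightarrow>
     (\<forall>P. measure_system A S P \<longrightarrow>
        (stochastically_monotone A r S s P \<longleftrightarrow> realizably_monotone A r S s P))"

end

theory Submission
  imports Defs
begin

text \<open>
  Root the Hasse tree of \<open>S\<close> at a leaf. A probability measure on \<open>S\<close> is then given by the masses
  of the subtrees, and stochastic monotonicity says that each of these masses is monotone in the
  index, increasing or decreasing according to the direction of the edge above the subtree. By the
  absence of induced Y-posets, every branching vertex is maximal or minimal in \<open>S\<close>.

  For a minimal \<open>b\<close> and a maximal \<open>g\<close> of \<open>A\<close>, place a random point on the metric tree whose edges
  are the unbranched segments of \<open>S\<close>: uniformly on a stretch of each segment, whose ends are the
  masses under \<open>P b\<close> at maximal branching vertices and those under \<open>P g\<close> at minimal ones, with the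
  remaining mass in atoms at the branching vertices. Inverse probability transform along the
  segments turns this point into \<open>X a\<close> for all \<open>b \<le> a \<le> g\<close> at once, monotonically in \<open>a\<close>.
  Neighbouring pairs \<open>(b, g)\<close> have a common coarsening of their random points, so that these can be
  coupled to agree on the common part; the two locally connected spanning trees give an order in
  which all the couplings can be glued, and make \<open>X a\<close> independent of the pair it is read off from.
  When \<open>S\<close> has no minimal (maximal) branching vertex, \<open>g\<close> (\<open>b\<close>) plays no role and only one
  spanning tree is needed.
\<close>

section \<open>Rooted trees\<close>

text \<open>The pairs \<open>(b, g)\<close> form a product of two trees, and such a graph has
  squares. Couplings chosen separately on its edges need not be consistent around a square, so
  gluing along a spanning tree of the pairs is not enough. The way out is that on every segment the
  cuts depending on \<open>b\<close> sit at maximal ends and those depending on \<open>g\<close> at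
  minimal ends, and any index between \<open>b\<close> and \<open>g\<close> keeps the two kinds of
  cuts apart. Passing from \<open>g\<close> to \<open>g'\<close> then concerns only the points that
  are collapsed into minimal branching vertices, and the weights of such points do not depend on
  \<open>b\<close>. One fresh point, shared by all \<open>b\<close>, replaces them throughout the
  new column, and the agreements along the tree of minimal elements survive.

  The masses that occur form a finite set of levels. Lebesgue measure on the unit interval is
  replaced by the gaps between consecutive levels, so that every random point is a
  \<open>pmf\<close> on a finite set.\<close>

definition rooted_at :: "'a set \<Rightarrow> 'a rel \<Rightarrow> 'a \<Rightarrow> ('a \<Rightarrow> 'a) \<Rightarrow> ('a \<Rightarrow> nat) \<Rightarrow> bool" where
  "rooted_at V E t par dep \<longleftrightarrow>
     t \<in> V \<and> E \<subseteq> V \<times> V \<and> sym E \<and>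
     (\<forall>v\<in>V - {t}. (v, par v) \<in> E \<and> dep v = Suc (dep (par v))) \<and>
     (\<forall>u v. (u, v) \<in> E \<longrightarrow> u \<noteq> t \<and> par u = v \<or> v \<noteq> t \<and> par v = u)"

text \<open>Asking for a rooting at every vertex makes re-rooting free: at a leaf of
  \<open>S\<close>, and at an element of a prescribed subset of the minimal elements.\<close>

definition tree_on :: "'a set \<Rightarrow> 'a rel \<Rightarrow> bool" where
  "tree_on V E \<longleftrightarrow> (\<forall>t\<in>V. \<exists>par dep. rooted_at V E t par dep)"

definition conn_in :: "'a rel \<Rightarrow> 'a set \<Rightarrow> bool" where
  "conn_in E X \<longleftrightarrow> (\<forall>x\<in>X. \<forall>y\<in>X. (x, y) \<in> (E \<inter> X \<times> X)\<^sup>*)"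

text \<open>The path grows by one vertex at a time; when the new endpoint was visited before, the
  path is cut back to that visit.\<close>

lemma rtrancl_distinct_path:
  assumes "(x, y) \<in> R\<^sup>*"
  shows "\<exists>vs. distinct vs \<and> vs \<noteq> [] \<and> hd vs = x \<and> last vs = y \<and>
           (\<forall>i. Suc i < length vs \<longrightarrow> (vs ! i, vs ! Suc i) \<in> R)"
  using assms
proof (induction rule: rtrancl_induct)
  case base
  then show ?case by (intro exI[of _ "[x]"]) auto
next
  case (step y z)
  then obtain vs where vs: "distinct vs" "vs \<noteq> []" "hd vs = x" "last vs = y"
    "\<And>i. Suc i < length vs \<Longrightarrow> (vs ! i, vs ! Suc i) \<in> R" by blast
  show ?case
  proof (cases "z \<in> set vs")
    case False
    have "(((vs @ [z]) ! i), (vs @ [z]) ! Suc i) \<in> R" if "Suc i < length (vs @ [z])" for i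
    proof (cases "Suc i < length vs")
      case True then show ?thesis using vs(5) by (simp add: nth_append)
    next
      case False
      then have i: "i = length vs - 1" "Suc i = length vs" using that vs(2) by auto
      then have "vs ! i = y" using vs(2,4) by (simp add: last_conv_nth)
      then show ?thesis using i step(2) vs(2) by (simp add: nth_append)
    qed
    then show ?thesis using False vs by (intro exI[of _ "vs @ [z]"]) auto
  next
    case True
    then obtain k where k: "k < length vs" "vs ! k = z" by (auto simp: in_set_conv_nth)
    let ?w = "take (Suc k) vs"
    have "last ?w = z" using k by (simp add: take_Suc_conv_app_nth)
    moreover have "hd ?w = x" using vs by (cases vs) auto
    ultimately show ?thesis using vs k by (intro exI[of _ ?w]) auto
  qed
qed

definition arcs_of :: "'a list \<Rightarrow> ('a \<times> 'a) list" where
  "arcs_of vs = zip vs (tl vs)"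

lemma arcs_of_Cons: "arcs_of (x # y # vs) = (x, y) # arcs_of (y # vs)"
  by (simp add: arcs_of_def)

lemma pawalk_arcs_of:
  "vs \<noteq> [] \<Longrightarrow> pcas (hd vs) (arcs_of vs) (last vs) \<and> pawalk_verts (hd vs) (arcs_of vs) = vs"
proof (induction vs rule: induct_list012)
  case (3 x y zs)
  then show ?case by (auto simp: arcs_of_Cons)
qed (auto simp: arcs_of_def)

lemma set_arcs_of: "set (arcs_of vs) = {(vs ! i, vs ! Suc i) | i. Suc i < length vs}"
  unfolding arcs_of_def set_zip by (auto simp: nth_tl)

text \<open>Together with the edge, the detour closes up to a cycle. A detour of one arc would be
  the removed \<open>(v, u)\<close> and one of no arc would give \<open>u = v\<close>, so the cycle
  has at least three arcs, as \<open>undirected_tree\<close> requires.\<close>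

lemma undirected_tree_no_detour:
  assumes T: "undirected_tree G" and uv: "(u, v) \<in> parcs G" "u \<noteq> v"
    and wf: "parcs G \<subseteq> pverts G \<times> pverts G"
    and path: "(v, u) \<in> (parcs G - {(u, v), (v, u)})\<^sup>*"
  shows False
proof -
  obtain vs where vs: "distinct vs" "vs \<noteq> []" "hd vs = v" "last vs = u"
    "\<And>i. Suc i < length vs \<Longrightarrow> (vs ! i, vs ! Suc i) \<in> parcs G - {(u, v), (v, u)}"
    using rtrancl_distinct_path[OF path] by blast
  let ?p = "arcs_of (u # vs)"
  obtain ws where ws: "vs = v # ws" using vs by (cases vs) auto
  have p: "?p = (u, v) # arcs_of vs" by (simp add: arcs_of_Cons ws)
  have len: "2 \<le> length (arcs_of vs)"
  proof (rule ccontr)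
    assume "\<not> ?thesis"
    then have "length vs \<le> 2" by (simp add: arcs_of_def)
    then consider "vs = [v]" | w where "vs = [v, w]" using ws by (cases ws) auto
    then show False
    proof cases
      case 1 then show ?thesis using vs uv by simp
    next
      case 2 then show ?thesis using vs(4) vs(5)[of 0] by simp
    qed
  qed
  have "pre_digraph.cycle (with_proj G) ?p"
    unfolding pre_digraph.cycle_def pre_digraph.awalk_def cas_with_proj_eq awalk_verts_with_proj_eq
  proof (intro exI[of _ u] conjI)
    show "u \<in> verts (with_proj G)" using uv wf by auto
    have "set (arcs_of vs) \<subseteq> parcs G" unfolding set_arcs_of using vs(5) by blast
    then show "set ?p \<subseteq> arcs (with_proj G)" using uv p by simp
    show "pcas u ?p u" using pawalk_arcs_of[OF vs(2)] vs p by simp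
    show "distinct (tl (pawalk_verts u ?p))" using pawalk_arcs_of[of "u # vs"] vs by simp
    show "?p \<noteq> []" using p by simp
  qed
  moreover have "3 \<le> length ?p" using p len by simp
  ultimately show False using T unfolding undirected_tree_def by blast
qed

lemma connected_reachable:
  assumes "Digraph_Component.connected (with_proj G)" "sym (parcs G)" "u \<in> pverts G" "v \<in> pverts G"
  shows "(u, v) \<in> rtrancl_on (pverts G) (parcs G)"
proof -
  have "(\<Union>e\<in>parcs G. {(fst e, snd e), (snd e, fst e)}) = parcs G"
    using assms(2) by (auto simp: sym_def)
  then show ?thesis
    using assms unfolding connected_def strongly_connected_def mk_symmetric_def reachable_def
    by simp
qed

lemma rtrancl_on_imp_rtrancl: "(u, v) \<in> rtrancl_on V E \<Longrightarrow> (u, v) \<in> (E \<inter> V \<times> V)\<^sup>*"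
  by (induction rule: rtrancl_on_induct) (auto intro: rtrancl_into_rtrancl)

text \<open>Depth is the breadth-first distance from \<open>t\<close>, and the parent is a neighbour
  at distance one less. If an edge were not a parent edge, both its ends would reach
  \<open>t\<close> by parent edges alone, which is a detour.\<close>

lemma undirected_tree_imp_tree_on:
  assumes T: "undirected_tree G" and wf: "parcs G \<subseteq> pverts G \<times> pverts G"
    and symG: "sym (parcs G)" and irr: "\<And>u. (u, u) \<notin> parcs G"
  shows "tree_on (pverts G) (parcs G)"
  unfolding tree_on_def
proof
  fix t assume t: "t \<in> pverts G"
  let ?V = "pverts G" and ?E = "parcs G"
  have conn: "(t, v) \<in> ?E\<^sup>*" if "v \<in> ?V" for v
  proof -
    have "(t, v) \<in> (?E \<inter> ?V \<times> ?V)\<^sup>*"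
      using T t that by (intro rtrancl_on_imp_rtrancl connected_reachable symG) (auto simp: undirected_tree_def)
    then show ?thesis using rtrancl_mono[of "?E \<inter> ?V \<times> ?V" ?E] by blast
  qed
  define dep where "dep v = (LEAST n. (t, v) \<in> ?E ^^ n)" for v
  have dep: "(t, v) \<in> ?E ^^ dep v" if "v \<in> ?V" for v
    using conn[OF that] unfolding dep_def rtrancl_power by (rule LeastI_ex)
  have dep_le: "dep v \<le> n" if "(t, v) \<in> ?E ^^ n" for v n
    unfolding dep_def using that by (rule Least_le)
  have "\<exists>p. (v, p) \<in> ?E \<and> dep v = Suc (dep p)" if v: "v \<in> ?V - {t}" for v
  proof -
    have "dep v \<noteq> 0" using dep[of v] v by (intro notI) auto
    then obtain n where n: "dep v = Suc n" by (cases "dep v") auto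
    then obtain p where p: "(t, p) \<in> ?E ^^ n" "(p, v) \<in> ?E" using dep[of v] v by auto
    have "dep p \<le> n" using p by (rule_tac dep_le)
    moreover have "p \<in> ?V" using p wf by auto
    then have "(t, v) \<in> ?E ^^ Suc (dep p)" using dep[of p] p by auto
    then have "dep v \<le> Suc (dep p)" by (rule dep_le)
    ultimately show ?thesis using n p symG by (auto simp: sym_def)
  qed
  then obtain par where par: "\<And>v. v \<in> ?V - {t} \<Longrightarrow> (v, par v) \<in> ?E \<and> dep v = Suc (dep (par v))"
    by metis
  have "u \<noteq> t \<and> par u = v \<or> v \<noteq> t \<and> par v = u" if e: "(u, v) \<in> ?E" for u v
  proof (rule ccontr)
    assume neg: "\<not> ?thesis"
    let ?F = "?E - {(u, v), (v, u)}"
    have up: "(x, t) \<in> ?F\<^sup>*" if "x \<in> ?V" for x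
      using that
    proof (induction "dep x" arbitrary: x rule: less_induct)
      case less
      show ?case
      proof (cases "x = t")
        case False
        then have p: "(x, par x) \<in> ?E" "dep x = Suc (dep (par x))" using par less.prems by auto
        have "(x, par x) \<in> ?F" using p neg False by auto
        moreover have "(par x, t) \<in> ?F\<^sup>*" using p wf by (intro less.hyps) auto
        ultimately show ?thesis by (rule converse_rtrancl_into_rtrancl)
      qed simp
    qed
    have "sym ?F" using symG by (auto simp: sym_def)
    then have "sym (?F\<^sup>*)" by (rule sym_rtrancl)
    moreover have "(u, t) \<in> ?F\<^sup>*" "(v, t) \<in> ?F\<^sup>*" using e wf by (auto intro: up)
    ultimately have "(v, u) \<in> ?F\<^sup>*" by (blast dest: symD intro: rtrancl_trans)
    then show False using undirected_tree_no_detour[OF T e _ wf] irr e by blast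
  qed
  then show "\<exists>par dep. rooted_at ?V ?E t par dep"
    unfolding rooted_at_def using t wf symG par by blast
qed

lemma rooted_at_par_in:
  "rooted_at V E t par dep \<Longrightarrow> v \<in> V \<Longrightarrow> v \<noteq> t \<Longrightarrow> par v \<in> V"
  unfolding rooted_at_def by blast

text \<open>A connected set that leaves \<open>v\<close> without visiting its parent stays among the descendants of \<open>v\<close>.\<close>

lemma rooted_at_conn_par:
  assumes R: "rooted_at V E t par dep" and X: "conn_in E X" and v: "v \<in> X" "v \<in> V" "v \<noteq> t"
    and W: "w \<in> X" "w \<in> W" "v \<notin> W" and cl: "\<And>x. x \<in> W \<Longrightarrow> x \<noteq> t \<Longrightarrow> par x \<in> W"
  shows "par v \<in> X"
proof (rule ccontr)
  assume nX: "par v \<notin> X"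
  define desc where "desc = {(x, y). x \<in> V - {t} \<and> y = par x}"
  have "(v, w) \<in> (E \<inter> X \<times> X)\<^sup>*" using X v W unfolding conn_in_def by blast
  \<comment> \<open>The walk starts at \<open>v\<close> and moves up only from proper descendants of
    \<open>v\<close>, as a move up from \<open>v\<close> itself would enter
    \<open>par v\<close>.\<close>
  then have "(w, v) \<in> desc\<^sup>*"
  proof (induction rule: rtrancl_induct)
    case (step y z)
    then have yz: "(y, z) \<in> E" "z \<in> X" by auto
    from R yz consider "y \<noteq> t" "par y = z" "y \<in> V" | "z \<noteq> t" "par z = y" "z \<in> V"
      unfolding rooted_at_def by blast
    then show ?case
    proof cases
      case 1
      then have "y \<noteq> v" using nX yz by auto
      with step(3) obtain y' where "(y, y') \<in> desc" "(y', v) \<in> desc\<^sup>*" by (meson converse_rtranclE)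
      then show ?thesis using 1 unfolding desc_def by auto
    next
      case 2
      then have "(z, y) \<in> desc" unfolding desc_def by auto
      then show ?thesis using step(3) by (rule converse_rtrancl_into_rtrancl)
    qed
  qed simp
  then have "v \<in> W" using W(2)
  proof (induction rule: converse_rtrancl_induct)
    case (step y z)
    then show ?case using cl unfolding desc_def by auto
  qed simp
  then show False using W by simp
qed

lemma rooted_at_conn_closed:
  assumes R: "rooted_at V E t par dep" and X: "conn_in E X" and "X \<subseteq> V" "t \<in> X" "v \<in> X" "v \<noteq> t"
  shows "par v \<in> X"
  using rooted_at_conn_par[OF R X, of v t "{t}"] assms by auto

text \<open>A vertex of least depth outside \<open>W\<close> has its parent in \<open>W\<close>.
  This lets a parent-closed set grow one vertex at a time, both inside a column and from column to
  column.\<close>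

lemma rooted_at_frontier:
  assumes R: "rooted_at V E t par dep" and "X \<subseteq> V" and "W \<subset> X" "t \<in> W"
    and clX: "\<And>x. x \<in> X \<Longrightarrow> x \<noteq> t \<Longrightarrow> par x \<in> X"
  shows "\<exists>v\<in>X - W. v \<noteq> t \<and> par v \<in> W"
proof -
  have "\<exists>v. v \<in> X - W" using assms by blast
  then obtain v where v: "v \<in> X - W" "\<And>x. x \<in> X - W \<Longrightarrow> dep v \<le> dep x"
    using ex_has_least_nat[of "\<lambda>x. x \<in> X - W" _ dep] by blast
  have "v \<noteq> t" using v assms by auto
  moreover have "dep v = Suc (dep (par v))" using R v \<open>v \<noteq> t\<close> assms(2) unfolding rooted_at_def by auto
  then have "par v \<in> W" using v clX[of v] \<open>v \<noteq> t\<close> by (metis DiffD1 DiffI Suc_n_not_le_n)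
  ultimately show ?thesis using v by blast
qed

text \<open>A vertex of greatest depth from an arbitrary root has no neighbour except possibly its
  parent. With the root there, every vertex with two children also has a parent, hence three
  neighbours, which is the configuration that the forbidden subposets speak about.\<close>

lemma finite_tree_leaf_root:
  assumes "tree_on V E" "finite V" "V \<noteq> {}"
  shows "\<exists>t par dep. rooted_at V E t par dep \<and> (\<forall>x y. x \<in> V - {t} \<and> y \<in> V - {t} \<and> par x = t \<and> par y = t \<longrightarrow> x = y)"
proof -
  obtain s where s: "s \<in> V" using assms by blast
  then obtain par dep where R: "rooted_at V E s par dep" using assms unfolding tree_on_def by blast
  have "finite (dep ` V)" "dep ` V \<noteq> {}" using assms by auto
  then obtain t where t: "t \<in> V" "\<And>x. x \<in> V \<Longrightarrow> dep x \<le> dep t"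
    using Max_in[of "dep ` V"] Max_ge[of "dep ` V"] by fastforce
  then obtain par' dep' where R': "rooted_at V E t par' dep'" using assms unfolding tree_on_def by blast
  have nb: "x = par t" if "x \<in> V - {t}" "par' x = t" for x
  proof -
    have "(x, t) \<in> E" using R' that unfolding rooted_at_def by blast
    moreover have "\<not> (x \<noteq> s \<and> par x = t)"
      using R t(2)[of x] that unfolding rooted_at_def by auto
    ultimately show ?thesis using R unfolding rooted_at_def by blast
  qed
  have "x = y" if "x \<in> V - {t} \<and> y \<in> V - {t} \<and> par' x = t \<and> par' y = t" for x y
    using nb[of x] nb[of y] that by simp
  then show ?thesis using R' by blast
qed

section \<open>Distributions on a tree of segments\<close>

text \<open>\<open>w u\<close> is the gap from \<open>u\<close> to the next element of
  \<open>L\<close>, and the gaps telescope.\<close>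

lemma level_weights:
  fixes L :: "real set"
  assumes "finite L"
  shows "\<exists>w. (\<forall>u. 0 \<le> w u) \<and>
           (\<forall>s\<in>L. \<forall>t\<in>L. s \<le> t \<longrightarrow> (\<Sum>u\<in>{u\<in>L. s \<le> u \<and> u < t}. w u) = t - s)"
  using assms
proof (induction L rule: finite_linorder_max_induct)
  case (insert b A)
  then obtain w where w: "\<And>u. 0 \<le> w u"
    "\<And>s t. s \<in> A \<Longrightarrow> t \<in> A \<Longrightarrow> s \<le> t \<Longrightarrow> (\<Sum>u\<in>{u\<in>A. s \<le> u \<and> u < t}. w u) = t - s"
    by blast
  show ?case
  proof (cases "A = {}")
    case False
    define m where "m = Max A"
    have m: "m \<in> A" "m < b" "\<And>a. a \<in> A \<Longrightarrow> a \<le> m"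
      using insert False by (auto simp: m_def)
    \<comment> \<open>The former maximum receives the gap to the new one; it belongs to no half-open
      interval that ends in \<open>A\<close>.\<close>
    define w' where "w' = w(m := b - m)"
    have old: "(\<Sum>u\<in>{u\<in>A. s \<le> u \<and> u < t}. w' u) = t - s" if "s \<in> A" "t \<in> A" "s \<le> t" for s t
    proof -
      have "(\<Sum>u\<in>{u\<in>A. s \<le> u \<and> u < t}. w' u) = (\<Sum>u\<in>{u\<in>A. s \<le> u \<and> u < t}. w u)"
        using m(3)[of t] that by (intro sum.cong) (auto simp: w'_def)
      then show ?thesis using w(2) that by simp
    qed
    have "(\<Sum>u\<in>{u\<in>insert b A. s \<le> u \<and> u < t}. w' u) = t - s"
      if st: "s \<in> insert b A" "t \<in> insert b A" "s \<le> t" for s t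
    proof (cases "t = b")
      case False
      then have "t \<in> A" "t < b" using st insert by auto
      then have "s \<in> A" using st by auto
      have "{u\<in>insert b A. s \<le> u \<and> u < t} = {u\<in>A. s \<le> u \<and> u < t}" using \<open>t < b\<close> by auto
      then show ?thesis using old \<open>s \<in> A\<close> \<open>t \<in> A\<close> st by simp
    next
      case t: True
      show ?thesis
      proof (cases "s = b")
        case True
        then have "(\<Sum>u\<in>{u\<in>insert b A. s \<le> u \<and> u < t}. w' u) = 0"
          using t by (intro sum.neutral) auto
        then show ?thesis using True t by simp
      next
        case False
        then have s: "s \<in> A" using st by simp
        have "{u\<in>insert b A. s \<le> u \<and> u < t} = {u\<in>A. s \<le> u}" using insert t by auto
        also have "\<dots> = insert m {u\<in>A. s \<le> u \<and> u < m}"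
          using m(1) m(3)[OF s] m(3) by (auto simp: less_le)
        finally have eq: "{u\<in>insert b A. s \<le> u \<and> u < t} = insert m {u\<in>A. s \<le> u \<and> u < m}" .
        have "(\<Sum>u\<in>{u\<in>insert b A. s \<le> u \<and> u < t}. w' u) = w' m + (\<Sum>u\<in>{u\<in>A. s \<le> u \<and> u < m}. w' u)"
          unfolding eq using insert by simp
        also have "\<dots> = t - s" using old[of s m] m s t by (simp add: w'_def)
        finally show ?thesis .
      qed
    qed
    moreover have "0 \<le> w' u" for u using w m by (simp add: w'_def)
    ultimately show ?thesis by blast
  qed auto
qed auto

text \<open>The tree of segments, stripped of the poset: a segment is named by its lower end, and
  \<open>up\<close> leads to the branching vertex from which it hangs.\<close>

locale level_tree =
  fixes T :: "'c set" and r :: 'c and up :: "'c \<Rightarrow> 'c" and L :: "real set" and w :: "real \<Rightarrow> real"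
  assumes finT: "finite T" and rT: "r \<in> T" and upT: "\<And>c. c \<in> T \<Longrightarrow> c \<noteq> r \<Longrightarrow> up c \<in> T"
    and finL: "finite L" and L01: "L \<subseteq> {0..1}"
    and w_nonneg: "\<And>u. 0 \<le> w u"
    and w_sum: "\<And>s t. s \<in> L \<Longrightarrow> t \<in> L \<Longrightarrow> s \<le> t \<Longrightarrow> (\<Sum>u\<in>{u\<in>L. s \<le> u \<and> u < t}. w u) = t - s"
begin

definition kids :: "'c \<Rightarrow> 'c set" where
  "kids c = {d \<in> T - {r}. up d = c}"

text \<open>The inequality for the kids makes the atom at \<open>c\<close> nonnegative, and
  \<open>hi r = 1\<close> normalizes the total mass.\<close>

definition valid :: "('c \<Rightarrow> real) \<Rightarrow> ('c \<Rightarrow> real) \<Rightarrow> bool" where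
  "valid lo hi \<longleftrightarrow>
     (\<forall>c\<in>T. lo c \<in> L \<and> hi c \<in> L \<and> lo c \<le> hi c \<and> (\<Sum>d\<in>kids c. hi d) \<le> lo c) \<and> hi r = 1"

text \<open>
  The point \<open>(c, u)\<close> with \<open>0 \<le> u\<close> is the level \<open>u\<close> of the segment above the terminal \<open>c\<close>,
  and \<open>(c, - 1)\<close> is \<open>c\<close> itself.
\<close>

definition wt :: "('c \<Rightarrow> real) \<Rightarrow> ('c \<Rightarrow> real) \<Rightarrow> 'c \<times> real \<Rightarrow> real" where
  "wt lo hi = (\<lambda>(c, u).
     if c \<notin> T then 0
     else if u = - 1 then lo c - (\<Sum>d\<in>kids c. hi d)
     else if u \<in> L \<and> lo c \<le> u \<and> u < hi c then w u else 0)"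

definition nu :: "('c \<Rightarrow> real) \<Rightarrow> ('c \<Rightarrow> real) \<Rightarrow> ('c \<times> real) pmf" where
  "nu lo hi = embed_pmf (wt lo hi)"

text \<open>Passage to narrower stretches: the parts of a segment that are cut off collapse into the
  terminal at that end. The segment of \<open>r\<close> is never cut at its top, as there is no
  vertex above it.\<close>

definition coarsen :: "('c \<Rightarrow> real) \<Rightarrow> ('c \<Rightarrow> real) \<Rightarrow> 'c \<times> real \<Rightarrow> 'c \<times> real" where
  "coarsen lo hi = (\<lambda>(c, u).
     if u = - 1 then (c, u)
     else if c \<noteq> r \<and> hi c \<le> u then (up c, - 1)
     else if u < lo c then (c, - 1) else (c, u))"

lemma finite_kids [simp]: "finite (kids c)"
  using finT by (simp add: kids_def)

lemma neg1_notin_L: "- 1 \<notin> L"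
  using L01 by force

lemma sum_levels:
  assumes "s \<in> L" "t \<in> L" "s \<le> t"
  shows "(\<Sum>u\<in>L. if s \<le> u \<and> u < t then w u else 0) = t - s"
  using w_sum[OF assms] finL by (simp add: sum.inter_filter)

lemma wt_nonneg: "valid lo hi \<Longrightarrow> 0 \<le> wt lo hi y"
  using w_nonneg by (auto simp: wt_def valid_def split: prod.splits)

lemma wt_outside: "y \<notin> T \<times> insert (- 1) L \<Longrightarrow> wt lo hi y = 0"
  by (auto simp: wt_def split: prod.splits)

text \<open>The atom at \<open>c\<close> and the segment above \<open>c\<close> weigh
  \<open>hi c\<close> minus the \<open>hi\<close> of the kids of \<open>c\<close>; over the whole
  tree only \<open>hi r\<close> survives.\<close>

lemma sum_wt:
  assumes v: "valid lo hi"
  shows "(\<Sum>y\<in>T \<times> insert (- 1) L. wt lo hi y) = 1"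
proof -
  have "(\<Sum>y\<in>T \<times> insert (- 1) L. wt lo hi y) = (\<Sum>c\<in>T. \<Sum>u\<in>insert (- 1) L. wt lo hi (c, u))"
    by (simp add: sum.cartesian_product)
  also have "\<dots> = (\<Sum>c\<in>T. hi c - (\<Sum>d\<in>kids c. hi d))"
  proof (intro sum.cong refl)
    fix c assume c: "c \<in> T"
    have "(\<Sum>u\<in>L. wt lo hi (c, u)) = (\<Sum>u\<in>L. if lo c \<le> u \<and> u < hi c then w u else 0)"
      using c neg1_notin_L by (intro sum.cong refl) (auto simp: wt_def)
    also have "\<dots> = hi c - lo c" using c v by (intro sum_levels) (auto simp: valid_def)
    finally show "(\<Sum>u\<in>insert (- 1) L. wt lo hi (c, u)) = hi c - (\<Sum>d\<in>kids c. hi d)"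
      using finL neg1_notin_L c by (simp add: wt_def)
  qed
  also have "\<dots> = (\<Sum>c\<in>T. hi c) - (\<Sum>c\<in>T. \<Sum>d\<in>kids c. hi d)" by (simp add: sum_subtractf)
  also have "(\<Sum>c\<in>T. \<Sum>d\<in>kids c. hi d) = (\<Sum>d\<in>T - {r}. hi d)"
    unfolding kids_def using finT upT by (intro sum.group) auto
  also have "(\<Sum>c\<in>T. hi c) = hi r + (\<Sum>d\<in>T - {r}. hi d)" using finT rT by (rule sum.remove)
  finally show ?thesis using v by (simp add: valid_def)
qed

lemma pmf_nu:
  assumes v: "valid lo hi"
  shows "pmf (nu lo hi) y = wt lo hi y"
  unfolding nu_def
proof (rule pmf_embed_pmf)
  show "0 \<le> wt lo hi y" for y using wt_nonneg[OF v] .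
  let ?P = "T \<times> insert (- 1) L"
  have fin: "finite ?P" using finT finL by simp
  have "(\<integral>\<^sup>+ y. ennreal (wt lo hi y) \<partial>count_space UNIV) = (\<Sum>y\<in>?P. ennreal (wt lo hi y))"
    by (intro nn_integral_count_space'[OF fin]) (auto simp: wt_outside)
  also have "\<dots> = ennreal (\<Sum>y\<in>?P. wt lo hi y)" using wt_nonneg[OF v] by (simp add: sum_ennreal)
  also have "\<dots> = 1" using sum_wt[OF v] by simp
  finally show "(\<integral>\<^sup>+ y. ennreal (wt lo hi y) \<partial>count_space UNIV) = 1" .
qed

lemma set_nu: "valid lo hi \<Longrightarrow> set_pmf (nu lo hi) \<subseteq> T \<times> insert (- 1) L"
  using wt_outside[of _ lo hi] unfolding subset_iff set_pmf_iff by (metis pmf_nu)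

lemma pmf_map_finite:
  assumes "finite P" "set_pmf p \<subseteq> P"
  shows "pmf (map_pmf f p) y = (\<Sum>z\<in>{z\<in>P. f z = y}. pmf p z)"
proof -
  have "pmf (map_pmf f p) y = measure_pmf.prob p (f -` {y})" by (simp add: pmf_map)
  also have "\<dots> = measure_pmf.prob p {z\<in>P. f z = y}"
    using assms by (intro measure_pmf.finite_measure_eq_AE) (auto simp: AE_measure_pmf_iff)
  also have "\<dots> = (\<Sum>z\<in>{z\<in>P. f z = y}. pmf p z)"
    using assms by (intro measure_measure_pmf_finite) simp
  finally show ?thesis .
qed

lemma pmf_map_nu:
  assumes v: "valid lo hi"
  shows "pmf (map_pmf f (nu lo hi)) y = (\<Sum>z\<in>{z \<in> T \<times> insert (- 1) L. f z = y}. wt lo hi z)"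
  using pmf_map_finite[OF _ set_nu[OF v]] finT finL by (simp add: pmf_nu[OF v])

text \<open>The new atom at \<open>c\<close> gathers the old one, the levels between
  \<open>lo c\<close> and \<open>lo' c\<close> of its own segment, and the levels between
  \<open>hi' d\<close> and \<open>hi d\<close> of every kid \<open>d\<close>. These add up to
  \<open>lo' c\<close> minus the \<open>hi'\<close> of the kids.\<close>

lemma map_coarsen_nu:
  assumes v: "valid lo hi" and v': "valid lo' hi'"
    and lo: "\<And>c. c \<in> T \<Longrightarrow> lo c \<le> lo' c" and hi: "\<And>c. c \<in> T \<Longrightarrow> hi' c \<le> hi c"
  shows "map_pmf (coarsen lo' hi') (nu lo hi) = nu lo' hi'"
proof (rule pmf_eqI)
  fix y :: "'c \<times> real"
  let ?P = "T \<times> insert (- 1) L"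
  let ?S = "{z \<in> ?P. coarsen lo' hi' z = y}"
  obtain c v where y: "y = (c, v)" by fastforce
  have "(\<Sum>z\<in>?S. wt lo hi z) = wt lo' hi' y"
  proof (cases "c \<in> T")
    case False
    then have "?S = {}" using upT y by (auto simp: coarsen_def split: if_splits)
    then show ?thesis unfolding \<open>?S = {}\<close> using False by (simp add: y wt_def)
  next
    case c: True
    have vc: "lo c \<in> L" "hi c \<in> L" "lo' c \<in> L" "hi' c \<in> L" "lo' c \<le> hi' c" "lo c \<le> lo' c" "hi' c \<le> hi c"
      using v v' lo hi c by (auto simp: valid_def)
    show ?thesis
    proof (cases "v = - 1")
      case False
      have 1: "?S = (if v \<in> L \<and> lo' c \<le> v \<and> (c = r \<or> v < hi' c) then {y} else {})"
        using False c by (auto simp: y coarsen_def split: if_splits)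
      have "hi r = hi' r" using v v' by (simp add: valid_def)
      then show ?thesis unfolding 1 using False c vc by (auto simp: y wt_def)
    next
      case v1: True
      let ?A = "Pair c ` {u\<in>L. u < lo' c}" and ?B = "SIGMA d:kids c. {u\<in>L. hi' d \<le> u}"
      have S: "?S = insert (c, - 1) (?A \<union> ?B)"
        using c v1 neg1_notin_L vc L01 by (auto simp: y coarsen_def kids_def split: if_splits)
      have fin: "finite ?A" "finite ?B" using finL by auto
      have "?A \<inter> ?B = {}" using vc by auto
      moreover have "(c, - 1) \<notin> ?A \<union> ?B" using neg1_notin_L by auto
      ultimately have "(\<Sum>z\<in>?S. wt lo hi z) = wt lo hi (c, - 1) + (\<Sum>z\<in>?A. wt lo hi z) + (\<Sum>z\<in>?B. wt lo hi z)"
        unfolding S using fin by (simp add: sum.union_disjoint)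
      moreover have "(\<Sum>z\<in>?A. wt lo hi z) = lo' c - lo c"
      proof -
        have "(\<Sum>z\<in>?A. wt lo hi z) = (\<Sum>u\<in>{u\<in>L. u < lo' c}. wt lo hi (c, u))"
          by (subst sum.reindex) (auto simp: inj_on_def)
        also have "\<dots> = (\<Sum>u\<in>L. if u < lo' c then wt lo hi (c, u) else 0)"
          using finL by (simp add: sum.inter_filter)
        also have "\<dots> = (\<Sum>u\<in>L. if lo c \<le> u \<and> u < lo' c then w u else 0)"
          using c vc neg1_notin_L by (intro sum.cong) (auto simp: wt_def)
        also have "\<dots> = lo' c - lo c" using vc by (intro sum_levels) auto
        finally show ?thesis .
      qed
      moreover have "(\<Sum>z\<in>?B. wt lo hi z) = (\<Sum>d\<in>kids c. hi d - hi' d)"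
      proof -
        have "(\<Sum>z\<in>?B. wt lo hi z) = (\<Sum>d\<in>kids c. \<Sum>u\<in>{u\<in>L. hi' d \<le> u}. wt lo hi (d, u))"
          using finL by (subst sum.Sigma) auto
        also have "\<dots> = (\<Sum>d\<in>kids c. hi d - hi' d)"
        proof (intro sum.cong refl)
          fix d assume d: "d \<in> kids c"
          then have dT: "d \<in> T" by (simp add: kids_def)
          then have vd: "lo d \<le> hi' d" "hi' d \<le> hi d" "hi d \<in> L" "hi' d \<in> L"
            using v v' lo[of d] hi[of d] by (auto simp: valid_def intro: order_trans)
          have "(\<Sum>u\<in>{u\<in>L. hi' d \<le> u}. wt lo hi (d, u)) = (\<Sum>u\<in>L. if hi' d \<le> u then wt lo hi (d, u) else 0)"
            using finL by (simp add: sum.inter_filter)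
          also have "\<dots> = (\<Sum>u\<in>L. if hi' d \<le> u \<and> u < hi d then w u else 0)"
            using dT vd neg1_notin_L by (intro sum.cong) (auto simp: wt_def)
          also have "\<dots> = hi d - hi' d" using vd by (intro sum_levels) auto
          finally show "(\<Sum>u\<in>{u\<in>L. hi' d \<le> u}. wt lo hi (d, u)) = hi d - hi' d" .
        qed
        finally show ?thesis .
      qed
      ultimately show ?thesis using c v1 by (simp add: y wt_def sum_subtractf)
    qed
  qed
  then show "pmf (map_pmf (coarsen lo' hi') (nu lo hi)) y = pmf (nu lo' hi') y"
    by (simp add: pmf_map_nu[OF v] pmf_nu[OF v'])
qed

end

section \<open>Gluing along two trees\<close>

text \<open>Equal images are coupled by equality, and \<open>rel_pmf\<close> lifts this coupling to
  the original distributions.\<close>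

lemma pmf_coupling:
  assumes "map_pmf q M = map_pmf f N"
  shows "\<exists>J. map_pmf fst J = M \<and> map_pmf snd J = N \<and> (\<forall>(x, y)\<in>set_pmf J. q x = f y)"
proof -
  have "rel_pmf (=) (map_pmf q M) (map_pmf f N)" using assms by (simp add: pmf.rel_eq)
  then have "rel_pmf (\<lambda>x y. q x = f y) M N" by (simp add: pmf.rel_map)
  then show ?thesis by (auto elim!: rel_pmf.cases)
qed

lemma pmf_eq_except_one:
  assumes "finite B" "set_pmf p \<subseteq> B" "set_pmf q \<subseteq> B" and eq: "\<And>y. y \<noteq> x \<Longrightarrow> pmf p y = pmf q y"
  shows "p = q"
proof (rule pmf_eqI)
  fix y
  have "pmf s x = 1 - (\<Sum>z\<in>B - {x}. pmf s z)" if "set_pmf s \<subseteq> B" for s :: "'a pmf"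
  proof -
    have "(\<Sum>z\<in>insert x B. pmf s z) = 1" using assms that by (intro sum_pmf_eq_1) auto
    then show ?thesis using assms by (simp add: sum.insert_remove)
  qed
  from this[OF assms(2)] this[OF assms(3)] have "pmf p x = pmf q x" using eq by simp
  then show "pmf p y = pmf q y" using eq by (cases "y = x") auto
qed

text \<open>As both coordinates agree on whether \<open>P\<close> holds, the spliced value hits a
  \<open>z\<close> with \<open>P z\<close> exactly when the first coordinate does, and any other
  \<open>z\<close> exactly when the second does.\<close>

lemma map_pmf_splice:
  assumes J: "map_pmf fst J = p" "map_pmf snd J = q"
    and Z: "\<And>x y. (x, y) \<in> set_pmf J \<Longrightarrow> P x \<longleftrightarrow> P y"
    and \<tau>: "\<And>z. P z \<Longrightarrow> pmf p z = pmf \<tau> z" "\<And>z. \<not> P z \<Longrightarrow> pmf q z = pmf \<tau> z"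
  shows "map_pmf (\<lambda>(x, y). if P x then x else y) J = \<tau>"
proof (rule pmf_eqI)
  fix z
  let ?f = "\<lambda>(x, y). if P x then x else y" and ?g = "if P z then fst else snd"
  have "pmf (map_pmf ?f J) z = measure_pmf.prob J (?f -` {z})" by (simp add: pmf_map)
  also have "\<dots> = measure_pmf.prob J (?g -` {z})"
    using Z by (intro measure_pmf.finite_measure_eq_AE) (auto simp: AE_measure_pmf_iff)
  also have "\<dots> = pmf (map_pmf ?g J) z" by (simp add: pmf_map)
  also have "\<dots> = pmf \<tau> z" using J \<tau> by auto
  finally show "pmf (map_pmf ?f J) z = pmf \<tau> z" .
qed

text \<open>
  \<open>Dl a\<close> and \<open>Gl a\<close> stand for the minimal elements below \<open>a\<close> and the maximal elements above \<open>a\<close>.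
  Abstracting from the order allows one of \<open>D\<close> and \<open>G\<close> to be a dummy singleton.
\<close>

locale sync_frame =
  fixes A D G :: "'a set" and Dl Gl :: "'a \<Rightarrow> 'a set" and TD TG :: "'a rel"
  assumes finD: "finite D" and finG: "finite G"
    and treeD: "tree_on D TD" and treeG: "tree_on G TG"
    and sym_TD: "sym TD" and sym_TG: "sym TG" and G_ne: "G \<noteq> {}"
    and Dl: "\<And>a. a \<in> A \<Longrightarrow> Dl a \<subseteq> D \<and> Dl a \<noteq> {} \<and> conn_in TD (Dl a)"
    and Gl: "\<And>a. a \<in> A \<Longrightarrow> Gl a \<subseteq> G \<and> Gl a \<noteq> {} \<and> conn_in TG (Gl a)"
    and Dg_conn: "\<And>g. g \<in> G \<Longrightarrow> conn_in TD {b. \<exists>a\<in>A. b \<in> Dl a \<and> g \<in> Gl a}"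
    and Dg_ne: "\<And>g. g \<in> G \<Longrightarrow> \<exists>a\<in>A. g \<in> Gl a"
    and edgeD: "\<And>b b' g a a'. \<lbrakk>(b, b') \<in> TD; a \<in> A; b \<in> Dl a; g \<in> Gl a; a' \<in> A; b' \<in> Dl a'; g \<in> Gl a'\<rbrakk>
                  \<Longrightarrow> \<exists>a\<in>A. b \<in> Dl a \<and> b' \<in> Dl a \<and> g \<in> Gl a"
    and edgeG: "\<And>b g g' a a'. \<lbrakk>(g, g') \<in> TG; a \<in> A; b \<in> Dl a; g \<in> Gl a; a' \<in> A; b \<in> Dl a'; g' \<in> Gl a'\<rbrakk>
                  \<Longrightarrow> \<exists>a\<in>A. b \<in> Dl a \<and> g \<in> Gl a \<and> g' \<in> Gl a"

text \<open>
  \<open>l a c\<close> and \<open>h a c\<close> are the masses of the subtrees at the lower end and at the top of the segment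
  above \<open>c\<close>, and \<open>mx c\<close> means that the branching vertex \<open>c\<close> is maximal (otherwise it is minimal).
\<close>

locale grid = level_tree T r up L w + sync_frame A D G Dl Gl TD TG
  for T :: "'c set" and r :: 'c and up :: "'c \<Rightarrow> 'c" and L :: "real set" and w :: "real \<Rightarrow> real"
    and A D G :: "'a set" and Dl Gl :: "'a \<Rightarrow> 'a set" and TD TG :: "'a rel" +
  fixes mx :: "'c \<Rightarrow> bool" and l h :: "'a \<Rightarrow> 'c \<Rightarrow> real"
  assumes L0: "0 \<in> L" and L1: "1 \<in> L"
    and l_in: "\<And>a c. a \<in> A \<union> D \<union> G \<Longrightarrow> c \<in> T \<Longrightarrow> l a c \<in> L"
    and h_in: "\<And>a c. a \<in> A \<union> D \<union> G \<Longrightarrow> c \<in> T \<Longrightarrow> h a c \<in> L"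
    and l_le_h: "\<And>a c. a \<in> A \<Longrightarrow> c \<in> T \<Longrightarrow> l a c \<le> h a c"
    and kids_le: "\<And>a c. a \<in> D \<union> G \<Longrightarrow> c \<in> T \<Longrightarrow> kids c \<noteq> {} \<Longrightarrow> (\<Sum>d\<in>kids c. h a d) \<le> l a c"
    and l_D: "\<And>a b c. \<lbrakk>a \<in> A; b \<in> Dl a; c \<in> T; kids c \<noteq> {}; mx c\<rbrakk> \<Longrightarrow> l b c \<le> l a c"
    and h_D: "\<And>a b d. \<lbrakk>a \<in> A; b \<in> Dl a; d \<in> T; d \<noteq> r; mx (up d)\<rbrakk> \<Longrightarrow> h a d \<le> h b d"
    and l_G: "\<And>a g c. \<lbrakk>a \<in> A; g \<in> Gl a; c \<in> T; kids c \<noteq> {}; \<not> mx c\<rbrakk> \<Longrightarrow> l g c \<le> l a c"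
    and h_G: "\<And>a g d. \<lbrakk>a \<in> A; g \<in> Gl a; d \<in> T; d \<noteq> r; \<not> mx (up d)\<rbrakk> \<Longrightarrow> h a d \<le> h g d"
begin

text \<open>The pairs that occur as nodes: some index lies between them.\<close>

definition inc :: "'a \<Rightarrow> 'a \<Rightarrow> bool" where
  "inc b g \<longleftrightarrow> (\<exists>a\<in>A. b \<in> Dl a \<and> g \<in> Gl a)"

text \<open>Repeated arguments give the stretch of one pair; distinct ones give the intersection of
  the stretches of two pairs, to which both are coarsened. The default \<open>0\<close> leaves a
  leaf without an atom, its mass being spread over levels.\<close>

definition lo :: "'a \<Rightarrow> 'a \<Rightarrow> 'a \<Rightarrow> 'a \<Rightarrow> 'c \<Rightarrow> real" where
  "lo b b' g g' c =
     (if kids c = {} then 0 else if mx c then max (l b c) (l b' c) else max (l g c) (l g' c))"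

definition hi :: "'a \<Rightarrow> 'a \<Rightarrow> 'a \<Rightarrow> 'a \<Rightarrow> 'c \<Rightarrow> real" where
  "hi b b' g g' c =
     (if c = r then 1 else if mx (up c) then min (h b c) (h b' c) else min (h g c) (h g' c))"

definition nd :: "'a \<Rightarrow> 'a \<Rightarrow> ('c \<times> real) pmf" where
  "nd b g = nu (lo b b g g) (hi b b g g)"

definition K :: "'a \<Rightarrow> 'a \<Rightarrow> 'a \<Rightarrow> 'a \<Rightarrow> 'c \<times> real \<Rightarrow> 'c \<times> real" where
  "K b b' g g' = coarsen (lo b b' g g') (hi b b' g g')"

lemma inc_in: "inc b g \<Longrightarrow> b \<in> D \<and> g \<in> G"
  using Dl Gl unfolding inc_def by blast

lemma lo_comm: "lo b b' g g' = lo b' b g g'" "lo b b' g g' = lo b b' g' g"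
  by (auto simp: lo_def max_def)

lemma hi_comm: "hi b b' g g' = hi b' b g g'" "hi b b' g g' = hi b b' g' g"
  by (auto simp: hi_def min_def)

lemma K_comm: "K b b' g g' = K b' b g g'" "K b b' g g' = K b b' g' g"
  unfolding K_def by (metis lo_comm(1) hi_comm(1), metis lo_comm(2) hi_comm(2))

lemma kids_up: "c \<in> T \<Longrightarrow> c \<noteq> r \<Longrightarrow> kids (up c) \<noteq> {}"
  unfolding kids_def by blast

lemma h_nonneg: "a \<in> A \<union> D \<union> G \<Longrightarrow> c \<in> T \<Longrightarrow> 0 \<le> h a c"
  using h_in L01 by fastforce

text \<open>The stretch of an index \<open>a\<close> between all four lies inside each of theirs,
  which forces \<open>lo\<close> below \<open>hi\<close>. The inequality for the kids holds since
  the lower cut at \<open>c\<close> and the upper cuts of the segments hanging from \<open>c\<close>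
  are governed by the same side, \<open>b\<close> or \<open>g\<close>, according to
  \<open>mx c\<close>.\<close>

lemma valid4:
  assumes a: "a \<in> A" and b: "b \<in> Dl a" "b' \<in> Dl a" and g: "g \<in> Gl a" "g' \<in> Gl a"
  shows "valid (lo b b' g g') (hi b b' g g')"
  unfolding valid_def
proof (intro conjI ballI)
  fix c assume c: "c \<in> T"
  have bD: "b \<in> D" "b' \<in> D" "g \<in> G" "g' \<in> G" using Dl Gl a b g by blast+
  show "lo b b' g g' c \<in> L" using bD c l_in L0 by (auto simp: lo_def max_def)
  show "hi b b' g g' c \<in> L" using bD c h_in L1 by (auto simp: hi_def min_def)
  have "lo b b' g g' c \<le> (if kids c = {} then 0 else l a c)"
    using l_D[OF a _ c] l_G[OF a _ c] b g by (auto simp: lo_def)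
  also have "\<dots> \<le> h a c" using l_le_h[OF a c] h_nonneg[of a c] a c by auto
  also have "h a c \<le> hi b b' g g' c"
    using h_D[OF a _ c] h_G[OF a _ c] b g h_in[of a c] L01 a c by (auto simp: hi_def)
  finally show "lo b b' g g' c \<le> hi b b' g g' c" .
  show "(\<Sum>d\<in>kids c. hi b b' g g' d) \<le> lo b b' g g' c"
  proof (cases "kids c = {}")
    case True then show ?thesis by (simp add: lo_def)
  next
    case False
    have "(\<Sum>d\<in>kids c. hi b b' g g' d) \<le> (\<Sum>d\<in>kids c. h (if mx c then b else g) d)"
      by (intro sum_mono) (auto simp: hi_def kids_def)
    also have "\<dots> \<le> l (if mx c then b else g) c" using bD c False by (intro kids_le) auto
    also have "\<dots> \<le> lo b b' g g' c" using False by (auto simp: lo_def)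
    finally show ?thesis .
  qed
qed (simp add: hi_def)

lemma valid_nd: "inc b g \<Longrightarrow> valid (lo b b g g) (hi b b g g)"
  using valid4 unfolding inc_def by blast

lemma map_K_nd:
  assumes "a \<in> A" "b \<in> Dl a" "b' \<in> Dl a" "g \<in> Gl a" "g' \<in> Gl a"
  shows "map_pmf (K b b' g g') (nd b g) = nu (lo b b' g g') (hi b b' g g')"
  unfolding K_def nd_def
  by (rule map_coarsen_nu[OF valid4 valid4, OF assms(1,2,2,4,4) assms])
    (auto simp: lo_def hi_def)

lemma set_nd:
  assumes "inc b g" "(c, u) \<in> set_pmf (nd b g)"
  shows "c \<in> T" "u = - 1 \<or> u \<in> L \<and> lo b b g g c \<le> u \<and> u < hi b b g g c"
  using assms(2) pmf_nu[OF valid_nd[OF assms(1)], of "(c, u)"]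
  by (auto simp: set_pmf_iff nd_def wt_def split: if_splits)

text \<open>On a segment from a minimal lower end to a maximal upper one the lower cut comes from
  \<open>g\<close> and the upper cut from \<open>b\<close>; an index between \<open>b\<close> and
  \<open>g\<close> separates them.\<close>

lemma cross_G:
  assumes "inc b g" "c \<in> T" "kids c \<noteq> {}" "\<not> mx c" "c \<noteq> r" "mx (up c)"
  shows "l g c \<le> h b c"
proof -
  obtain a where a: "a \<in> A" "b \<in> Dl a" "g \<in> Gl a" using assms(1) by (auto simp: inc_def)
  have "l g c \<le> l a c" using a assms by (intro l_G)
  also have "\<dots> \<le> h a c" using a assms by (intro l_le_h)
  also have "\<dots> \<le> h b c" using a assms by (intro h_D)
  finally show ?thesis .
qed

lemma cross_D:
  assumes "inc b g" "c \<in> T" "kids c \<noteq> {}" "mx c" "c \<noteq> r" "\<not> mx (up c)"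
  shows "l b c \<le> h g c"
proof -
  obtain a where a: "a \<in> A" "b \<in> Dl a" "g \<in> Gl a" using assms(1) by (auto simp: inc_def)
  have "l b c \<le> l a c" using a assms by (intro l_D)
  also have "\<dots> \<le> h a c" using a assms by (intro l_le_h)
  also have "\<dots> \<le> h g c" using a assms by (intro h_G)
  finally show ?thesis .
qed

text \<open>
  \<open>zb g g' y\<close> is the vertex (not \<open>mx\<close>) into which \<open>K b b g g'\<close> collapses the point \<open>y\<close>; it does
  not depend on \<open>b\<close>, and moving along an edge of \<open>TD\<close> keeps such a point fixed.
\<close>

definition zb :: "'a \<Rightarrow> 'a \<Rightarrow> 'c \<times> real \<Rightarrow> 'c option" where
  "zb g g' = (\<lambda>(c, u).
     if kids c \<noteq> {} \<and> \<not> mx c \<and> (u = - 1 \<or> u < max (l g c) (l g' c)) then Some c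
     else if c \<noteq> r \<and> \<not> mx (up c) \<and> u \<noteq> - 1 \<and> min (h g c) (h g' c) \<le> u then Some (up c)
     else None)"

text \<open>The minimal branching vertex at which an atom sits, if any: what \<open>zb\<close>
  predicts, read off after the coarsening.\<close>

definition zat :: "'c \<times> real \<Rightarrow> 'c option" where
  "zat = (\<lambda>(c, u). if u = - 1 \<and> kids c \<noteq> {} \<and> \<not> mx c then Some c else None)"

lemma zb_comm: "zb g g' = zb g' g"
proof -
  have "max (l g c) (l g' c) = max (l g' c) (l g c)" "min (h g c) (h g' c) = min (h g' c) (h g c)" for c
    by (simp_all add: max_def min_def)
  then show ?thesis unfolding zb_def by presburger
qed

lemma zat_K:
  assumes a: "a \<in> A" "b \<in> Dl a" "g \<in> Gl a" "g' \<in> Gl a" and y: "y \<in> set_pmf (nd b g)"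
  shows "zat (K b b g g' y) = zb g g' y"
proof -
  obtain c u where cu: "y = (c, u)" by fastforce
  have inc: "inc b g" using a by (auto simp: inc_def)
  have c: "c \<in> T" and u: "u = - 1 \<or> u \<in> L \<and> lo b b g g c \<le> u \<and> u < hi b b g g c"
    using set_nd[OF inc] y cu by auto
  have le: "lo b b g g' c \<le> hi b b g g' c" using valid4[OF a(1,2,2,3,4)] c by (simp add: valid_def)
  have ku: "c \<noteq> r \<Longrightarrow> kids (up c) \<noteq> {}" using kids_up c by blast
  show ?thesis
  proof (cases "u = - 1")
    case True then show ?thesis by (simp add: cu K_def coarsen_def zat_def zb_def)
  next
    case False
    show ?thesis
    proof (cases "c \<noteq> r \<and> hi b b g g' c \<le> u")
      case True
      then have nm: "\<not> mx (up c)" using u False by (auto simp: hi_def split: if_splits)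
      then have "min (h g c) (h g' c) \<le> u" using conjunct1[OF True] conjunct2[OF True] by (simp add: hi_def)
      moreover have "\<not> (kids c \<noteq> {} \<and> \<not> mx c \<and> u < max (l g c) (l g' c))"
        using True le by (cases "kids c = {}") (auto simp: lo_def)
      ultimately show ?thesis using True False nm ku
        by (auto simp: cu K_def coarsen_def zat_def zb_def)
    next
      case nt: False
      show ?thesis
      proof (cases "u < lo b b g g' c")
        case True
        then have "kids c \<noteq> {} \<and> \<not> mx c" using u False by (auto simp: lo_def split: if_splits)
        then show ?thesis using True False nt by (auto simp: cu K_def coarsen_def zat_def zb_def lo_def)
      next
        case nl: False
        then have "\<not> (kids c \<noteq> {} \<and> \<not> mx c \<and> u < max (l g c) (l g' c))" by (cases "kids c = {}") (auto simp: lo_def)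
        moreover have "\<not> (c \<noteq> r \<and> \<not> mx (up c) \<and> min (h g c) (h g' c) \<le> u)"
          using nt by (auto simp: hi_def)
        ultimately show ?thesis using False nt nl by (auto simp: cu K_def coarsen_def zat_def zb_def)
      qed
    qed
  qed
qed

text \<open>By \<open>cross_G\<close> and \<open>cross_D\<close> the parts cut off in the two
  directions are disjoint, so coarsening in the direction of \<open>b\<close> cannot disturb the
  reading for \<open>g\<close> and \<open>g'\<close>. Points that agree after this coarsening hence
  have the same reading.\<close>

lemma zb_K:
  assumes inc: "inc b g" "inc b' g" "inc b g'" "inc b' g'" and y: "y \<in> set_pmf (nd b g)"
  shows "zb g g' (K b b' g g y) = zb g g' y"
proof -
  obtain c u where cu: "y = (c, u)" by fastforce
  have c: "c \<in> T" and u: "u = - 1 \<or> u \<in> L \<and> lo b b g g c \<le> u \<and> u < hi b b g g c"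
    using set_nd[OF inc(1)] y cu by auto
  have ku: "c \<noteq> r \<Longrightarrow> kids (up c) \<noteq> {}" using kids_up c by blast
  show ?thesis
  proof (cases "u = - 1")
    case True then show ?thesis by (simp add: cu K_def coarsen_def)
  next
    case False
    show ?thesis
    proof (cases "c \<noteq> r \<and> hi b b' g g c \<le> u")
      case True
      then have m: "mx (up c)" using u False by (auto simp: hi_def split: if_splits)
      have "\<not> (kids c \<noteq> {} \<and> \<not> mx c \<and> u < max (l g c) (l g' c))"
      proof
        assume *: "kids c \<noteq> {} \<and> \<not> mx c \<and> u < max (l g c) (l g' c)"
        then have "max (l g c) (l g' c) \<le> min (h b c) (h b' c)"
          using cross_G inc c m True by auto
        then show False using * True m by (auto simp: hi_def)
      qed
      then show ?thesis using True False m by (auto simp: cu K_def coarsen_def zb_def)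
    next
      case nt: False
      show ?thesis
      proof (cases "u < lo b b' g g c")
        case True
        then have m: "kids c \<noteq> {} \<and> mx c" using u False by (auto simp: lo_def split: if_splits)
        have "\<not> (c \<noteq> r \<and> \<not> mx (up c) \<and> min (h g c) (h g' c) \<le> u)"
        proof
          assume *: "c \<noteq> r \<and> \<not> mx (up c) \<and> min (h g c) (h g' c) \<le> u"
          then have "max (l b c) (l b' c) \<le> min (h g c) (h g' c)"
            using cross_D inc c m by auto
          then show False using * True m by (auto simp: lo_def)
        qed
        then show ?thesis using True False m nt by (auto simp: cu K_def coarsen_def zb_def)
      next
        case nl: False
        then show ?thesis using False nt by (auto simp: cu K_def coarsen_def)
      qed
    qed
  qed
qed

text \<open>Such a point is affected only by the cuts of \<open>b\<close> and \<open>b'\<close>, and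
  these are the same in both columns.\<close>

lemma K_eq_of_zb_None:
  assumes "zb g g' y = None"
  shows "K b b' g g y = K b b' g' g' y"
  using assms by (cases y) (auto simp: zb_def K_def coarsen_def lo_def hi_def split: if_splits)

lemma pmf_nd_zb_None:
  assumes inc: "inc b g" "inc b g'" and z: "zb g g' z = None"
  shows "pmf (nd b g) z = pmf (nd b g') z"
proof -
  obtain c u where cu: "z = (c, u)" by fastforce
  have "(\<Sum>d\<in>kids c. hi b b g g d) = (\<Sum>d\<in>kids c. hi b b g' g' d)" if "kids c = {} \<or> mx c"
    using that by (intro sum.cong) (auto simp: hi_def kids_def)
  then have "wt (lo b b g g) (hi b b g g) z = wt (lo b b g' g') (hi b b g' g') z"
    using z by (auto simp: cu wt_def zb_def lo_def hi_def split: if_splits)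
  then show ?thesis using inc by (simp add: nd_def pmf_nu valid_nd)
qed

text \<open>The points in question are near minimal branching vertices, where by the cross
  inequalities the cuts of \<open>b\<close> do not reach.\<close>

lemma pmf_nd_zb_Some:
  assumes inc: "inc b g" "inc b g'" "inc b0 g" "inc b0 g'" and z: "zb g g' z \<noteq> None"
  shows "pmf (nd b g') z = pmf (nd b0 g') z"
proof -
  obtain c u where cu: "z = (c, u)" by fastforce
  have "wt (lo b b g' g') (hi b b g' g') z = wt (lo b0 b0 g' g') (hi b0 b0 g' g') z"
  proof (cases "c \<in> T")
    case c: True
    show ?thesis
    proof (cases "kids c \<noteq> {} \<and> \<not> mx c \<and> (u = - 1 \<or> u < max (l g c) (l g' c))")
      case k: True
      have "(\<Sum>d\<in>kids c. hi b b g' g' d) = (\<Sum>d\<in>kids c. hi b0 b0 g' g' d)"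
        using k by (intro sum.cong) (auto simp: hi_def kids_def)
      moreover have "max (l g c) (l g' c) \<le> h b c \<and> max (l g c) (l g' c) \<le> h b0 c" if "c \<noteq> r" "mx (up c)"
        using cross_G inc c k that by simp
      ultimately show ?thesis using c k
        by (auto simp: cu wt_def lo_def hi_def split: if_splits)
    next
      case False
      then have k: "c \<noteq> r" "\<not> mx (up c)" "u \<noteq> - 1" "min (h g c) (h g' c) \<le> u"
        using z by (auto simp: cu zb_def split: if_splits)
      have "l b c \<le> min (h g c) (h g' c) \<and> l b0 c \<le> min (h g c) (h g' c)" if "kids c \<noteq> {}" "mx c"
        using cross_D inc c k that by simp
      then have "(lo b b g' g' c \<le> u \<and> u < hi b b g' g' c) = (lo b0 b0 g' g' c \<le> u \<and> u < hi b0 b0 g' g' c)"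
        using k by (cases "kids c = {}"; cases "mx c") (auto simp: lo_def hi_def)
      then show ?thesis using c k by (simp add: cu wt_def)
    qed
  qed (simp add: cu wt_def)
  then show ?thesis using inc by (simp add: nd_def pmf_nu valid_nd)
qed

text \<open>After coarsening to the common stretch, \<open>zb\<close> reads off the atoms at minimal
  branching vertices, and their masses involve \<open>g\<close> and \<open>g'\<close> only. The mass
  of \<open>None\<close> is then determined by total mass one.\<close>

lemma map_zb_nd:
  assumes a: "a \<in> A" "b \<in> Dl a" "g \<in> Gl a" "g' \<in> Gl a"
    and a0: "a0 \<in> A" "b0 \<in> Dl a0" "g \<in> Gl a0" "g' \<in> Gl a0"
  shows "map_pmf (zb g g') (nd b g) = map_pmf (zb g g') (nd b0 g')"
proof -
  define p where "p b = nu (lo b b g g') (hi b b g g')" for b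
  have p: "map_pmf (zb g g') (nd b g) = map_pmf zat (p b)" "map_pmf (zb g g') (nd b g') = map_pmf zat (p b)"
    if a: "a \<in> A" "b \<in> Dl a" "g \<in> Gl a" "g' \<in> Gl a" for a b
  proof -
    have "map_pmf (zb g g') (nd b g) = map_pmf zat (map_pmf (K b b g g') (nd b g))"
      unfolding pmf.map_comp using zat_K[OF a] by (intro pmf.map_cong) auto
    also have "\<dots> = map_pmf zat (p b)" using map_K_nd[OF a(1,2,2,3,4)] by (simp add: p_def)
    finally show "map_pmf (zb g g') (nd b g) = map_pmf zat (p b)" .
    have "map_pmf (zb g g') (nd b g') = map_pmf zat (map_pmf (K b b g' g) (nd b g'))"
      unfolding pmf.map_comp using zat_K[OF a(1,2,4,3)] by (intro pmf.map_cong) (auto simp: zb_comm)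
    also have "map_pmf (K b b g' g) (nd b g') = nu (lo b b g' g) (hi b b g' g)"
      using map_K_nd[OF a(1,2,2,4,3)] .
    also have "\<dots> = p b" unfolding p_def using lo_comm(2)[of b b g' g] hi_comm(2)[of b b g' g] by simp
    finally show "map_pmf (zb g g') (nd b g') = map_pmf zat (p b)" .
  qed
  have v: "valid (lo b b g g') (hi b b g g')" "valid (lo b0 b0 g g') (hi b0 b0 g g')"
    using valid4 a a0 by blast+
  have "map_pmf zat (p b) = map_pmf zat (p b0)"
  proof (rule pmf_eq_except_one[of "insert None (Some ` T)" _ _ None])
    have "zat ` (T \<times> insert (- 1) L) \<subseteq> insert None (Some ` T)"
      by (auto simp: zat_def split: if_splits)
    then show "set_pmf (map_pmf zat (p b)) \<subseteq> insert None (Some ` T)"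
      "set_pmf (map_pmf zat (p b0)) \<subseteq> insert None (Some ` T)"
      using set_nu[OF v(1)] set_nu[OF v(2)] by (auto simp: p_def simp del: mem_Sigma_iff)
    fix y :: "'c option" assume "y \<noteq> None"
    then obtain c where y: "y = Some c" by blast
    have "pmf (map_pmf zat (p b)) y = (if c \<in> T \<and> kids c \<noteq> {} \<and> \<not> mx c
            then max (l g c) (l g' c) - (\<Sum>d\<in>kids c. min (h g d) (h g' d)) else 0)"
      if v: "valid (lo b b g g') (hi b b g g')" for b
    proof -
      have "{z \<in> T \<times> insert (- 1) L. zat z = y} = (if c \<in> T \<and> kids c \<noteq> {} \<and> \<not> mx c then {(c, - 1)} else {})"
        by (auto simp: y zat_def split: if_splits)
      moreover have "(\<Sum>d\<in>kids c. hi b b g g' d) = (\<Sum>d\<in>kids c. min (h g d) (h g' d))" if "\<not> mx c"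
        using that by (intro sum.cong) (auto simp: hi_def kids_def)
      ultimately show ?thesis
        unfolding p_def pmf_map_nu[OF v] by (auto simp: wt_def lo_def)
    qed
    then show "pmf (map_pmf zat (p b)) y = pmf (map_pmf zat (p b0)) y" using v by simp
  qed (use finT in auto)
  then show ?thesis using p(1)[OF a] p(2)[OF a0] by simp
qed

end

section \<open>Joint laws of the random points, built column by column\<close>

context grid
begin

text \<open>Agreement after the common coarsening along an edge of either tree; other pairs of nodes
  are unconstrained.\<close>

definition R :: "'a \<times> 'a \<Rightarrow> 'a \<times> 'a \<Rightarrow> 'c \<times> real \<Rightarrow> 'c \<times> real \<Rightarrow> bool" where
  "R = (\<lambda>(b, g) (b', g') y z.
     (g = g' \<and> (b, b') \<in> TD \<longrightarrow> K b b' g g y = K b b' g g z) \<and>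
     (b = b' \<and> (g, g') \<in> TG \<longrightarrow> K b b g g' y = K b b g g' z))"

text \<open>Sample points assign a value to every pair, but only the values on \<open>N\<close> are
  constrained; a new node is thus a function update.\<close>

definition joint :: "('a \<times> 'a) set \<Rightarrow> ('a \<times> 'a \<Rightarrow> 'c \<times> real) pmf \<Rightarrow> bool" where
  "joint N M \<longleftrightarrow>
     (\<forall>n\<in>N. map_pmf (\<lambda>\<omega>. \<omega> n) M = nd (fst n) (snd n)) \<and>
     (\<forall>\<omega>\<in>set_pmf M. \<forall>n\<in>N. \<forall>m\<in>N. R n m (\<omega> n) (\<omega> m))"

lemma R_sym: "R n m y z \<Longrightarrow> R m n z y"
  using sym_TD sym_TG K_comm unfolding R_def sym_def by (auto split: prod.splits)

lemma R_refl: "R n n y y"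
  by (auto simp: R_def split: prod.splits)

lemma joint_marginal: "joint N M \<Longrightarrow> (b, g) \<in> N \<Longrightarrow> map_pmf (\<lambda>\<omega>. \<omega> (b, g)) M = nd b g"
  unfolding joint_def by fastforce

lemma joint_in_nd: "joint N M \<Longrightarrow> (b, g) \<in> N \<Longrightarrow> \<omega> \<in> set_pmf M \<Longrightarrow> \<omega> (b, g) \<in> set_pmf (nd b g)"
  by (metis (no_types, lifting) image_eqI joint_marginal set_map_pmf)

lemma joint_R: "joint N M \<Longrightarrow> \<omega> \<in> set_pmf M \<Longrightarrow> n \<in> N \<Longrightarrow> m \<in> N \<Longrightarrow> R n m (\<omega> n) (\<omega> m)"
  unfolding joint_def by blast

lemma joint_empty: "\<exists>M. joint {} M"
  by (simp add: joint_def)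

text \<open>The new point is tied to the old ones by the statistic \<open>q\<close> alone, so all
  agreements required of it must follow from \<open>q \<omega> = f y\<close>.\<close>

lemma joint_insert:
  assumes M: "joint N M" and n: "n \<notin> N"
    and q: "map_pmf q M = map_pmf f (nd (fst n) (snd n))"
    and R: "\<And>\<omega> y m. \<omega> \<in> set_pmf M \<Longrightarrow> q \<omega> = f y \<Longrightarrow> m \<in> N \<Longrightarrow> R n m y (\<omega> m)"
  shows "\<exists>M'. joint (insert n N) M'"
proof -
  obtain J where J: "map_pmf fst J = M" "map_pmf snd J = nd (fst n) (snd n)"
    "\<And>x y. (x, y) \<in> set_pmf J \<Longrightarrow> q x = f y"
    using pmf_coupling[OF q] by blast
  define M' where "M' = map_pmf (\<lambda>(\<omega>, y). fun_upd \<omega> n y) J"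
  have "map_pmf (\<lambda>\<omega>. \<omega> m) M' = nd (fst m) (snd m)" if "m \<in> insert n N" for m
  proof (cases "m = n")
    case True
    have "map_pmf (\<lambda>\<omega>. \<omega> m) M' = map_pmf snd J"
      unfolding M'_def pmf.map_comp using True by (intro pmf.map_cong) auto
    then show ?thesis using J True by simp
  next
    case False
    have "map_pmf (\<lambda>\<omega>. \<omega> m) M' = map_pmf (\<lambda>\<omega>. \<omega> m) (map_pmf fst J)"
      unfolding M'_def pmf.map_comp using False by (intro pmf.map_cong) auto
    then show ?thesis using J False that M by (simp add: joint_def)
  qed
  moreover have "R m k (\<omega>' m) (\<omega>' k)" if "\<omega>' \<in> set_pmf M'" "m \<in> insert n N" "k \<in> insert n N" for \<omega>' m k
  proof -
    obtain \<omega> y where \<omega>: "(\<omega>, y) \<in> set_pmf J" "\<omega>' = fun_upd \<omega> n y" using \<open>\<omega>' \<in> set_pmf M'\<close> by (auto simp: M'_def)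
    have "fst (\<omega>, y) \<in> set_pmf (map_pmf fst J)" using \<omega> unfolding set_map_pmf by (rule_tac imageI)
    then have \<omega>M: "\<omega> \<in> set_pmf M" using J by simp
    have "R n m y (\<omega> m)" if "m \<in> N" for m using R[OF \<omega>M J(3)[OF \<omega>(1)] that] .
    then show ?thesis using that n \<omega> \<omega>M joint_R[OF M \<omega>M] R_refl R_sym
      by (cases "m = n"; cases "k = n") auto
  qed
  ultimately show ?thesis unfolding joint_def by blast
qed

text \<open>A node without neighbours needs no tie, hence the constant statistic.\<close>

lemma joint_add_free:
  assumes M: "joint N M" and n: "(b, g) \<notin> N"
    and iso: "\<And>b' g'. (b', g') \<in> N \<Longrightarrow> \<not> (g' = g \<and> (b, b') \<in> TD) \<and> \<not> (b' = b \<and> (g, g') \<in> TG)"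
  shows "\<exists>M'. joint (insert (b, g) N) M'"
proof (rule joint_insert[OF M n, of "\<lambda>_. ()" "\<lambda>_. ()"])
  show "map_pmf (\<lambda>_. ()) M = map_pmf (\<lambda>_. ()) (nd (fst (b, g)) (snd (b, g)))"
    by (simp add: map_pmf_const)
  show "R (b, g) m y (\<omega> m)" if "m \<in> N" for \<omega> y m
    using iso[of "fst m" "snd m"] that by (auto simp: R_def split: prod.splits)
qed

text \<open>The statistic is the common coarsening with the only neighbour \<open>(p, g)\<close>;
  both points have the same law after it.\<close>

lemma joint_add_leaf:
  assumes M: "joint N M" and n: "(b, g) \<notin> N" and p: "(p, g) \<in> N" and e: "(b, p) \<in> TD"
    and inc: "inc b g" "inc p g"
    and iso: "\<And>b' g'. (b', g') \<in> N \<Longrightarrow> (g' = g \<and> (b, b') \<in> TD \<longrightarrow> b' = p) \<and> \<not> (b' = b \<and> (g, g') \<in> TG)"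
  shows "\<exists>M'. joint (insert (b, g) N) M'"
proof (rule joint_insert[OF M n, of "\<lambda>\<omega>. K b p g g (\<omega> (p, g))" "K b p g g"])
  obtain a where a: "a \<in> A" "b \<in> Dl a" "p \<in> Dl a" "g \<in> Gl a"
    using edgeD[OF e] inc unfolding inc_def by blast
  have "map_pmf (\<lambda>\<omega>. K b p g g (\<omega> (p, g))) M = map_pmf (K b p g g) (nd p g)"
    unfolding joint_marginal[OF M p, symmetric] pmf.map_comp by (simp add: o_def)
  also have "\<dots> = map_pmf (K p b g g) (nd p g)" by (subst K_comm(1)) simp
  also have "\<dots> = nu (lo p b g g) (hi p b g g)" using map_K_nd[OF a(1,3,2,4,4)] .
  also have "\<dots> = nu (lo b p g g) (hi b p g g)" by (subst lo_comm(1), subst hi_comm(1)) simp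
  also have "\<dots> = map_pmf (K b p g g) (nd b g)" using map_K_nd[OF a(1,2,3,4,4)] by simp
  finally show "map_pmf (\<lambda>\<omega>. K b p g g (\<omega> (p, g))) M = map_pmf (K b p g g) (nd (fst (b, g)) (snd (b, g)))"
    by simp
  show "R (b, g) m y (\<omega> m)" if "K b p g g (\<omega> (p, g)) = K b p g g y" "m \<in> N" for \<omega> y m
    using iso[of "fst m" "snd m"] that by (auto simp: R_def split: prod.splits)
qed

text \<open>The column grows along \<open>TD\<close> from a parent-closed part containing the root.
  A new node has its parent as only neighbour in the column, and \<open>iso\<close> excludes
  neighbours in the other columns.\<close>

lemma joint_column:
  assumes "joint N M" and R: "rooted_at D TD t par dep"
    and X: "conn_in TD {b. inc b g}" and W: "{b. (b, g) \<in> N} \<subseteq> {b. inc b g}" "(t, g) \<in> N"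
    and cl: "\<And>b. (b, g) \<in> N \<Longrightarrow> b \<noteq> t \<Longrightarrow> (par b, g) \<in> N"
    and iso: "\<And>b g'. inc b g \<Longrightarrow> (b, g) \<notin> N \<Longrightarrow> (b, g') \<in> N \<Longrightarrow> (g, g') \<notin> TG"
  shows "\<exists>M'. joint (N \<union> {b. inc b g} \<times> {g}) M'"
  using assms(1) W cl iso
proof (induction "card ({b. inc b g} - {b. (b, g) \<in> N})" arbitrary: N M rule: less_induct)
  case less
  have XD: "{b. inc b g} \<subseteq> D" using inc_in by blast
  then have fin: "finite {b. inc b g}" using finD finite_subset by blast
  show ?case
  proof (cases "{b. (b, g) \<in> N} = {b. inc b g}")
    case True
    then have "N \<union> {b. inc b g} \<times> {g} = N" by auto
    then show ?thesis using less.prems by auto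
  next
    case False
    have "t \<in> {b. inc b g}" using less.prems by blast
    then have "\<exists>v\<in>{b. inc b g} - {b. (b, g) \<in> N}. v \<noteq> t \<and> par v \<in> {b. (b, g) \<in> N}"
      using False less.prems by (intro rooted_at_frontier[OF R XD] rooted_at_conn_closed[OF R X XD]) auto
    then obtain v where v: "inc v g" "(v, g) \<notin> N" "v \<noteq> t" "(par v, g) \<in> N" by blast
    have e: "(v, par v) \<in> TD" using R v inc_in unfolding rooted_at_def by blast
    have nb: "b' = par v" if "(b', g) \<in> N" "(v, b') \<in> TD" for b'
    proof -
      have "v \<noteq> t \<and> par v = b' \<or> b' \<noteq> t \<and> par b' = v" using R that unfolding rooted_at_def by blast
      then show ?thesis using less.prems(4)[OF that(1)] v by auto
    qed
    have "inc (par v) g" using v less.prems by blast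
    then obtain M' where M': "joint (insert (v, g) N) M'"
      using joint_add_leaf[OF less.prems(1) v(2,4) e v(1)] nb less.prems(5)[OF v(1,2)] by blast
    let ?N = "insert (v, g) N"
    have "{b. inc b g} - {b. (b, g) \<in> ?N} \<subset> {b. inc b g} - {b. (b, g) \<in> N}" using v by blast
    then have "card ({b. inc b g} - {b. (b, g) \<in> ?N}) < card ({b. inc b g} - {b. (b, g) \<in> N})"
      using fin by (intro psubset_card_mono) auto
    then have "\<exists>M'. joint (?N \<union> {b. inc b g} \<times> {g}) M'"
      using less.prems v by (intro less.hyps[OF _ M']) auto
    moreover have "?N \<union> {b. inc b g} \<times> {g} = N \<union> {b. inc b g} \<times> {g}" using v by auto
    ultimately show ?thesis by simp
  qed
qed

lemma conn_const:
  assumes X: "conn_in E X" and e: "\<And>x y. x \<in> X \<Longrightarrow> y \<in> X \<Longrightarrow> (x, y) \<in> E \<Longrightarrow> f x = f y"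
    and "x \<in> X" "y \<in> X"
  shows "f x = f y"
proof -
  have "(x, y) \<in> (E \<inter> X \<times> X)\<^sup>*" using assms unfolding conn_in_def by blast
  then show ?thesis by (induction rule: rtrancl_induct) (use e in auto)
qed

text \<open>All \<open>b\<close> incident with both columns are carried over together, since adding
  them one by one would close squares. A single \<open>y\<close> with law \<open>nd b0 g'\<close> is
  coupled to column \<open>g\<close> through \<open>zb g g'\<close>. The point at
  \<open>(b, g)\<close> is kept where \<open>zb\<close> is \<open>None\<close> and replaced by the
  common \<open>y\<close> elsewhere.\<close>

lemma joint_block:
  assumes M: "joint N M" and e: "(g, g') \<in> TG"
    and C: "C = {b. inc b g \<and> inc b g'}" "b0 \<in> C" and Cconn: "conn_in TD C"
    and N: "\<And>b. b \<in> C \<Longrightarrow> (b, g) \<in> N" "\<And>b. (b, g') \<notin> N"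
    and iso: "\<And>b g''. (b, g'') \<in> N \<Longrightarrow> (g', g'') \<in> TG \<Longrightarrow> g'' = g"
  shows "\<exists>M'. joint (N \<union> C \<times> {g'}) M'"
proof -
  have ab: "\<exists>a. a \<in> A \<and> b \<in> Dl a \<and> g \<in> Gl a \<and> g' \<in> Gl a" if "b \<in> C" for b
    using edgeG[OF e] that C(1) unfolding inc_def by blast
  obtain a0 where a0: "a0 \<in> A" "b0 \<in> Dl a0" "g \<in> Gl a0" "g' \<in> Gl a0" using ab C by blast
  have "map_pmf (\<lambda>\<omega>. zb g g' (\<omega> (b0, g))) M = map_pmf (zb g g') (nd b0 g)"
    unfolding joint_marginal[OF M N(1)[OF C(2)], symmetric] pmf.map_comp by (simp add: o_def)
  also have "\<dots> = map_pmf (zb g g') (nd b0 g')" using map_zb_nd[OF a0 a0] .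
  finally obtain J where J: "map_pmf fst J = M" "map_pmf snd J = nd b0 g'"
    "\<And>\<omega> y. (\<omega>, y) \<in> set_pmf J \<Longrightarrow> zb g g' (\<omega> (b0, g)) = zb g g' y"
    using pmf_coupling[of "\<lambda>\<omega>. zb g g' (\<omega> (b0, g))" M] by blast
  have inM: "\<omega> \<in> set_pmf M" if "(\<omega>, y) \<in> set_pmf J" for \<omega> y
  proof -
    have "fst (\<omega>, y) \<in> set_pmf (map_pmf fst J)" using that unfolding set_map_pmf by (rule imageI)
    then show ?thesis using J by simp
  qed
  \<comment> \<open>By \<open>zb_K\<close> the reading survives the coarsening along an edge of
    \<open>TD\<close>, after which the points at the two ends agree.\<close>
  have zbC: "zb g g' (\<omega> (b, g)) = zb g g' (\<omega> (b', g))" if \<omega>: "\<omega> \<in> set_pmf M" and "b \<in> C" "b' \<in> C" for \<omega> b b'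
  proof (rule conn_const[OF Cconn _ that(2,3)])
    fix x y assume xy: "x \<in> C" "y \<in> C" "(x, y) \<in> TD"
    have "R (x, g) (y, g) (\<omega> (x, g)) (\<omega> (y, g))" using joint_R[OF M \<omega>] N xy by blast
    then have K: "K x y g g (\<omega> (x, g)) = K x y g g (\<omega> (y, g))" using xy by (simp add: R_def)
    have inc: "inc x g" "inc y g" "inc x g'" "inc y g'" using xy C by auto
    have "zb g g' (\<omega> (x, g)) = zb g g' (K x y g g (\<omega> (x, g)))"
      using zb_K[OF inc] joint_in_nd[OF M N(1) \<omega>] xy by simp
    also have "\<dots> = zb g g' (K y x g g (\<omega> (y, g)))" using K by (subst K_comm(1)) simp
    also have "\<dots> = zb g g' (\<omega> (y, g))"
      using zb_K[OF inc(2,1,4,3)] joint_in_nd[OF M N(1) \<omega>] xy by simp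
    finally show "zb g g' (\<omega> (x, g)) = zb g g' (\<omega> (y, g))" .
  qed
  define F where "F = (\<lambda>(\<omega>, y). \<lambda>n. if n \<in> C \<times> {g'} then
      (if zb g g' (\<omega> (fst n, g)) = None then \<omega> (fst n, g) else y) else \<omega> n :: 'c \<times> real)"
  define M' where "M' = map_pmf F J"
  have marg_old: "map_pmf (\<lambda>\<omega>. \<omega> n) M' = nd (fst n) (snd n)" if n: "n \<in> N" for n
  proof -
    have "n \<notin> C \<times> {g'}" using N(2) n by auto
    then have "map_pmf (\<lambda>\<omega>. \<omega> n) M' = map_pmf (\<lambda>\<omega>. \<omega> n) (map_pmf fst J)"
      unfolding M'_def pmf.map_comp by (intro pmf.map_cong) (auto simp: F_def)
    then show ?thesis using J n M by (simp add: joint_def)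
  qed
  have marg_new: "map_pmf (\<lambda>\<omega>. \<omega> (b, g')) M' = nd b g'" if b: "b \<in> C" for b
  proof -
    have inc: "inc b g" "inc b g'" "inc b0 g" "inc b0 g'" using b C by auto
    let ?J = "map_pmf (\<lambda>(\<omega>, y). (\<omega> (b, g), y)) J"
    have "map_pmf (\<lambda>\<omega>. \<omega> (b, g')) M' = map_pmf (\<lambda>(x, y). if zb g g' x = None then x else y) ?J"
      unfolding M'_def pmf.map_comp using b by (intro pmf.map_cong) (auto simp: F_def)
    \<comment> \<open>Where \<open>zb\<close> is \<open>None\<close>, \<open>nd b g\<close> already
      has the required weights; elsewhere \<open>nd b0 g'\<close> has them.\<close>
    also have "\<dots> = nd b g'"
    proof (rule map_pmf_splice)
      have "map_pmf fst ?J = map_pmf (\<lambda>\<omega>. \<omega> (b, g)) (map_pmf fst J)"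
        unfolding pmf.map_comp by (intro pmf.map_cong) auto
      then show "map_pmf fst ?J = nd b g" using J joint_marginal[OF M N(1)[OF b]] by simp
      have "map_pmf snd ?J = map_pmf snd J" unfolding pmf.map_comp by (intro pmf.map_cong) auto
      then show "map_pmf snd ?J = nd b0 g'" using J by simp
      show "zb g g' x = None \<longleftrightarrow> zb g g' y = None" if xy: "(x, y) \<in> set_pmf ?J" for x y
      proof -
        obtain \<omega> where \<omega>: "(\<omega>, y) \<in> set_pmf J" "x = \<omega> (b, g)" using xy by auto
        then show ?thesis using zbC[OF inM[OF \<omega>(1)] b C(2)] J(3)[OF \<omega>(1)] by simp
      qed
      show "pmf (nd b g) z = pmf (nd b g') z" if "zb g g' z = None" for z
        using pmf_nd_zb_None[OF inc(1,2) that] .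
      show "pmf (nd b0 g') z = pmf (nd b g') z" if "zb g g' z \<noteq> None" for z
        using pmf_nd_zb_Some[OF inc that] by simp
    qed
    finally show ?thesis .
  qed
  have "R m k (\<omega>' m) (\<omega>' k)" if \<omega>': "\<omega>' \<in> set_pmf M'" and mk: "m \<in> N \<union> C \<times> {g'}" "k \<in> N \<union> C \<times> {g'}" for \<omega>' m k
  proof -
    obtain \<omega> y where \<omega>: "(\<omega>, y) \<in> set_pmf J" "\<omega>' = F (\<omega>, y)" using \<omega>' by (auto simp: M'_def)
    note \<omega>M = inM[OF \<omega>(1)]
    have old: "\<omega>' n = \<omega> n" if "n \<in> N" for n using that N(2) \<omega> by (auto simp: F_def)
    have new: "\<omega>' (b, g') = (if zb g g' (\<omega> (b, g)) = None then \<omega> (b, g) else y)" if "b \<in> C" for b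
      using that \<omega> by (simp add: F_def)
    have newsupp: "\<omega>' (b, g') \<in> set_pmf (nd b g')" if "b \<in> C" for b
      unfolding marg_new[OF that, symmetric] set_map_pmf using \<omega>' by blast
    have NC: "R (b, g') n (\<omega>' (b, g')) (\<omega>' n)" if b: "b \<in> C" and n: "n \<in> N" for b n
    proof -
      \<comment> \<open>Either the point was kept, or both coarsened points are the atom at the
        vertex named by \<open>zb\<close>.\<close>
      have "K b b g' g (\<omega>' (b, g')) = K b b g' g (\<omega> (b, g))"
      proof (cases "zb g g' (\<omega> (b, g))")
        case None then show ?thesis using new[OF b] by simp
      next
        case (Some c)
        obtain a where a: "a \<in> A" "b \<in> Dl a" "g \<in> Gl a" "g' \<in> Gl a" using ab b by blast
        have "zb g g' y = Some c" using zbC[OF \<omega>M b C(2)] J(3)[OF \<omega>(1)] Some by simp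
        moreover have "\<omega>' (b, g') = y" using new[OF b] Some by simp
        ultimately have 1: "zat (K b b g' g (\<omega>' (b, g'))) = Some c"
          using zat_K[OF a(1,2,4,3) newsupp[OF b]] zb_comm[of g g'] by simp
        have "zat (K b b g g' (\<omega> (b, g))) = Some c"
          using zat_K[OF a joint_in_nd[OF M N(1)[OF b] \<omega>M]] Some by simp
        then have 2: "zat (K b b g' g (\<omega> (b, g))) = Some c" by (subst K_comm(2))
        have zat: "z = (c, - 1)" if "zat z = Some c" for z
          using that by (auto simp: zat_def split: prod.splits if_splits)
        show ?thesis using zat[OF 1] zat[OF 2] by simp
      qed
      moreover have "snd n \<noteq> g'" using n N(2)[of "fst n"] by auto
      moreover have "snd n = g" if "fst n = b" "(g', snd n) \<in> TG"
        using iso[of b "snd n"] n that by (metis prod.collapse)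
      ultimately show ?thesis using old[OF n] by (auto simp: R_def split: prod.splits)
    qed
    have CC: "R (b, g') (b', g') (\<omega>' (b, g')) (\<omega>' (b', g'))" if b: "b \<in> C" "b' \<in> C" for b b'
    proof -
      \<comment> \<open>Kept points agree as they did in column \<open>g\<close>; replaced points
        are all equal to \<open>y\<close>.\<close>
      have "K b b' g' g' (\<omega>' (b, g')) = K b b' g' g' (\<omega>' (b', g'))" if e: "(b, b') \<in> TD"
      proof (cases "zb g g' (\<omega> (b, g))")
        case None
        then have None': "zb g g' (\<omega> (b', g)) = None" using zbC[OF \<omega>M b] by simp
        have "R (b, g) (b', g) (\<omega> (b, g)) (\<omega> (b', g))" using joint_R[OF M \<omega>M] N b by blast
        then have "K b b' g g (\<omega> (b, g)) = K b b' g g (\<omega> (b', g))" using e by (simp add: R_def)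
        then show ?thesis
          using new b None None' K_eq_of_zb_None[OF None] K_eq_of_zb_None[OF None'] by simp
      next
        case (Some c)
        then show ?thesis using new b zbC[OF \<omega>M b] by simp
      qed
      moreover have "K b b g' g' (\<omega>' (b, g')) = K b b g' g' (\<omega>' (b', g'))" if "b = b'" using that by simp
      ultimately show ?thesis by (auto simp: R_def)
    qed
    show ?thesis using mk
    proof (elim UnE)
      assume "m \<in> N" "k \<in> N" then show ?thesis using old joint_R[OF M \<omega>M] by simp
    next
      assume m: "m \<in> N" and "k \<in> C \<times> {g'}"
      then obtain b where "b \<in> C" "k = (b, g')" by auto
      then show ?thesis using R_sym[OF NC[OF _ m]] by simp
    next
      assume "m \<in> C \<times> {g'}" and k: "k \<in> N"
      then obtain b where "b \<in> C" "m = (b, g')" by auto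
      then show ?thesis using NC[OF _ k] by simp
    next
      assume "m \<in> C \<times> {g'}" "k \<in> C \<times> {g'}"
      then obtain b b' where "b \<in> C" "m = (b, g')" "b' \<in> C" "k = (b', g')" by auto
      then show ?thesis using CC by simp
    qed
  qed
  then have "joint (N \<union> C \<times> {g'}) M'" unfolding joint_def using marg_old marg_new by auto
  then show ?thesis by blast
qed

lemma inc_conn: "g \<in> G \<Longrightarrow> conn_in TD {b. inc b g}"
  using Dg_conn unfolding inc_def by simp

lemma inc_ex: "g \<in> G \<Longrightarrow> \<exists>b. inc b g"
  using Dg_ne Dl unfolding inc_def by blast

text \<open>If some \<open>b\<close> is incident with both \<open>v\<close> and its parent, the
  block of these \<open>b\<close> is the starting part of the column, and the remaining
  \<open>b\<close> have no node in the parent column. Otherwise the column starts from one free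
  node.\<close>

lemma joint_add_column:
  assumes M: "joint {(b, g). g \<in> \<Gamma> \<and> inc b g} M" and R: "rooted_at G TG tg par dep"
    and \<Gamma>: "\<And>x. x \<in> \<Gamma> \<Longrightarrow> x \<noteq> tg \<Longrightarrow> par x \<in> \<Gamma>" and v: "v \<in> G" "v \<notin> \<Gamma>" "v = tg \<or> par v \<in> \<Gamma>"
    and tg: "v = tg \<Longrightarrow> \<Gamma> = {}"
  shows "\<exists>M'. joint {(b, g). g \<in> insert v \<Gamma> \<and> inc b g} M'"
proof -
  let ?N = "{(b, g). g \<in> \<Gamma> \<and> inc b g}"
  have goal: "{(b, g). g \<in> insert v \<Gamma> \<and> inc b g} = ?N \<union> {b. inc b v} \<times> {v}" by auto
  have nb: "v \<noteq> tg \<and> g = par v" if "g \<in> \<Gamma>" "(v, g) \<in> TG" for g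
    using R \<Gamma> that v tg unfolding rooted_at_def by blast
  define C where "C = {b. inc b (par v) \<and> inc b v}"
  show ?thesis
  proof (cases "v = tg \<or> C = {}")
    case True
    obtain b0 where b0: "inc b0 v" using inc_ex v by blast
    obtain pd dd where RD: "rooted_at D TD b0 pd dd" using treeD inc_in[OF b0] unfolding tree_on_def by blast
    have iso: "(v, g) \<notin> TG" if "inc b v" "(b, g) \<in> ?N" for b g
      using nb[of g] that True by (auto simp: C_def)
    obtain M1 where M1: "joint (insert (b0, v) ?N) M1"
      using joint_add_free[OF M, of b0 v] iso[OF b0] v by blast
    have "\<exists>M'. joint (insert (b0, v) ?N \<union> {b. inc b v} \<times> {v}) M'"
      using b0 v by (intro joint_column[OF M1 RD inc_conn[OF v(1)]]) (use iso in auto)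
    moreover have "insert (b0, v) ?N \<union> {b. inc b v} \<times> {v} = ?N \<union> {b. inc b v} \<times> {v}" using b0 by auto
    ultimately show ?thesis unfolding goal by simp
  next
    case False
    then obtain b0 where b0: "b0 \<in> C" by blast
    have p: "par v \<in> \<Gamma>" "(par v, v) \<in> TG" "par v \<in> G"
      using False v R sym_TG unfolding rooted_at_def sym_def by blast+
    obtain pd dd where RD: "rooted_at D TD b0 pd dd"
      using treeD inc_in b0 unfolding tree_on_def C_def by blast
    \<comment> \<open>Seen from a root inside \<open>C\<close>, both incident sets are closed under
      parents; so is their intersection, which makes it connected.\<close>
    have cl: "pd b \<in> C" if b: "b \<in> C" "b \<noteq> b0" for b
      using rooted_at_conn_closed[OF RD inc_conn[OF v(1)], of b] rooted_at_conn_closed[OF RD inc_conn[OF p(3)], of b]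
        b b0 inc_in unfolding C_def by blast
    have CD: "C \<subseteq> D" using inc_in unfolding C_def by blast
    have up: "(b, b0) \<in> (TD \<inter> C \<times> C)\<^sup>*" if "b \<in> C" for b
      using that
    proof (induction "dd b" arbitrary: b rule: less_induct)
      case less
      show ?case
      proof (cases "b = b0")
        case False
        then have "(b, pd b) \<in> TD \<inter> C \<times> C" "dd b = Suc (dd (pd b))"
          using cl less.prems CD RD unfolding rooted_at_def by blast+
        then have "(pd b, b0) \<in> (TD \<inter> C \<times> C)\<^sup>*" by (intro less.hyps) auto
        with \<open>(b, pd b) \<in> TD \<inter> C \<times> C\<close> show ?thesis by (rule converse_rtrancl_into_rtrancl)
      qed simp
    qed
    have "sym (TD \<inter> C \<times> C)" using sym_TD by (auto simp: sym_def)
    then have "sym ((TD \<inter> C \<times> C)\<^sup>*)" by (rule sym_rtrancl)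
    then have Cconn: "conn_in TD C"
      using up unfolding conn_in_def by (blast dest: symD intro: rtrancl_trans)
    have "\<exists>M1. joint (?N \<union> C \<times> {v}) M1"
    proof (rule joint_block[OF M p(2) _ b0 Cconn])
      show "C = {b. inc b (par v) \<and> inc b v}" by (simp add: C_def)
      show "(b, par v) \<in> ?N" if "b \<in> C" for b using that p by (simp add: C_def)
      show "(b, v) \<notin> ?N" for b using v by simp
      show "g'' = par v" if "(b, g'') \<in> ?N" "(v, g'') \<in> TG" for b g'' using nb that by blast
    qed
    then obtain M1 where M1: "joint (?N \<union> C \<times> {v}) M1" by blast
    have "\<exists>M'. joint ((?N \<union> C \<times> {v}) \<union> {b. inc b v} \<times> {v}) M'"
    proof (rule joint_column[OF M1 RD inc_conn[OF v(1)]])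
      show "{b. (b, v) \<in> ?N \<union> C \<times> {v}} \<subseteq> {b. inc b v}" using v by (auto simp: C_def)
      show "(b0, v) \<in> ?N \<union> C \<times> {v}" using b0 by simp
      show "(pd b, v) \<in> ?N \<union> C \<times> {v}" if "(b, v) \<in> ?N \<union> C \<times> {v}" "b \<noteq> b0" for b
        using that cl v by auto
      show "(v, g') \<notin> TG" if *: "inc b v" "(b, v) \<notin> ?N \<union> C \<times> {v}" "(b, g') \<in> ?N \<union> C \<times> {v}" for b g'
      proof
        assume "(v, g') \<in> TG"
        then have "g' = par v" using nb * by auto
        then show False using * by (auto simp: C_def)
      qed
    qed
    moreover have "(?N \<union> C \<times> {v}) \<union> {b. inc b v} \<times> {v} = ?N \<union> {b. inc b v} \<times> {v}" by (auto simp: C_def)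
    ultimately show ?thesis unfolding goal by simp
  qed
qed

lemma joint_exists: "\<exists>M. joint {(b, g). g \<in> G \<and> inc b g} M"
proof -
  obtain tg where tg: "tg \<in> G" using G_ne by blast
  obtain par dep where R: "rooted_at G TG tg par dep" using treeG tg unfolding tree_on_def by blast
  obtain M0 where M0: "joint {(b, g). g \<in> {} \<and> inc b g} M0" using joint_empty by auto
  have "\<exists>M. joint {(b, g). g \<in> {tg} \<and> inc b g} M"
    using joint_add_column[OF M0 R, of tg] tg by simp
  then obtain M1 where M1: "joint {(b, g). g \<in> {tg} \<and> inc b g} M1" by blast
  have "\<exists>M. joint {(b, g). g \<in> G \<and> inc b g} M"
    if "joint {(b, g). g \<in> \<Gamma> \<and> inc b g} M" "tg \<in> \<Gamma>" "\<Gamma> \<subseteq> G" "\<And>x. x \<in> \<Gamma> \<Longrightarrow> x \<noteq> tg \<Longrightarrow> par x \<in> \<Gamma>" for \<Gamma> M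
    using that
  proof (induction "card (G - \<Gamma>)" arbitrary: \<Gamma> M rule: less_induct)
    case less
    show ?case
    proof (cases "\<Gamma> = G")
      case False
      then obtain v where v: "v \<in> G - \<Gamma>" "v \<noteq> tg" "par v \<in> \<Gamma>"
        using rooted_at_frontier[OF R order_refl, of \<Gamma>] less.prems rooted_at_par_in[OF R] by blast
      obtain M' where M': "joint {(b, g). g \<in> insert v \<Gamma> \<and> inc b g} M'"
        using joint_add_column[OF less.prems(1) R less.prems(4), of v] v by blast
      have "card (G - insert v \<Gamma>) < card (G - \<Gamma>)"
        using v finG by (intro psubset_card_mono) auto
      then show ?thesis using v less.prems by (intro less.hyps[OF _ M']) auto
    qed (use less.prems in blast)
  qed
  from this[OF M1] show ?thesis using tg by blast
qed

end

section \<open>Posets whose Hasse diagram is a tree\<close>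

text \<open>\<open>E\<close> is the Hasse diagram. By \<open>leaf_root\<close> the root has at most
  one child, so every branching vertex has a parent.\<close>

locale poset_tree =
  fixes S :: "'b set" and s E :: "'b rel" and t :: 'b and par :: "'b \<Rightarrow> 'b" and dep :: "'b \<Rightarrow> nat"
  assumes finS: "finite S" and po: "partial_order_on S s" and rooted: "rooted_at S E t par dep"
    and E_iff: "\<And>x y. (x, y) \<in> E \<longleftrightarrow> x \<in> S \<and> y \<in> S \<and> (covered_by s x y \<or> covered_by s y x)"
    and leaf_root: "\<And>x y. \<lbrakk>x \<in> S - {t}; y \<in> S - {t}; par x = t; par y = t\<rbrakk> \<Longrightarrow> x = y"
begin

lemma s_in: "(x, y) \<in> s \<Longrightarrow> x \<in> S \<and> y \<in> S"
  using partial_order_onD(4)[OF po] by blast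

lemma s_refl: "x \<in> S \<Longrightarrow> (x, x) \<in> s"
  using partial_order_onD(1)[OF po] by (simp add: refl_on_def)

lemma s_trans: "(x, y) \<in> s \<Longrightarrow> (y, z) \<in> s \<Longrightarrow> (x, z) \<in> s"
  using partial_order_onD(2)[OF po] by (blast dest: transD)

lemma s_antisym: "(x, y) \<in> s \<Longrightarrow> (y, x) \<in> s \<Longrightarrow> x = y"
  using partial_order_onD(3)[OF po] by (blast dest: antisymD)

lemma t_in: "t \<in> S"
  using rooted by (simp add: rooted_at_def)

lemma par_in: "x \<in> S \<Longrightarrow> x \<noteq> t \<Longrightarrow> par x \<in> S"
  by (rule rooted_at_par_in[OF rooted])

lemma dep_par: "x \<in> S \<Longrightarrow> x \<noteq> t \<Longrightarrow> dep x = Suc (dep (par x))"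
  using rooted by (simp add: rooted_at_def)

lemma cover_par: "x \<in> S \<Longrightarrow> x \<noteq> t \<Longrightarrow> covered_by s x (par x) \<or> covered_by s (par x) x"
  using rooted E_iff[of x "par x"] by (simp add: rooted_at_def)

lemma cover_in: "covered_by s x y \<Longrightarrow> x \<in> S \<and> y \<in> S"
  unfolding covered_by_def strictly_below_def using s_in by blast

lemma cover_cases:
  assumes "covered_by s x y" shows "x \<noteq> t \<and> par x = y \<or> y \<noteq> t \<and> par y = x"
proof -
  have "(x, y) \<in> E" using E_iff cover_in assms by simp
  then show ?thesis using rooted by (simp add: rooted_at_def)
qed

definition parent :: "'b rel" where
  "parent = {(z, par z) | z. z \<in> S - {t}}"

definition sub :: "'b \<Rightarrow> 'b set" where
  "sub x = {z \<in> S. (z, x) \<in> parent\<^sup>*}"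

definition ch :: "'b \<Rightarrow> 'b set" where
  "ch x = {y \<in> S - {t}. par y = x}"

text \<open>Direction of the edge above \<open>x\<close>. It decides whether the mass of the subtree
  at \<open>x\<close> increases or decreases along the index; at \<open>t\<close> it has no
  meaning.\<close>

definition upt :: "'b \<Rightarrow> bool" where
  "upt x \<longleftrightarrow> (par x, x) \<in> s"

lemma finite_ch [simp]: "finite (ch x)"
  using finS by (simp add: ch_def)

lemma sub_in: "z \<in> sub x \<Longrightarrow> z \<in> S"
  by (simp add: sub_def)

lemma finite_sub [simp]: "finite (sub x)"
  using finS by (simp add: sub_def)

lemma sub_refl: "x \<in> S \<Longrightarrow> x \<in> sub x"
  by (simp add: sub_def)

lemma sub_step:
  assumes z: "z \<in> S" "z \<noteq> t"
  shows "z \<in> sub x \<longleftrightarrow> z = x \<or> par z \<in> sub x"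
proof -
  from z have p: "(z, par z) \<in> parent" by (auto simp: parent_def)
  show "z \<in> sub x \<longleftrightarrow> z = x \<or> par z \<in> sub x"
  proof
    assume "z \<in> sub x"
    then have "(z, x) \<in> parent\<^sup>*" by (simp add: sub_def)
    then show "z = x \<or> par z \<in> sub x"
    proof (cases rule: converse_rtranclE)
      case (step y)
      then have "y = par z" by (auto simp: parent_def)
      then show ?thesis using step z par_in by (simp add: sub_def)
    qed simp
  next
    assume "z = x \<or> par z \<in> sub x"
    moreover have "(z, x) \<in> parent\<^sup>*" if "(par z, x) \<in> parent\<^sup>*"
      using p that by (rule converse_rtrancl_into_rtrancl)
    ultimately show "z \<in> sub x" using z by (auto simp: sub_def)
  qed
qed

lemma t_sub: "t \<in> sub x \<longleftrightarrow> x = t"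
proof
  assume "t \<in> sub x"
  then have "(t, x) \<in> parent\<^sup>*" by (simp add: sub_def)
  then show "x = t" by (cases rule: converse_rtranclE) (auto simp: parent_def)
qed (use t_in sub_refl in auto)

lemma sub_trans: "x \<in> sub y \<Longrightarrow> y \<in> sub z \<Longrightarrow> x \<in> sub z"
  by (auto simp: sub_def)

lemma par_sub: "x \<in> S \<Longrightarrow> x \<noteq> t \<Longrightarrow> x \<in> sub (par x)"
  using sub_step[of x "par x"] sub_refl[OF par_in] by simp

lemma parent_dep: "(z, x) \<in> parent\<^sup>* \<Longrightarrow> dep x \<le> dep z \<and> (dep x = dep z \<longrightarrow> x = z)"
proof (induction rule: converse_rtrancl_induct)
  case (step y z)
  then have "dep y = Suc (dep z)" using dep_par[of y] by (auto simp: parent_def)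
  then show ?case using step(3) by simp
qed simp

lemma sub_dep: "z \<in> sub x \<Longrightarrow> dep x \<le> dep z"
  and sub_dep_eq: "z \<in> sub x \<Longrightarrow> dep z \<le> dep x \<Longrightarrow> z = x"
  using parent_dep[of z x] unfolding sub_def by auto

lemma sub_antisym: "x \<in> sub y \<Longrightarrow> y \<in> sub x \<Longrightarrow> x = y"
  using sub_dep[of y x] sub_dep_eq[of x y] by simp

text \<open>The ancestors of a vertex form a chain, since \<open>parent\<close> is
  single-valued.\<close>

lemma sub_comparable:
  assumes "c \<in> sub x" "c \<in> sub y" shows "x \<in> sub y \<or> y \<in> sub x"
proof -
  have "x \<in> S" if "(c, x) \<in> parent\<^sup>*" "c \<in> S" for x
    using that by (induction rule: rtrancl_induct) (auto simp: parent_def par_in)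
  then have S: "x \<in> S" "y \<in> S" using assms by (auto simp: sub_def)
  have "single_valued parent" by (auto simp: parent_def single_valued_def)
  moreover have "(c, x) \<in> parent\<^sup>*" "(c, y) \<in> parent\<^sup>*" using assms by (simp_all add: sub_def)
  ultimately have "(x, y) \<in> parent\<^sup>* \<or> (y, x) \<in> parent\<^sup>*" by (rule single_valued_confluent)
  then show ?thesis using S by (auto simp: sub_def)
qed

lemma sub_root: "sub t = S"
proof -
  have "x \<in> sub t" if "x \<in> S" for x
    using that
  proof (induction "dep x" arbitrary: x rule: less_induct)
    case less
    show ?case
    proof (cases "x = t")
      case False
      then have "par x \<in> sub t" using dep_par[OF less.prems] less.prems by (intro less.hyps par_in) auto
      then show ?thesis using sub_step[OF less.prems False] by blast
    qed (use t_in sub_refl in auto)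
  qed
  then show ?thesis using sub_in by blast
qed

lemma in_chD: "y \<in> ch x \<Longrightarrow> y \<in> S \<and> y \<noteq> t \<and> par y = x"
  by (simp add: ch_def)

lemma dep_ch: "y \<in> ch x \<Longrightarrow> dep y = Suc (dep x)"
  using dep_par in_chD by blast

lemma sub_ch: assumes "x \<in> S" shows "sub x = insert x (\<Union>y\<in>ch x. sub y)"
proof -
  have "z = x \<or> (\<exists>y\<in>ch x. z \<in> sub y)" if "(z, x) \<in> parent\<^sup>*" "z \<in> S" for z
    using that(1)
  proof (cases rule: rtranclE)
    case (step y)
    then have "y \<in> ch x" by (auto simp: parent_def ch_def)
    then show ?thesis using step that by (auto simp: sub_def)
  qed simp
  then have "sub x \<subseteq> insert x (\<Union>y\<in>ch x. sub y)" by (auto simp: sub_def)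
  moreover have "z \<in> sub x" if "y \<in> ch x" "z \<in> sub y" for y z
  proof -
    have "y \<in> sub x" using par_sub[of y] in_chD[OF that(1)] by simp
    then show ?thesis by (rule sub_trans[OF that(2)])
  qed
  ultimately show ?thesis using sub_refl[OF assms] by auto
qed

lemma ch_disjoint:
  assumes "y \<in> ch x" "y' \<in> ch x" "y \<noteq> y'" shows "sub y \<inter> sub y' = {}"
proof (rule ccontr)
  assume "sub y \<inter> sub y' \<noteq> {}"
  then obtain c where "c \<in> sub y" "c \<in> sub y'" by blast
  then have "y \<in> sub y' \<or> y' \<in> sub y" by (rule sub_comparable)
  moreover have "dep y = dep y'" using assms dep_ch by simp
  ultimately show False using sub_dep_eq[of y y'] sub_dep_eq[of y' y] assms(3) by auto
qed

lemma ch_notin: "y \<in> ch x \<Longrightarrow> x \<notin> sub y"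
  using sub_dep[of x y] dep_ch by fastforce

lemma down_induct [consumes 1, case_names node]:
  assumes "x \<in> S" and step: "\<And>x. x \<in> S \<Longrightarrow> (\<And>y. y \<in> ch x \<Longrightarrow> Q y) \<Longrightarrow> Q x"
  shows "Q x"
  using assms(1)
proof (induction "Max (dep ` S) - dep x" arbitrary: x rule: less_induct)
  case less
  show ?case
  proof (rule step[OF less.prems])
    fix y assume y: "y \<in> ch x"
    then have "dep y \<le> Max (dep ` S)" using finS in_chD by (intro Max_ge) auto
    moreover have "dep y = Suc (dep x)" "y \<in> S" using y dep_ch in_chD by auto
    ultimately show "Q y" by (intro less.hyps) auto
  qed
qed

subsection \<open>Order and stochastic order\<close>

text \<open>A pair that is neither equal nor covering splits at an intermediate element into two
  intervals with fewer elements. Closure under covers thus gives closure under the order.\<close>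

lemma covers_upto:
  assumes "(a, b) \<in> s" "a \<in> Q" and Q: "\<And>x y. x \<in> Q \<Longrightarrow> covered_by s x y \<Longrightarrow> y \<in> Q"
  shows "b \<in> Q"
  using assms(1,2)
proof (induction "card {z. (a, z) \<in> s \<and> (z, b) \<in> s}" arbitrary: a b rule: less_induct)
  case less
  have fin: "finite {z. (a, z) \<in> s \<and> (z, b) \<in> s}" for a b
    using finS s_in by (rule_tac finite_subset[of _ S]) auto
  show ?case
  proof (cases "a = b \<or> covered_by s a b")
    case False
    then obtain c where c: "(a, c) \<in> s" "a \<noteq> c" "(c, b) \<in> s" "c \<noteq> b"
      using less.prems unfolding covered_by_def strictly_below_def by blast
    have ab: "a \<in> S" "b \<in> S" using less.prems s_in by auto
    have "a \<notin> {z. (c, z) \<in> s \<and> (z, b) \<in> s}" "b \<notin> {z. (a, z) \<in> s \<and> (z, c) \<in> s}"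
      using c s_antisym by blast+
    moreover have "a \<in> {z. (a, z) \<in> s \<and> (z, b) \<in> s}" "b \<in> {z. (a, z) \<in> s \<and> (z, b) \<in> s}"
      using less.prems s_refl ab by auto
    moreover have "{z. (c, z) \<in> s \<and> (z, b) \<in> s} \<subseteq> {z. (a, z) \<in> s \<and> (z, b) \<in> s}"
      "{z. (a, z) \<in> s \<and> (z, c) \<in> s} \<subseteq> {z. (a, z) \<in> s \<and> (z, b) \<in> s}"
      using c s_trans by blast+
    ultimately have "card {z. (c, z) \<in> s \<and> (z, b) \<in> s} < card {z. (a, z) \<in> s \<and> (z, b) \<in> s}"
      "card {z. (a, z) \<in> s \<and> (z, c) \<in> s} < card {z. (a, z) \<in> s \<and> (z, b) \<in> s}"
      by (auto intro!: psubset_card_mono[OF fin])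
    then show ?thesis using less.hyps[of a c] less.hyps[of c b] c less.prems by blast
  qed (use less.prems Q in auto)
qed

lemma not_upt: "x \<in> S \<Longrightarrow> x \<noteq> t \<Longrightarrow> \<not> upt x \<Longrightarrow> (x, par x) \<in> s"
  using cover_par unfolding covered_by_def strictly_below_def upt_def by blast

lemma covered_upt: "x \<in> S \<Longrightarrow> x \<noteq> t \<Longrightarrow> upt x \<Longrightarrow> covered_by s (par x) x"
  and covered_not_upt: "x \<in> S \<Longrightarrow> x \<noteq> t \<Longrightarrow> \<not> upt x \<Longrightarrow> covered_by s x (par x)"
  using cover_par[of x] s_antisym unfolding covered_by_def strictly_below_def upt_def by blast+

text \<open>The only edge that leaves the subtree goes from \<open>x\<close> down to
  \<open>par x\<close>, so upward covers stay inside.\<close>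

lemma sub_up_set: assumes x: "x \<in> S" "x \<noteq> t" "upt x" shows "up_set S s (sub x)"
  unfolding up_set_def
proof (intro conjI ballI impI)
  fix a b assume ab: "a \<in> sub x" "(a, b) \<in> s"
  show "b \<in> sub x"
  proof (rule covers_upto[OF ab(2,1)])
    fix y z assume yz: "y \<in> sub x" "covered_by s y z"
    then have "y \<in> S" "z \<in> S" using s_in unfolding covered_by_def strictly_below_def by auto
    from cover_cases[OF yz(2)] show "z \<in> sub x"
    proof
      assume y: "y \<noteq> t \<and> par y = z"
      then have "y \<noteq> x" using x(3) yz(2) s_antisym unfolding upt_def covered_by_def strictly_below_def by blast
      then show ?thesis using sub_step \<open>y \<in> S\<close> y yz by blast
    qed (use sub_step \<open>z \<in> S\<close> yz in blast)
  qed
qed (use sub_in in auto)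

lemma compl_sub_up_set: assumes x: "x \<in> S" "x \<noteq> t" "\<not> upt x" shows "up_set S s (S - sub x)"
  unfolding up_set_def
proof (intro conjI ballI impI)
  fix a b assume ab: "a \<in> S - sub x" "(a, b) \<in> s"
  show "b \<in> S - sub x"
  proof (rule covers_upto[OF ab(2,1)])
    fix y z assume yz: "y \<in> S - sub x" "covered_by s y z"
    then have yS: "y \<in> S" "z \<in> S" using s_in unfolding covered_by_def strictly_below_def by auto
    from cover_cases[OF yz(2)] have "z \<notin> sub x"
    proof
      assume z: "z \<noteq> t \<and> par z = y"
      then have "z \<noteq> x" using x(3) yz(2) unfolding upt_def covered_by_def strictly_below_def by blast
      then show ?thesis using sub_step yS z yz by blast
    qed (use sub_step yS yz in blast)
    then show "z \<in> S - sub x" using yS by simp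
  qed
qed auto

definition mass :: "'b pmf \<Rightarrow> 'b \<Rightarrow> real" where
  "mass P x = measure_pmf.prob P (sub x)"

lemma mass_upt:
  "\<lbrakk>stochastically_le S s P P'; x \<in> S; x \<noteq> t; upt x\<rbrakk> \<Longrightarrow> mass P x \<le> mass P' x"
  using sub_up_set unfolding stochastically_le_def mass_def by blast

lemma mass_not_upt:
  assumes st: "stochastically_le S s P P'" and P: "set_pmf P \<subseteq> S" "set_pmf P' \<subseteq> S"
    and x: "x \<in> S" "x \<noteq> t" "\<not> upt x"
  shows "mass P' x \<le> mass P x"
proof -
  have "measure_pmf.prob Q (S - sub x) = 1 - mass Q x" if "set_pmf Q \<subseteq> S" for Q
  proof -
    have "measure_pmf.prob Q (S - sub x) = measure_pmf.prob Q S - mass Q x"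
      unfolding mass_def using sub_in by (intro measure_pmf.finite_measure_Diff) auto
    moreover have "measure_pmf.prob Q S = 1"
      using that by (subst measure_pmf.prob_eq_1) (auto simp: AE_measure_pmf_iff)
    ultimately show ?thesis by simp
  qed
  then show ?thesis using st compl_sub_up_set[OF x] P unfolding stochastically_le_def by fastforce
qed

lemma mass_nonneg: "0 \<le> mass P x" and mass_le_1: "mass P x \<le> 1"
  by (simp_all add: mass_def)

lemma mass_mono: "y \<in> sub x \<Longrightarrow> mass P y \<le> mass P x"
  unfolding mass_def using sub_trans by (intro measure_pmf.finite_measure_mono) auto

lemma mass_root: "set_pmf P \<subseteq> S \<Longrightarrow> mass P t = 1"
  unfolding mass_def sub_root by (subst measure_pmf.prob_eq_1) (auto simp: AE_measure_pmf_iff)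

lemma mass_ch:
  assumes "x \<in> S" shows "mass P x = pmf P x + (\<Sum>y\<in>ch x. mass P y)"
proof -
  have "mass P x = measure_pmf.prob P ({x} \<union> (\<Union>y\<in>ch x. sub y))"
    unfolding mass_def using sub_ch[OF assms] by simp
  also have "\<dots> = measure_pmf.prob P {x} + measure_pmf.prob P (\<Union>y\<in>ch x. sub y)"
    using ch_notin by (intro measure_pmf.finite_measure_Union) auto
  also have "measure_pmf.prob P (\<Union>y\<in>ch x. sub y) = (\<Sum>y\<in>ch x. mass P y)"
    unfolding mass_def using ch_disjoint
    by (intro measure_pmf.finite_measure_finite_Union) (auto simp: disjoint_family_on_def)
  finally show ?thesis by (simp add: measure_pmf_single)
qed

text \<open>Every edge separating \<open>a\<close> from \<open>b\<close> is crossed upwards on the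
  way from \<open>a\<close> to \<open>b\<close>. The induction strips the edge above
  \<open>a\<close>, or the edge above \<open>b\<close> when \<open>b\<close> lies in the subtree at
  \<open>a\<close>. Pathwise monotonicity is later checked by this criterion.\<close>

lemma s_of_sides:
  assumes "a \<in> S" "b \<in> S"
    and "\<And>x. x \<in> S \<Longrightarrow> x \<noteq> t \<Longrightarrow> upt x \<Longrightarrow> a \<in> sub x \<Longrightarrow> b \<in> sub x"
    and "\<And>x. x \<in> S \<Longrightarrow> x \<noteq> t \<Longrightarrow> \<not> upt x \<Longrightarrow> b \<in> sub x \<Longrightarrow> a \<in> sub x"
  shows "(a, b) \<in> s"
  using assms
proof (induction "dep a + dep b" arbitrary: a b rule: less_induct)
  case less
  note up = less.prems(3) and dn = less.prems(4)
  consider "a = b" | "b \<notin> sub a" | "b \<in> sub a" "a \<noteq> b" by blast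
  then show ?case
  proof cases
    case 1 then show ?thesis using less.prems s_refl by simp
  next
    case 2
    then have at: "a \<noteq> t" using sub_root less.prems by blast
    then have "\<not> upt a" using up[of a] 2 less.prems sub_refl by blast
    then have 3: "(a, par a) \<in> s" using not_upt at less.prems by blast
    have "(par a, b) \<in> s"
    proof (rule less.hyps)
      show "dep (par a) + dep b < dep a + dep b" using dep_par at less.prems by simp
      show "par a \<in> S" using par_in at less.prems by simp
      show "b \<in> sub x" if "x \<in> S" "x \<noteq> t" "upt x" "par a \<in> sub x" for x
        using up[OF that(1-3)] sub_step[of a x] at less.prems that by blast
      show "par a \<in> sub x" if "x \<in> S" "x \<noteq> t" "\<not> upt x" "b \<in> sub x" for x
        using dn[OF that] sub_step[of a x] at less.prems that 2 by blast
    qed (use less.prems in blast)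
    then show ?thesis using 3 s_trans by blast
  next
    case 3
    then have bt: "b \<noteq> t" using t_sub by blast
    have nab: "a \<notin> sub b" using 3 sub_antisym by blast
    then have "upt b" using dn[of b] bt less.prems sub_refl by blast
    then have 4: "(par b, b) \<in> s" by (simp add: upt_def)
    have "(a, par b) \<in> s"
    proof (rule less.hyps)
      show "dep a + dep (par b) < dep a + dep b" using dep_par bt less.prems by simp
      show "par b \<in> S" using par_in bt less.prems by simp
      show "par b \<in> sub x" if "x \<in> S" "x \<noteq> t" "upt x" "a \<in> sub x" for x
        using up[OF that] sub_step[of b x] bt less.prems that nab by blast
      show "a \<in> sub x" if "x \<in> S" "x \<noteq> t" "\<not> upt x" "par b \<in> sub x" for x
        using dn[OF that(1-3)] sub_step[of b x] bt less.prems that by blast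
    qed (use less.prems in blast)
    then show ?thesis using 4 s_trans by blast
  qed
qed

subsection \<open>Segments\<close>

text \<open>
  The terminals are the lower ends of the unbranched segments. The segment \<open>seg c\<close> above the
  terminal \<open>c\<close> has top vertex \<open>hdv c\<close> and hangs below the branching vertex \<open>upv c\<close>; the segment
  of the root \<open>t\<close>, which ends in \<open>r\<close>, is not below any vertex, so that \<open>upv r\<close> is junk.
\<close>

definition terminal :: "'b \<Rightarrow> bool" where
  "terminal c \<longleftrightarrow> c \<in> S \<and> \<not> (\<exists>y. ch c = {y})"

definition down :: "'b \<Rightarrow> 'b" where
  "down x = (if \<exists>y. ch x = {y} then (THE y. ch x = {y}) else x)"

text \<open>The number of iterations exceeds every depth. As a step from a non-terminal raises the
  depth by one, a terminal has been reached, and there \<open>down\<close> rests.\<close>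

definition tm :: "'b \<Rightarrow> 'b" where
  "tm x = (down ^^ Suc (Max (dep ` S))) x"

lemma down_ch: "ch x = {y} \<Longrightarrow> down x = y"
  by (auto simp: down_def)

lemma down_term: "terminal x \<Longrightarrow> down x = x"
  by (auto simp: down_def terminal_def)

lemma down_pow: "x \<in> S \<Longrightarrow> (down ^^ n) x \<in> S \<and> (terminal ((down ^^ n) x) \<or> dep ((down ^^ n) x) = dep x + n)"
proof (induction n)
  case (Suc n)
  let ?z = "(down ^^ n) x"
  show ?case
  proof (cases "terminal ?z")
    case True
    then show ?thesis using down_term Suc by simp
  next
    case False
    then obtain y where y: "ch ?z = {y}" using Suc by (auto simp: terminal_def)
    then have "y \<in> ch ?z" by simp
    then have "dep y = Suc (dep ?z)" "y \<in> S" using dep_ch in_chD by auto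
    then show ?thesis using Suc False down_ch[OF y] by simp
  qed
qed simp

lemma term_tm: assumes "x \<in> S" shows "terminal (tm x)"
proof -
  have "(down ^^ Suc (Max (dep ` S))) x \<in> S" using down_pow[OF assms] by blast
  then have "dep ((down ^^ Suc (Max (dep ` S))) x) \<le> Max (dep ` S)" using finS by simp
  then show ?thesis using down_pow[OF assms, of "Suc (Max (dep ` S))"] unfolding tm_def by linarith
qed

lemma tm_term: assumes "terminal c" shows "tm c = c"
proof -
  have "(down ^^ n) c = c" for n by (induction n) (simp_all add: down_term[OF assms])
  then show ?thesis unfolding tm_def by blast
qed

lemma tm_ch: assumes "x \<in> S" "ch x = {y}" shows "tm x = tm y"
proof -
  have "tm y = (down ^^ Suc (Max (dep ` S))) (down x)" using assms by (simp add: tm_def down_ch)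
  also have "\<dots> = down (tm x)" unfolding tm_def by (metis funpow_swap1)
  also have "\<dots> = tm x" using term_tm[OF assms(1)] by (rule down_term)
  finally show ?thesis by simp
qed

lemma tm_sub: "x \<in> S \<Longrightarrow> tm x \<in> sub x"
proof (induction x rule: down_induct)
  case (node x)
  show ?case
  proof (cases "terminal x")
    case True then show ?thesis using tm_term sub_refl node by simp
  next
    case False
    then obtain y where y: "ch x = {y}" using node by (auto simp: terminal_def)
    then have "tm y \<in> sub y" using node by simp
    then show ?thesis using tm_ch[OF _ y] sub_ch node y by auto
  qed
qed

text \<open>From \<open>z\<close> down to its terminal every vertex has a single child, so
  \<open>x\<close> lies on this path and has the same end.\<close>

lemma tm_between: "z \<in> S \<Longrightarrow> x \<in> sub z \<Longrightarrow> tm z \<in> sub x \<Longrightarrow> tm x = tm z"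
proof (induction z arbitrary: x rule: down_induct)
  case (node z)
  show ?case
  proof (cases "terminal z")
    case True
    then have "x = z" using node tm_term sub_antisym by simp
    then show ?thesis by simp
  next
    case False
    then obtain y where y: "ch z = {y}" using node by (auto simp: terminal_def)
    then have "x = z \<or> x \<in> sub y" using node sub_ch by auto
    then show ?thesis using node y tm_ch[OF _ y] by auto
  qed
qed

definition seg :: "'b \<Rightarrow> 'b set" where
  "seg c = {x \<in> S. tm x = c}"

definition hdv :: "'b \<Rightarrow> 'b" where
  "hdv c = (SOME x. x \<in> seg c \<and> (\<forall>y\<in>seg c. dep x \<le> dep y))"

definition upv :: "'b \<Rightarrow> 'b" where
  "upv c = par (hdv c)"

definition T :: "'b set" where
  "T = {c. terminal c}"

definition r :: 'b where
  "r = tm t"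

lemma T_in: "c \<in> T \<Longrightarrow> c \<in> S"
  by (simp add: T_def terminal_def)

lemma seg_self: "c \<in> T \<Longrightarrow> c \<in> seg c"
  using T_in by (simp add: seg_def T_def tm_term)

lemma seg_sub: "x \<in> seg c \<Longrightarrow> c \<in> sub x"
  using tm_sub by (auto simp: seg_def)

lemma hdv: assumes "c \<in> T" shows "hdv c \<in> seg c" "x \<in> seg c \<Longrightarrow> x \<in> sub (hdv c)"
proof -
  have "\<exists>x. x \<in> seg c \<and> (\<forall>y\<in>seg c. dep x \<le> dep y)"
    using ex_has_least_nat[of "\<lambda>x. x \<in> seg c" c dep] seg_self[OF assms] by blast
  then have h: "hdv c \<in> seg c \<and> (\<forall>y\<in>seg c. dep (hdv c) \<le> dep y)" unfolding hdv_def by (rule someI_ex)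
  then show 1: "hdv c \<in> seg c" by blast
  assume x: "x \<in> seg c"
  have "x \<in> sub (hdv c) \<or> hdv c \<in> sub x" by (rule sub_comparable[OF seg_sub[OF x] seg_sub[OF 1]])
  then show "x \<in> sub (hdv c)" using h x sub_dep_eq by blast
qed

lemma hdv_in: "c \<in> T \<Longrightarrow> hdv c \<in> S" and tm_hdv: "c \<in> T \<Longrightarrow> tm (hdv c) = c"
  using hdv(1) by (auto simp: seg_def)

lemma r_T: "r \<in> T"
  using term_tm t_in by (simp add: T_def r_def)

lemma hdv_r: "hdv r = t"
  using hdv(2)[OF r_T, of t] t_in t_sub by (simp add: seg_def r_def)

lemma hdv_t: "c \<in> T \<Longrightarrow> c \<noteq> r \<Longrightarrow> hdv c \<noteq> t"
  using tm_hdv[of c] by (auto simp: r_def)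

lemma hdv_ch: "c \<in> T \<Longrightarrow> c \<noteq> r \<Longrightarrow> hdv c \<in> ch (upv c)"
  using hdv_t hdv_in by (simp add: ch_def upv_def)

lemma upv_in: "c \<in> T \<Longrightarrow> c \<noteq> r \<Longrightarrow> upv c \<in> S"
  using par_in hdv_in hdv_t by (simp add: upv_def)

lemma par_hdv_seg: "c \<in> T \<Longrightarrow> c \<noteq> r \<Longrightarrow> upv c \<notin> seg c"
proof
  assume c: "c \<in> T" "c \<noteq> r" and "upv c \<in> seg c"
  then have "upv c \<in> sub (hdv c)" using hdv by blast
  then show False using ch_notin hdv_ch c by blast
qed

lemma upv_T: assumes "c \<in> T" "c \<noteq> r" shows "upv c \<in> T"
proof -
  have "\<not> ch (upv c) = {y}" for y
  proof
    assume y: "ch (upv c) = {y}"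
    then have "y = hdv c" using hdv_ch[OF assms] by simp
    then have "tm (upv c) = c" using tm_ch[OF upv_in y] assms tm_hdv by simp
    then show False using par_hdv_seg assms upv_in by (simp add: seg_def)
  qed
  then show ?thesis using upv_in assms by (auto simp: T_def terminal_def)
qed

lemma T_card_ch: assumes "c \<in> T" "ch c \<noteq> {}" shows "2 \<le> card (ch c)"
proof (rule ccontr)
  assume "\<not> ?thesis"
  then have "card (ch c) = 0 \<or> card (ch c) = 1" by linarith
  then have "card (ch c) = 1" using assms by (auto simp: card_eq_0_iff)
  then show False using assms by (auto simp: card_1_singleton_iff T_def terminal_def)
qed

lemma ch_root_card: "card (ch t) \<le> 1"
proof -
  have "\<forall>x\<in>ch t. \<forall>y\<in>ch t. x = y" using leaf_root by (auto simp: ch_def)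
  then show ?thesis using card_le_Suc0_iff_eq[OF finite_ch] by simp
qed

text \<open>A child of a terminal begins a new segment: if the segment reached above
  \<open>k\<close>, it would contain \<open>c\<close>, and \<open>c\<close> would be its lower end
  although \<open>c\<close> is not in the subtree at \<open>k\<close>.\<close>

lemma hdv_tm: assumes c: "c \<in> T" and k: "k \<in> ch c" shows "hdv (tm k) = k"
proof (rule ccontr)
  assume ne: "hdv (tm k) \<noteq> k"
  have kS: "k \<in> S" "k \<noteq> t" "par k = c" using in_chD k by auto
  then have dT: "tm k \<in> T" using term_tm by (simp add: T_def)
  have "k \<in> sub (hdv (tm k))" using hdv(2)[OF dT] kS by (simp add: seg_def)
  then have "c \<in> sub (hdv (tm k))" using sub_step[of k] kS ne by auto
  moreover have "tm k \<in> sub c" using tm_sub[OF kS(1)] par_sub kS sub_trans by metis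
  ultimately have "tm c = tm k" using tm_between[of "hdv (tm k)" c] hdv_in dT tm_hdv by simp
  then have "c = tm k" using c tm_term by (simp add: T_def)
  then show False using tm_sub[OF kS(1)] ch_notin k by metis
qed

text \<open>Turns sums over the kids of \<open>c\<close> in the tree of segments into sums over the
  children of \<open>c\<close> in \<open>S\<close>.\<close>

lemma hdv_bij: assumes c: "c \<in> T" shows "bij_betw hdv {d \<in> T - {r}. upv d = c} (ch c)"
  unfolding bij_betw_def
proof
  show "inj_on hdv {d \<in> T - {r}. upv d = c}" by (rule inj_on_inverseI[of _ tm]) (simp add: tm_hdv)
  show "hdv ` {d \<in> T - {r}. upv d = c} = ch c"
  proof
    show "hdv ` {d \<in> T - {r}. upv d = c} \<subseteq> ch c" using hdv_ch by auto
    show "ch c \<subseteq> hdv ` {d \<in> T - {r}. upv d = c}"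
    proof
      fix k assume k: "k \<in> ch c"
      then have "tm k \<in> T" using term_tm in_chD by (simp add: T_def)
      moreover have "tm k \<noteq> r" using hdv_tm[OF c k] hdv_r in_chD[OF k] by auto
      moreover have "upv (tm k) = c" using hdv_tm[OF c k] in_chD[OF k] by (simp add: upv_def)
      ultimately have "tm k \<in> {d \<in> T - {r}. upv d = c}" by simp
      then show "k \<in> hdv ` {d \<in> T - {r}. upv d = c}" using hdv_tm[OF c k] by (intro image_eqI[where x = "tm k"]) simp_all
    qed
  qed
qed

text \<open>Inverse probability transform along a segment, \<open>F x\<close> being the mass of the subtree at \<open>x\<close>.\<close>

definition Xp :: "('b \<Rightarrow> real) \<Rightarrow> 'b \<times> real \<Rightarrow> 'b" where
  "Xp F = (\<lambda>(c, u). if \<exists>x\<in>seg c. u < F x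
     then (SOME x. x \<in> seg c \<and> u < F x \<and> (\<forall>y\<in>seg c. u < F y \<longrightarrow> dep y \<le> dep x)) else upv c)"

lemma Xp_seg:
  assumes "\<exists>x\<in>seg c. u < F x"
  shows "Xp F (c, u) \<in> seg c" "u < F (Xp F (c, u))" "\<And>y. y \<in> seg c \<Longrightarrow> u < F y \<Longrightarrow> dep y \<le> dep (Xp F (c, u))"
proof -
  let ?Q = "\<lambda>x. x \<in> seg c \<and> u < F x"
  obtain x0 where "?Q x0" using assms by blast
  moreover have "\<forall>y. ?Q y \<longrightarrow> dep y < Suc (Max (dep ` S))"
    using finS by (auto simp: seg_def less_Suc_eq_le)
  ultimately have "\<exists>x. ?Q x \<and> (\<forall>y. ?Q y \<longrightarrow> dep y \<le> dep x)" by (rule ex_has_greatest_nat)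
  then have "\<exists>x. x \<in> seg c \<and> u < F x \<and> (\<forall>y\<in>seg c. u < F y \<longrightarrow> dep y \<le> dep x)" by blast
  from someI_ex[OF this] show "Xp F (c, u) \<in> seg c" "u < F (Xp F (c, u))"
    "\<And>y. y \<in> seg c \<Longrightarrow> u < F y \<Longrightarrow> dep y \<le> dep (Xp F (c, u))"
    using assms by (auto simp: Xp_def)
qed

lemma seg_chain: "x \<in> seg c \<Longrightarrow> y \<in> seg c \<Longrightarrow> dep x \<le> dep y \<Longrightarrow> y \<in> sub x"
  using sub_comparable[OF seg_sub seg_sub, of x c y] sub_dep_eq sub_refl
  by (metis (no_types, lifting) mem_Collect_eq seg_def)

lemma Xp_top:
  assumes F: "\<And>x y. y \<in> sub x \<Longrightarrow> F y \<le> F x" and "c \<in> T" "F (hdv c) \<le> u"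
  shows "Xp F (c, u) = upv c"
  using assms hdv(2)[OF \<open>c \<in> T\<close>] by (force simp: Xp_def)

lemma Xp_bot:
  assumes "c \<in> T" "u < F c"
  shows "Xp F (c, u) = c"
proof -
  have ex: "\<exists>x\<in>seg c. u < F x" using assms seg_self by blast
  note X = Xp_seg[OF ex]
  have "c \<in> sub (Xp F (c, u))" using seg_sub X(1) by blast
  then show ?thesis using X(3)[of c] assms seg_self sub_dep_eq by metis
qed

lemma Xp_in:
  assumes "c \<in> T" "c = r \<longrightarrow> u < F t" shows "Xp F (c, u) \<in> S"
proof (cases "\<exists>x\<in>seg c. u < F x")
  case True
  then show ?thesis using Xp_seg(1)[of c u F] by (simp add: seg_def)
next
  case False
  then have "c \<noteq> r" using assms hdv(1)[OF r_T] hdv_r by auto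
  then show ?thesis using False assms upv_in by (simp add: Xp_def)
qed

text \<open>The side of the edge above \<open>x\<close> depends on \<open>F\<close> only if
  \<open>x\<close> lies in the segment of the point, and then monotonically through
  \<open>u < F x\<close>. At a fixed point, comparing two indices therefore amounts to comparing
  subtree masses.\<close>

lemma Xp_side:
  assumes F: "\<And>x y. y \<in> sub x \<Longrightarrow> F y \<le> F x" and c: "c \<in> T" "c = r \<longrightarrow> u < F t"
    and x: "x \<in> S"
  shows "Xp F (c, u) \<in> sub x \<longleftrightarrow> (if tm x = c then u < F x else c \<in> sub x)"
proof (cases "\<exists>x\<in>seg c. u < F x")
  case ex: True
  define z where "z = Xp F (c, u)"
  note X = Xp_seg[OF ex, folded z_def]
  have cz: "c \<in> sub z" and zS: "z \<in> S" "tm z = c" using seg_sub X(1) by (auto simp: seg_def)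
  show ?thesis unfolding z_def[symmetric]
  proof (cases "tm x = c")
    case True
    then have xs: "x \<in> seg c" using x by (simp add: seg_def)
    have "z \<in> sub x \<longleftrightarrow> u < F x"
    proof
      assume "z \<in> sub x" then show "u < F x" using F X(2) by (meson less_le_trans)
    next
      assume "u < F x" then show "z \<in> sub x" using X(3)[OF xs] seg_chain[OF xs X(1)] by blast
    qed
    then show "z \<in> sub x \<longleftrightarrow> (if tm x = c then u < F x else c \<in> sub x)" using True by simp
  next
    case False
    have "z \<in> sub x" if "c \<in> sub x"
    proof -
      have "\<not> x \<in> sub z" using tm_between[OF zS(1), of x] zS that False by auto
      then show ?thesis using sub_comparable[OF cz that] by blast
    qed
    moreover have "c \<in> sub x" if "z \<in> sub x" using sub_trans[OF cz that] .
    ultimately show "z \<in> sub x \<longleftrightarrow> (if tm x = c then u < F x else c \<in> sub x)" using False by auto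
  qed
next
  case False
  then have cr: "c \<noteq> r" using c hdv(1)[OF r_T] hdv_r by auto
  have X: "Xp F (c, u) = upv c" using False by (simp add: Xp_def)
  note h = hdv_in[OF c(1)] hdv_t[OF c(1) cr] tm_hdv[OF c(1)]
  have hp: "hdv c \<in> sub (upv c)" using par_sub h by (simp add: upv_def)
  have ch: "c \<in> sub (hdv c)" using seg_sub hdv(1) c by blast
  show ?thesis
  proof (cases "tm x = c")
    case True
    then have xs: "x \<in> seg c" using x by (simp add: seg_def)
    have "upv c \<notin> sub x"
    proof
      assume "upv c \<in> sub x"
      then have "upv c \<in> sub (hdv c)" using hdv(2)[OF c(1) xs] sub_trans by blast
      then show False using ch_notin hdv_ch[OF c(1) cr] by blast
    qed
    then show ?thesis using X True False xs by auto
  next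
    case ne: False
    have "upv c \<in> sub x" if "c \<in> sub x"
    proof -
      have "\<not> x \<in> sub (hdv c)" using tm_between[OF h(1), of x] h that ne by auto
      then have "hdv c \<in> sub x" "hdv c \<noteq> x" using sub_comparable[OF ch that] sub_refl x by auto
      then show ?thesis using sub_step[OF h(1,2)] by (simp add: upv_def)
    qed
    moreover have "c \<in> sub x" if "upv c \<in> sub x" using sub_trans[OF sub_trans[OF ch hp] that] .
    ultimately show ?thesis using X ne by auto
  qed
qed

text \<open>The levels sent to \<open>x\<close> form the interval from \<open>F\<close> at its only
  child up to \<open>F x\<close>; at a terminal the lower bound is absent.\<close>

lemma Xp_eq_iff:
  assumes F: "\<And>x y. y \<in> sub x \<Longrightarrow> F y \<le> F x" and x: "x \<in> S"
  shows "(Xp F (tm x, u) = x \<and> (\<exists>y\<in>seg (tm x). u < F y)) \<longleftrightarrow> u < F x \<and> (\<forall>y. ch x = {y} \<longrightarrow> F y \<le> u)"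
    (is "?L \<longleftrightarrow> ?R")
proof -
  have xs: "x \<in> seg (tm x)" using x by (simp add: seg_def)
  show ?thesis
  proof
    assume L: ?L
    note X = Xp_seg[of "tm x" u F]
    have "u < F x" using X(2) L by auto
    moreover have "F y \<le> u" if y: "ch x = {y}" for y
    proof (rule ccontr)
      assume "\<not> F y \<le> u"
      have yc: "y \<in> ch x" using y by simp
      then have "y \<in> seg (tm x)" using tm_ch[OF x y] in_chD by (simp add: seg_def)
      then have "dep y \<le> dep x" using X(3)[of y] L \<open>\<not> F y \<le> u\<close> by auto
      then show False using dep_ch[OF yc] by simp
    qed
    ultimately show ?R by blast
  next
    assume R: ?R
    then have ex: "\<exists>y\<in>seg (tm x). u < F y" using xs by blast
    note X = Xp_seg[OF ex]
    define z where "z = Xp F (tm x, u)"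
    have "z \<in> sub x" using seg_chain[OF xs X(1)] X(3)[OF xs] R by (simp add: z_def)
    have "z = x"
    proof (rule ccontr)
      assume "z \<noteq> x"
      then obtain y where y: "y \<in> ch x" "z \<in> sub y" using sub_ch[OF x] \<open>z \<in> sub x\<close> by blast
      show False
      proof (cases "terminal x")
        case True
        then have "tm x = x" by (rule tm_term)
        then have "x \<in> sub z" using seg_sub X(1) z_def by metis
        then show False using \<open>z \<in> sub x\<close> \<open>z \<noteq> x\<close> sub_antisym by blast
      next
        case False
        then have "ch x = {y}" using x y by (auto simp: terminal_def)
        then have "F y \<le> u" using R by blast
        moreover have "u < F y" using X(2) F[OF y(2)] by (simp add: z_def)
        ultimately show False by simp
      qed
    qed
    then show ?L using ex z_def by simp
  qed
qed

end

section \<open>Monotone systems on a tree\<close>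

context poset_tree
begin

lemma finite_T: "finite T"
  using finS T_in finite_subset[of T S] by blast

lemma branch_card: assumes "c \<in> T" "{d \<in> T - {r}. upv d = c} \<noteq> {}" shows "2 \<le> card (ch c)"
proof -
  have "ch c \<noteq> {}" using hdv_bij[OF assms(1)] assms(2) by (auto simp: bij_betw_def)
  then show ?thesis by (rule T_card_ch[OF assms(1)])
qed

lemma branch_neq_root: "2 \<le> card (ch c) \<Longrightarrow> c \<noteq> t"
  using ch_root_card by auto

lemma hdv_branch: "d \<in> T \<Longrightarrow> d \<noteq> r \<Longrightarrow> 2 \<le> card (ch (upv d))"
  using T_card_ch[OF upv_T] hdv_ch by blast

text \<open>Levels from \<open>F (hdv c)\<close> on are sent to \<open>upv c\<close> anyway, and
  levels below \<open>F c\<close> to \<open>c\<close>; collapsing them changes nothing.\<close>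

lemma Xp_coarsen:
  assumes lt: "level_tree T r upv L w" and F: "\<And>x y. y \<in> sub x \<Longrightarrow> F y \<le> F x" and F0: "\<And>x. 0 \<le> F x"
    and top: "\<And>c. c \<in> T \<Longrightarrow> c \<noteq> r \<Longrightarrow> F (hdv c) \<le> hi c"
    and bot: "\<And>c. c \<in> T \<Longrightarrow> lo c \<le> F c \<or> lo c \<le> 0"
    and y: "c \<in> T" "u = - 1 \<or> 0 \<le> u"
  shows "Xp F (level_tree.coarsen r upv lo hi (c, u)) = Xp F (c, u)"
proof -
  interpret level_tree T r upv L w by (rule lt)
  have atom: "Xp F (d, - 1) = d" if "d \<in> T" for d
    using F0[of d] by (intro Xp_bot[OF that]) simp
  consider "u = - 1" | "u \<noteq> - 1" "c \<noteq> r" "hi c \<le> u" | "u \<noteq> - 1" "\<not> (c \<noteq> r \<and> hi c \<le> u)" "u < lo c"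
    | "u \<noteq> - 1" "\<not> (c \<noteq> r \<and> hi c \<le> u)" "\<not> u < lo c" by blast
  then show ?thesis
  proof cases
    case 2
    then have "Xp F (c, u) = upv c" using top[of c] y by (intro Xp_top[OF F]) auto
    then show ?thesis using 2 atom[OF upv_T] y by (simp add: coarsen_def)
  next
    case 3
    then have "Xp F (c, u) = c" using bot[of c] y by (intro Xp_bot) auto
    moreover have "coarsen lo hi (c, u) = (c, - 1)" using 3 by (auto simp: coarsen_def)
    ultimately show ?thesis using atom y by simp
  qed (auto simp: coarsen_def)
qed

text \<open>With the stretches of \<open>P\<close> itself, a non-terminal receives the levels
  between the masses at its child and at itself, a branching vertex its atom, and a leaf all levels
  below its mass. Each time the total is \<open>pmf P x\<close>.\<close>

lemma map_Xp_nu: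
  fixes P :: "'b pmf"
  defines "lo \<equiv> \<lambda>c. if {d \<in> T - {r}. upv d = c} = {} then 0 else mass P c"
    and "hi \<equiv> \<lambda>c. if c = r then 1 else mass P (hdv c)"
  assumes lt: "level_tree T r upv L w" and P: "set_pmf P \<subseteq> S"
    and L: "0 \<in> L" "1 \<in> L" "\<And>x. x \<in> S \<Longrightarrow> mass P x \<in> L"
  shows "level_tree.valid T r upv L lo hi"
    and "map_pmf (Xp (mass P)) (level_tree.nu T r upv L w lo hi) = P"
proof -
  interpret level_tree T r upv L w by (rule lt)
  have hi: "hi c = mass P (hdv c)" if "c \<in> T" for c
    using mass_root[OF P] hdv_r by (simp add: hi_def)
  have lo: "lo c = (if kids c = {} then 0 else mass P c)" for c by (simp add: lo_def kids_def)
  have sum_kids: "(\<Sum>d\<in>kids c. hi d) = (\<Sum>y\<in>ch c. mass P y)" if "c \<in> T" for c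
  proof -
    have "(\<Sum>d\<in>kids c. hi d) = (\<Sum>d\<in>kids c. mass P (hdv d))" by (intro sum.cong) (auto simp: kids_def hi)
    also have "\<dots> = (\<Sum>y\<in>ch c. mass P y)"
      unfolding kids_def using hdv_bij[OF that] by (rule sum.reindex_bij_betw)
    finally show ?thesis .
  qed
  have lo_le: "lo c \<le> mass P c" for c by (simp add: lo mass_nonneg)
  show v: "valid lo hi"
    unfolding valid_def
  proof (intro conjI ballI)
    fix c assume c: "c \<in> T"
    have "mass P c \<le> mass P (hdv c)" using seg_sub hdv(1)[OF c] by (intro mass_mono) blast
    then show "lo c \<le> hi c" using lo_le[of c] hi[OF c] by simp
    show "lo c \<in> L" "hi c \<in> L" using L c T_in hdv_in by (auto simp: lo hi)
    show "(\<Sum>d\<in>kids c. hi d) \<le> lo c"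
      using sum_kids[OF c] mass_ch[OF T_in[OF c], of P] by (cases "kids c = {}") (auto simp: lo)
  qed (simp add: hi_def)
  let ?X = "Xp (mass P)" and ?Q = "T \<times> insert (- 1) L"
  have atom: "?X (d, - 1) = d" if "d \<in> T" for d
    using mass_nonneg[of P d] by (intro Xp_bot[OF that]) simp
  have seg_ex: "\<exists>y\<in>seg d. u < mass P y" if "d \<in> T" "u < hi d" for d u
    using that hi hdv(1)[OF that(1)] by auto
  have wtD: "d \<in> T \<and> (u = - 1 \<or> u \<in> L \<and> lo d \<le> u \<and> u < hi d)" if "wt lo hi (d, u) \<noteq> 0" for d u
    using that by (auto simp: wt_def split: if_splits)
  have main: "(\<Sum>z\<in>{z\<in>?Q. ?X z = x}. wt lo hi z) = pmf P x" for x
  proof (cases "x \<in> S")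
    case False
    have "wt lo hi z = 0" if "z \<in> ?Q" "?X z = x" for z
    proof (rule ccontr)
      assume nz: "wt lo hi z \<noteq> 0"
      obtain d u where z: "z = (d, u)" by fastforce
      have "d \<in> T" "d = r \<longrightarrow> u < mass P t"
        using wtD[OF nz[unfolded z]] mass_root[OF P] by (auto simp: hi_def)
      then have "?X z \<in> S" unfolding z by (rule Xp_in)
      then show False using False that by simp
    qed
    then have "(\<Sum>z\<in>{z\<in>?Q. ?X z = x}. wt lo hi z) = 0" by (intro sum.neutral) auto
    moreover have "pmf P x = 0" using P False by (auto simp: set_pmf_iff)
    ultimately show ?thesis by simp
  next
    case x: True
    define c where "c = tm x"
    have cT: "c \<in> T" using term_tm[OF x] by (simp add: T_def c_def)
    let ?B = "Pair c ` {u \<in> insert (- 1) L. ?X (c, u) = x}"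
    \<comment> \<open>Points of positive weight are sent into their own segment, so only the segment
      of \<open>x\<close> contributes.\<close>
    have "(\<Sum>z\<in>{z\<in>?Q. ?X z = x}. wt lo hi z) = (\<Sum>z\<in>?B. wt lo hi z)"
    proof (rule sum.mono_neutral_right)
      show "finite {z \<in> ?Q. ?X z = x}" using finite_T finL by simp
      show "?B \<subseteq> {z \<in> ?Q. ?X z = x}" using cT by auto
      show "\<forall>z\<in>{z \<in> ?Q. ?X z = x} - ?B. wt lo hi z = 0"
      proof (intro ballI, rule ccontr)
        fix z assume z: "z \<in> {z \<in> ?Q. ?X z = x} - ?B" and nz: "wt lo hi z \<noteq> 0"
        obtain d u where du: "z = (d, u)" by fastforce
        then have d: "d \<in> T" "u \<in> insert (- 1) L" "?X (d, u) = x" using z by auto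
        have "tm x = d"
        proof (cases "u = - 1")
          case True
          then show ?thesis using atom[OF d(1)] d tm_term by (simp add: T_def)
        next
          case False
          then have "u < hi d" using wtD[OF nz[unfolded du]] by blast
          then show ?thesis using Xp_seg(1)[OF seg_ex[OF d(1)], of u] d(3) by (simp add: seg_def)
        qed
        then show False using z d du by (auto simp: c_def)
      qed
    qed
    also have "\<dots> = (\<Sum>u\<in>{u \<in> insert (- 1) L. ?X (c, u) = x}. wt lo hi (c, u))"
      by (subst sum.reindex) (auto simp: inj_on_def)
    also have "\<dots> = (\<Sum>u\<in>insert (- 1) L. if ?X (c, u) = x then wt lo hi (c, u) else 0)"
      using finL by (intro sum.inter_filter) simp
    also have "\<dots> = (if c = x then wt lo hi (c, - 1) else 0) + (\<Sum>u\<in>L. if ?X (c, u) = x then wt lo hi (c, u) else 0)"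
      using finL neg1_notin_L atom[OF cT] by simp
    also have "(\<Sum>u\<in>L. if ?X (c, u) = x then wt lo hi (c, u) else 0) =
        (\<Sum>u\<in>L. if lo c \<le> u \<and> u < mass P x \<and> (\<forall>y. ch x = {y} \<longrightarrow> mass P y \<le> u) then w u else 0)"
    proof (intro sum.cong refl)
      fix u assume u: "u \<in> L"
      then have "u \<noteq> - 1" using neg1_notin_L by auto
      then have wt: "wt lo hi (c, u) = (if lo c \<le> u \<and> u < hi c then w u else 0)"
        using u cT by (simp add: wt_def)
      have "x \<in> sub (hdv c)" using x hdv(2)[OF cT] by (simp add: seg_def c_def)
      then have "mass P x \<le> hi c" using hi[OF cT] mass_mono by simp
      then have "?X (c, u) = x \<and> u < hi c \<longleftrightarrow> u < mass P x \<and> (\<forall>y. ch x = {y} \<longrightarrow> mass P y \<le> u)"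
        using Xp_eq_iff[where F = "mass P" and u = u, OF mass_mono x] seg_ex[OF cT, of u] unfolding c_def[symmetric] by fastforce
      then show "(if ?X (c, u) = x then wt lo hi (c, u) else 0) =
          (if lo c \<le> u \<and> u < mass P x \<and> (\<forall>y. ch x = {y} \<longrightarrow> mass P y \<le> u) then w u else 0)"
        unfolding wt by auto
    qed
    also have "(if c = x then wt lo hi (c, - 1) else 0) + \<dots> = pmf P x"
    proof (cases "terminal x")
      case True
      then have cx: "c = x" by (simp add: c_def tm_term)
      have "(\<Sum>u\<in>L. if lo c \<le> u \<and> u < mass P x \<and> (\<forall>y. ch x = {y} \<longrightarrow> mass P y \<le> u) then w u else 0) =
          (\<Sum>u\<in>L. if lo c \<le> u \<and> u < mass P c then w u else 0)"
        using True cx by (intro sum.cong) (auto simp: terminal_def)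
      also have "\<dots> = mass P c - lo c"
        using v cT L(3)[OF x] lo_le[of c] cx by (intro sum_levels) (auto simp: valid_def)
      finally show ?thesis using cx cT mass_ch[OF x, of P] sum_kids[OF cT] by (simp add: wt_def)
    next
      case False
      then obtain y where y: "ch x = {y}" using x by (auto simp: terminal_def)
      then have yS: "y \<in> S" "y \<in> ch x" using in_chD[of y x] by auto
      have "c \<noteq> x" using False cT by (auto simp: T_def)
      have "c \<in> sub y" using tm_ch[OF x y] tm_sub[OF yS(1)] by (simp add: c_def)
      then have ly: "lo c \<le> mass P y" using lo_le[of c] mass_mono by (meson order_trans)
      have "(\<Sum>u\<in>L. if lo c \<le> u \<and> u < mass P x \<and> (\<forall>y. ch x = {y} \<longrightarrow> mass P y \<le> u) then w u else 0) =
          (\<Sum>u\<in>L. if mass P y \<le> u \<and> u < mass P x then w u else 0)"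
        using y ly by (intro sum.cong) auto
      also have "\<dots> = mass P x - mass P y"
      proof (intro sum_levels L(3) x yS(1))
        show "mass P y \<le> mass P x" using mass_ch[OF x, of P] y by simp
      qed
      finally show ?thesis using \<open>c \<noteq> x\<close> mass_ch[OF x, of P] y by simp
    qed
    finally show ?thesis .
  qed
  then show "map_pmf ?X (nu lo hi) = P" by (intro pmf_eqI) (simp add: pmf_map_nu[OF v])
qed

end

text \<open>\<open>D_le\<close> and \<open>G_ge\<close> are conditional on a branching vertex of the
  matching direction. In the absence of such vertices, \<open>D\<close> or \<open>G\<close> may be a
  singleton unrelated to the order.\<close>

locale coupled_system =
  poset_tree S s E t par dep + sync_frame A D G Dl Gl TD TG
  for S :: "'b set" and s E :: "'b rel" and t :: 'b and par :: "'b \<Rightarrow> 'b" and dep :: "'b \<Rightarrow> nat"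
    and A D G :: "'a set" and Dl Gl :: "'a \<Rightarrow> 'a set" and TD TG :: "'a rel" +
  fixes ra :: "'a rel" and P :: "'a \<Rightarrow> 'b pmf"
  assumes finA: "finite A" and DA: "D \<subseteq> A" and GA: "G \<subseteq> A"
    and PS: "\<And>a. a \<in> A \<Longrightarrow> set_pmf (P a) \<subseteq> S"
    and stm: "stochastically_monotone A ra S s P"
    and Dl_mono: "\<And>a a'. \<lbrakk>a \<in> A; a' \<in> A; strictly_below ra a a'\<rbrakk> \<Longrightarrow> Dl a \<subseteq> Dl a'"
    and Gl_anti: "\<And>a a'. \<lbrakk>a \<in> A; a' \<in> A; strictly_below ra a a'\<rbrakk> \<Longrightarrow> Gl a' \<subseteq> Gl a"
    and D_le: "\<And>c a b. \<lbrakk>c \<in> S; 2 \<le> card (ch c); upt c; a \<in> A; b \<in> Dl a\<rbrakk> \<Longrightarrow> (b, a) \<in> ra"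
    and G_ge: "\<And>c a g. \<lbrakk>c \<in> S; 2 \<le> card (ch c); \<not> upt c; a \<in> A; g \<in> Gl a\<rbrakk> \<Longrightarrow> (a, g) \<in> ra"
    and side: "\<And>c k. \<lbrakk>c \<in> S; 2 \<le> card (ch c); k \<in> ch c\<rbrakk> \<Longrightarrow> upt k \<longleftrightarrow> \<not> upt c"
begin

definition F :: "'a \<Rightarrow> 'b \<Rightarrow> real" where
  "F a = mass (P a)"

lemma F_up:
  assumes "(a, a') \<in> ra" "a \<in> A" "a' \<in> A" "x \<in> S" "x \<noteq> t" "upt x"
  shows "F a x \<le> F a' x"
proof (cases "a = a'")
  case False
  then have "stochastically_le S s (P a) (P a')"
    using stm assms unfolding stochastically_monotone_def strictly_below_def by blast
  then show ?thesis unfolding F_def using assms by (intro mass_upt)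
qed simp

lemma F_down:
  assumes "(a, a') \<in> ra" "a \<in> A" "a' \<in> A" "x \<in> S" "x \<noteq> t" "\<not> upt x"
  shows "F a' x \<le> F a x"
proof (cases "a = a'")
  case False
  then have "stochastically_le S s (P a) (P a')"
    using stm assms unfolding stochastically_monotone_def strictly_below_def by blast
  then show ?thesis unfolding F_def using assms PS by (intro mass_not_upt)
qed simp

lemma F_mono: "y \<in> sub x \<Longrightarrow> F a y \<le> F a x"
  by (simp add: F_def mass_mono)

lemma F_nonneg: "0 \<le> F a x"
  by (simp add: F_def mass_nonneg)

lemma Dl_in: "a \<in> A \<Longrightarrow> b \<in> Dl a \<Longrightarrow> b \<in> A" and Gl_in: "a \<in> A \<Longrightarrow> b \<in> Gl a \<Longrightarrow> b \<in> A"
  using Dl[of a] Gl[of a] DA GA by auto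

theorem realizable: "realizably_monotone A ra S s P"
proof -
  \<comment> \<open>All subtree masses together with the ends \<open>0\<close> and \<open>1\<close>,
    so that every cut falls on a level.\<close>
  define L where "L = {0, 1} \<union> (\<Union>a\<in>A. F a ` S)"
  have finL: "finite L" using finA finS by (simp add: L_def)
  obtain w where w: "\<And>u. 0 \<le> w u"
    "\<And>p q. p \<in> L \<Longrightarrow> q \<in> L \<Longrightarrow> p \<le> q \<Longrightarrow> (\<Sum>u\<in>{u\<in>L. p \<le> u \<and> u < q}. w u) = q - p"
    using level_weights[OF finL] by blast
  have lt: "level_tree T r upv L w"
  proof
    show "L \<subseteq> {0..1}" by (auto simp: L_def F_def mass_nonneg mass_le_1)
  qed (use finite_T r_T upv_T finL w in auto)
  have FL: "F a x \<in> L" if "a \<in> A" "x \<in> S" for a x using that by (auto simp: L_def)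
  have kids: "level_tree.kids T r upv c = {d \<in> T - {r}. upv d = c}" for c
    using level_tree.kids_def[OF lt] .
  have br: "2 \<le> card (ch c) \<and> c \<noteq> t" if "c \<in> T" "level_tree.kids T r upv c \<noteq> {}" for c
    using branch_card[OF that[unfolded kids]] branch_neq_root by blast
  have hup: "upv d \<in> S \<and> 2 \<le> card (ch (upv d)) \<and> hdv d \<in> ch (upv d) \<and> hdv d \<in> S \<and> hdv d \<noteq> t"
    if "d \<in> T" "d \<noteq> r" for d
    using hdv_branch[OF that] hdv_ch[OF that] upv_in[OF that] hdv_in[OF that(1)] hdv_t[OF that] by blast
  \<comment> \<open>\<open>upt\<close> plays the part of \<open>mx\<close>: a branching vertex above
    its parent is by \<open>side\<close> also above its children, hence maximal.\<close>
  interpret grid T r upv L w A D G Dl Gl TD TG upt F "\<lambda>a c. F a (hdv c)"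
  proof (intro grid.intro lt sync_frame_axioms grid_axioms.intro)
    show "0 \<in> L" "1 \<in> L" by (simp_all add: L_def)
    show "F a c \<in> L" "F a (hdv c) \<in> L" if "a \<in> A \<union> D \<union> G" "c \<in> T" for a c
      using that DA GA T_in hdv_in by (auto intro!: FL)
    show "F a c \<le> F a (hdv c)" if "c \<in> T" for a c
      using seg_sub hdv(1)[OF that] by (intro F_mono) blast
    show "(\<Sum>d\<in>level_tree.kids T r upv c. F a (hdv d)) \<le> F a c" if "c \<in> T" for a c
    proof -
      have "(\<Sum>d\<in>level_tree.kids T r upv c. F a (hdv d)) = (\<Sum>y\<in>ch c. F a y)"
        unfolding kids using hdv_bij[OF that] by (rule sum.reindex_bij_betw)
      then show ?thesis using mass_ch[OF T_in[OF that], of "P a"] by (simp add: F_def)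
    qed
    show "F b c \<le> F a c" if "a \<in> A" "b \<in> Dl a" "c \<in> T" "level_tree.kids T r upv c \<noteq> {}" "upt c" for a b c
      using that br[OF that(3,4)] T_in[OF that(3)] by (intro F_up D_le[of c] Dl_in[of a b]) auto
    \<comment> \<open>By \<open>side\<close> the edge at the top of a segment is directed oppositely
      to the edge above the branching vertex, so monotonicity is reversed compared with the lower
      cut.\<close>
    show "F a (hdv d) \<le> F b (hdv d)" if "a \<in> A" "b \<in> Dl a" "d \<in> T" "d \<noteq> r" "upt (upv d)" for a b d
      using that hup[OF that(3,4)] side[of "upv d" "hdv d"]
      by (intro F_down D_le[of "upv d"] Dl_in[of a b]) auto
    show "F g c \<le> F a c" if "a \<in> A" "g \<in> Gl a" "c \<in> T" "level_tree.kids T r upv c \<noteq> {}" "\<not> upt c" for a g c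
      using that br[OF that(3,4)] T_in[OF that(3)] by (intro F_down G_ge[of c] Gl_in[of a g]) auto
    show "F a (hdv d) \<le> F g (hdv d)" if "a \<in> A" "g \<in> Gl a" "d \<in> T" "d \<noteq> r" "\<not> upt (upv d)" for a g d
      using that hup[OF that(3,4)] side[of "upv d" "hdv d"]
      by (intro F_up G_ge[of "upv d"] Gl_in[of a g]) auto
  qed
  have hi_ge: "F a (hdv c) \<le> hi b b' g g' c"
    if "a \<in> A" "b \<in> Dl a" "b' \<in> Dl a" "g \<in> Gl a" "g' \<in> Gl a" "c \<in> T" "c \<noteq> r" for a b b' g g' c
    using h_D[of a _ c] h_G[of a _ c] that by (simp add: hi_def)
  have lo_le: "lo b b' g g' c \<le> F a c \<or> lo b b' g g' c \<le> 0"
    if "a \<in> A" "b \<in> Dl a" "b' \<in> Dl a" "g \<in> Gl a" "g' \<in> Gl a" "c \<in> T" for a b b' g g' c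
    using l_D[of a _ c] l_G[of a _ c] that by (simp add: lo_def)
  have pos: "fst y \<in> T \<and> (snd y = - 1 \<or> 0 \<le> snd y) \<and> (fst y = r \<longrightarrow> snd y < 1)"
    if "inc b g" "y \<in> set_pmf (nd b g)" for b g y
  proof -
    have "(fst y, snd y) \<in> set_pmf (nd b g)" using that by simp
    from set_nd[OF that(1) this] show ?thesis using L01 by (auto simp: hi_def)
  qed
  \<comment> \<open>The common stretch still contains that of every index between the pairs, so
    \<open>X a\<close> can be read before or after the coarsening.\<close>
  have X_K: "Xp (F a) (K b b' g g' y) = Xp (F a) y"
    if a: "a \<in> A" "b \<in> Dl a" "b' \<in> Dl a" "g \<in> Gl a" "g' \<in> Gl a" and y: "fst y \<in> T" "snd y = - 1 \<or> 0 \<le> snd y"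
    for a b b' g g' y
  proof -
    have "Xp (F a) (K b b' g g' (fst y, snd y)) = Xp (F a) (fst y, snd y)"
      unfolding K_def using hi_ge[OF a] lo_le[OF a] y
      by (intro Xp_coarsen[OF lt] F_mono F_nonneg)
    then show ?thesis by simp
  qed
  have X_law: "map_pmf (Xp (F a)) (nd b g) = P a" if a: "a \<in> A" "b \<in> Dl a" "g \<in> Gl a" for a b g
  proof -
    let ?lo = "\<lambda>c. if {d \<in> T - {r}. upv d = c} = {} then 0 else F a c"
    let ?hi = "\<lambda>c. if c = r then 1 else F a (hdv c)"
    have inc: "inc b g" using a by (auto simp: inc_def)
    have v: "valid ?lo ?hi" and X: "map_pmf (Xp (F a)) (nu ?lo ?hi) = P a"
      unfolding F_def using map_Xp_nu[OF lt PS[OF a(1)] L0 L1 FL[OF a(1), unfolded F_def]] by blast+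
    \<comment> \<open>The stretch of \<open>P a\<close> lies within that of the pair. Coarsening to
      it leaves the transform unchanged and reduces the law to \<open>map_Xp_nu\<close>.\<close>
    have "map_pmf (coarsen ?lo ?hi) (nd b g) = nu ?lo ?hi"
      unfolding nd_def
    proof (rule map_coarsen_nu[OF valid_nd[OF inc] v])
      show "lo b b g g c \<le> ?lo c" if "c \<in> T" for c
        using l_D[of a b c] l_G[of a g c] F_nonneg[of a c] a that by (simp add: lo_def kids_def)
      show "?hi c \<le> hi b b g g c" if "c \<in> T" for c
        using hi_ge[OF a(1,2,2,3,3) that] by (simp add: hi_def)
    qed
    then have "P a = map_pmf (Xp (F a)) (map_pmf (coarsen ?lo ?hi) (nd b g))" using X by simp
    also have "\<dots> = map_pmf (Xp (F a)) (nd b g)"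
      unfolding pmf.map_comp
    proof (intro pmf.map_cong refl)
      fix y assume y: "y \<in> set_pmf (nd b g)"
      have "Xp (F a) (coarsen ?lo ?hi (fst y, snd y)) = Xp (F a) (fst y, snd y)"
        using pos[OF inc y] by (intro Xp_coarsen[OF lt] F_mono F_nonneg) auto
      then show "(Xp (F a) \<circ> coarsen ?lo ?hi) y = Xp (F a) y" by simp
    qed
    finally show ?thesis by simp
  qed
  obtain M where M: "joint {(b, g). g \<in> G \<and> inc b g} M" using joint_exists by blast
  let ?N = "{(b, g). g \<in> G \<and> inc b g}"
  have inN: "(b, g) \<in> ?N" if "a \<in> A" "b \<in> Dl a" "g \<in> Gl a" for a b g
    using that inc_in[of b g] by (auto simp: inc_def)
  have "\<forall>a\<in>A. \<exists>b. b \<in> Dl a" "\<forall>a\<in>A. \<exists>g. g \<in> Gl a" using Dl Gl by blast+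
  then obtain \<beta> \<gamma> where \<beta>: "\<And>a. a \<in> A \<Longrightarrow> \<beta> a \<in> Dl a" and \<gamma>: "\<And>a. a \<in> A \<Longrightarrow> \<gamma> a \<in> Gl a" by metis
  \<comment> \<open>The default \<open>t\<close> off the support of \<open>M\<close> keeps the
    values in \<open>S\<close> and monotone at every sample point, as a realization
    requires.\<close>
  define X where "X a \<omega> = (if \<omega> \<in> set_pmf M then Xp (F a) (\<omega> (\<beta> a, \<gamma> a)) else t)" for a \<omega>
  have node: "fst (\<omega> (b, g)) \<in> T \<and> (snd (\<omega> (b, g)) = - 1 \<or> 0 \<le> snd (\<omega> (b, g))) \<and>
      (fst (\<omega> (b, g)) = r \<longrightarrow> snd (\<omega> (b, g)) < 1)"
    if "\<omega> \<in> set_pmf M" "a \<in> A" "b \<in> Dl a" "g \<in> Gl a" for \<omega> a b g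
  proof -
    have bg: "(b, g) \<in> ?N" using inN that by blast
    then have "inc b g" by blast
    then show ?thesis using pos joint_in_nd[OF M bg] that by blast
  qed
  \<comment> \<open>Here the connectedness of \<open>Dl a\<close> and \<open>Gl a\<close> enters:
    \<open>b\<close> and then \<open>g\<close> are changed along paths inside these sets, and by
    \<open>X_K\<close> every edge preserves the value.\<close>
  have X_node: "X a \<omega> = Xp (F a) (\<omega> (b, g))"
    if \<omega>: "\<omega> \<in> set_pmf M" and a: "a \<in> A" and bg: "b \<in> Dl a" "g \<in> Gl a" for a \<omega> b g
  proof -
    have "Xp (F a) (\<omega> (\<beta> a, \<gamma> a)) = Xp (F a) (\<omega> (b, \<gamma> a))"
    proof (rule conn_const[of TD "Dl a" "\<lambda>b. Xp (F a) (\<omega> (b, \<gamma> a))"])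
      fix x y assume xy: "x \<in> Dl a" "y \<in> Dl a" "(x, y) \<in> TD"
      have "R (x, \<gamma> a) (y, \<gamma> a) (\<omega> (x, \<gamma> a)) (\<omega> (y, \<gamma> a))"
        using inN[OF a _ \<gamma>[OF a]] xy by (intro joint_R[OF M \<omega>]) blast+
      then have "K x y (\<gamma> a) (\<gamma> a) (\<omega> (x, \<gamma> a)) = K x y (\<gamma> a) (\<gamma> a) (\<omega> (y, \<gamma> a))"
        using xy by (simp add: R_def)
      then show "Xp (F a) (\<omega> (x, \<gamma> a)) = Xp (F a) (\<omega> (y, \<gamma> a))"
        using X_K[OF a xy(1,2) \<gamma>[OF a] \<gamma>[OF a]] node[OF \<omega> a _ \<gamma>[OF a]] xy by metis
    qed (use Dl a \<beta> bg in auto)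
    also have "\<dots> = Xp (F a) (\<omega> (b, g))"
    proof (rule conn_const[of TG "Gl a" "\<lambda>g. Xp (F a) (\<omega> (b, g))"])
      fix x y assume xy: "x \<in> Gl a" "y \<in> Gl a" "(x, y) \<in> TG"
      have "R (b, x) (b, y) (\<omega> (b, x)) (\<omega> (b, y))"
        using inN[OF a bg(1)] xy by (intro joint_R[OF M \<omega>]) blast+
      then have "K b b x y (\<omega> (b, x)) = K b b x y (\<omega> (b, y))"
        using xy by (simp add: R_def)
      then show "Xp (F a) (\<omega> (b, x)) = Xp (F a) (\<omega> (b, y))"
        using X_K[OF a bg(1) bg(1) xy(1,2)] node[OF \<omega> a bg(1)] xy by metis
    qed (use Gl a \<gamma> bg in auto)
    finally show ?thesis using \<omega> by (simp add: X_def)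
  qed
  have X_in: "X a \<omega> \<in> S" if "a \<in> A" for a \<omega>
  proof (cases "\<omega> \<in> set_pmf M")
    case True
    have n: "fst (\<omega> (\<beta> a, \<gamma> a)) \<in> T" "fst (\<omega> (\<beta> a, \<gamma> a)) = r \<longrightarrow> snd (\<omega> (\<beta> a, \<gamma> a)) < F a t"
      using node[OF True that \<beta>[OF that] \<gamma>[OF that]] mass_root[OF PS[OF that]] by (auto simp: F_def)
    show ?thesis using Xp_in[where F = "F a", OF n] True by (simp add: X_def)
  qed (simp add: X_def t_in)
  have "monotone_realization A ra S s P (measure_pmf M) X"
    unfolding monotone_realization_def
  proof (intro conjI ballI impI)
    show "prob_space (measure_pmf M)" by (rule prob_space_measure_pmf)
  next
    fix a assume a: "a \<in> A"
    show "X a \<in> measure_pmf M \<rightarrow>\<^sub>M count_space S" using X_in[OF a] by simp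
    have "map_pmf (X a) M = map_pmf (Xp (F a)) (map_pmf (\<lambda>\<omega>. \<omega> (\<beta> a, \<gamma> a)) M)"
      unfolding pmf.map_comp by (intro pmf.map_cong) (auto simp: X_def)
    also have "\<dots> = P a"
      using joint_marginal[OF M inN[OF a \<beta>[OF a] \<gamma>[OF a]]] X_law[OF a \<beta>[OF a] \<gamma>[OF a]] by simp
    finally have "map_pmf (X a) M = P a" .
    then show "distr (measure_pmf M) (count_space UNIV) (X a) = measure_pmf (P a)"
      using map_pmf_rep_eq[of "X a" M] by simp
  next
    fix a a' \<omega> assume a: "a \<in> A" "a' \<in> A" "strictly_below ra a a'"
    show "(X a \<omega>, X a' \<omega>) \<in> s"
    proof (cases "\<omega> \<in> set_pmf M")
      case True
      \<comment> \<open>The pair \<open>(\<beta> a, \<gamma> a')\<close> is admissible for both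
        indices, so both values come from one and the same point.\<close>
      have b: "\<beta> a \<in> Dl a" "\<beta> a \<in> Dl a'" and g: "\<gamma> a' \<in> Gl a" "\<gamma> a' \<in> Gl a'"
        using \<beta> \<gamma> Dl_mono[OF a] Gl_anti[OF a] a by blast+
      obtain c u where cu: "\<omega> (\<beta> a, \<gamma> a') = (c, u)" by fastforce
      have c: "c \<in> T" "c = r \<longrightarrow> u < F a t" "c = r \<longrightarrow> u < F a' t"
        using node[OF True a(1) b(1) g(1)] mass_root[OF PS[OF a(1)]] mass_root[OF PS[OF a(2)]] cu
        by (auto simp: F_def)
      have X: "X a \<omega> = Xp (F a) (c, u)" "X a' \<omega> = Xp (F a') (c, u)"
        using X_node[OF True a(1) b(1) g(1)] X_node[OF True a(2) b(2) g(2)] cu by simp_all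
      have le: "(a, a') \<in> ra" using a by (simp add: strictly_below_def)
      have side: "X a \<omega> \<in> sub x \<longleftrightarrow> (if tm x = c then u < F a x else c \<in> sub x)"
        "X a' \<omega> \<in> sub x \<longleftrightarrow> (if tm x = c then u < F a' x else c \<in> sub x)" if "x \<in> S" for x
        unfolding X using that c by (intro Xp_side F_mono; simp)+
      show ?thesis
      proof (rule s_of_sides)
        show "X a \<omega> \<in> S" "X a' \<omega> \<in> S" using X_in a by blast+
        show "X a' \<omega> \<in> sub x" if "x \<in> S" "x \<noteq> t" "upt x" "X a \<omega> \<in> sub x" for x
          using that F_up[OF le a(1,2) that(1-3)] side[OF that(1)] by (auto split: if_splits)
        show "X a \<omega> \<in> sub x" if "x \<in> S" "x \<noteq> t" "\<not> upt x" "X a' \<omega> \<in> sub x" for x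
          using that F_down[OF le a(1,2) that(1-3)] side[OF that(1)] by (auto split: if_splits)
      qed
    qed (simp add: X_def s_refl t_in)
  qed
  then show ?thesis by (rule realizably_monotoneI[OF finS])
qed

end

section \<open>Class W and synchronizability\<close>

lemma covered_by_Restr: "covered_by r x y \<Longrightarrow> x \<in> B \<Longrightarrow> y \<in> B \<Longrightarrow> covered_by (Restr r B) x y"
  unfolding covered_by_def strictly_below_def by blast

lemma covered_by_converse: "covered_by (r\<inverse>) x y \<longleftrightarrow> covered_by r y x"
  unfolding covered_by_def strictly_below_def by blast

lemma Restr_converse: "(Restr r B)\<inverse> = Restr (r\<inverse>) B"
  by blast

lemma has_inducedI: "B \<subseteq> S \<Longrightarrow> Q B (Restr r B) \<Longrightarrow> has_induced Q S r"
  unfolding has_induced_def by blast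

text \<open>Two elements covered by \<open>z\<close> are incomparable, and covers remain covers
  after restriction; three covers thus suffice for a Y.\<close>

lemma Y_shape_covers:
  assumes r: "antisym r" and c: "covered_by r z w" "covered_by r x z" "covered_by r y z" "x \<noteq> y"
  shows "Y_shape {w, z, x, y} (Restr r {w, z, x, y})"
proof -
  have lt: "(z, w) \<in> r" "z \<noteq> w" "(x, z) \<in> r" "x \<noteq> z" "(y, z) \<in> r" "y \<noteq> z"
    using c by (auto simp: covered_by_def strictly_below_def)
  have "x \<noteq> w" "y \<noteq> w" using lt r by (auto dest: antisymD)
  moreover have "(x, y) \<notin> r" "(y, x) \<notin> r"
    using c lt by (auto simp: covered_by_def strictly_below_def)
  moreover have "distinct [w, z, x, y]" using lt c calculation by auto
  moreover have "covered_by (Restr r {w, z, x, y}) z w" "covered_by (Restr r {w, z, x, y}) x z"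
    "covered_by (Restr r {w, z, x, y}) y z"
    by (rule covered_by_Restr; use c in simp)+
  ultimately show ?thesis unfolding Y_shape_def by blast
qed

lemma W_upper_star_covers:
  assumes r: "antisym r" and c: "covered_by r w x" "covered_by r w y" "covered_by r w z"
    and d: "x \<noteq> y" "x \<noteq> z" "y \<noteq> z"
  shows "W_upper_star_poset {w, x, y, z} (Restr r {w, x, y, z})"
proof -
  have lt: "(w, x) \<in> r" "w \<noteq> x" "(w, y) \<in> r" "w \<noteq> y" "(w, z) \<in> r" "w \<noteq> z"
    using c by (auto simp: covered_by_def strictly_below_def)
  have "(x, w) \<notin> r" "(y, w) \<notin> r" "(z, w) \<notin> r" using lt r by (auto dest: antisymD)
  moreover have "(x, y) \<notin> r" "(y, x) \<notin> r" "(x, z) \<notin> r" "(z, x) \<notin> r" "(y, z) \<notin> r" "(z, y) \<notin> r"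
    using c lt d by (auto simp: covered_by_def strictly_below_def)
  moreover have "a = w \<and> (b = x \<or> b = y \<or> b = z)"
    if "(a, b) \<in> r" "a \<noteq> b" "a \<in> {w, x, y, z}" "b \<in> {w, x, y, z}" for a b
    using that calculation by (elim insertE emptyE) simp_all
  ultimately have "Restr r {w, x, y, z} - Id = {(w, x), (w, y), (w, z)}" using lt by blast
  moreover have "distinct [w, x, y, z]" using lt d by simp
  ultimately show ?thesis unfolding W_upper_star_poset_def by blast
qed

section \<open>Direction of the edges at a branching vertex\<close>

context poset_tree
begin

lemma antisym_s: "antisym s"
  using partial_order_onD(3)[OF po] .

lemma two_kids:
  assumes "2 \<le> card (ch c)" "k \<in> ch c"
  obtains k' where "k' \<in> ch c" "k' \<noteq> k"
proof -
  have "card (ch c - {k}) \<noteq> 0" using assms by simp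
  then have "ch c - {k} \<noteq> {}" by force
  then show ?thesis using that by blast
qed

lemma par_not_kid: "c \<in> S \<Longrightarrow> c \<noteq> t \<Longrightarrow> k \<in> ch c \<Longrightarrow> par c \<noteq> k"
  using dep_par[of c] dep_ch[of k c] by auto

lemma kid_cover:
  assumes "k \<in> ch c" shows "if upt k then covered_by s c k else covered_by s k c"
  using in_chD[OF assms] covered_upt[of k] covered_not_upt[of k] by auto

text \<open>If \<open>upt k = upt c\<close>, then the parent and \<open>k\<close> lie on opposite
  sides of \<open>c\<close>. Any second child, on whichever side, completes a Y or its dual.\<close>

lemma no_Y_side:
  assumes nY: "\<not> has_induced Y_poset S s" and c: "c \<in> S" "2 \<le> card (ch c)" and k: "k \<in> ch c"
  shows "upt k \<longleftrightarrow> \<not> upt c"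
proof (rule ccontr)
  assume eq: "\<not> ?thesis"
  have ct: "c \<noteq> t" using branch_neq_root c by blast
  obtain k' where k': "k' \<in> ch c" "k' \<noteq> k" using two_kids[OF c(2) k] .
  have noY: False if "covered_by s z w" "covered_by s x z" "covered_by s y z" "x \<noteq> y" for w x y z
  proof -
    have "Y_poset {w, z, x, y} (Restr s {w, z, x, y})"
      using Y_shape_covers[OF antisym_s that] by (simp add: Y_poset_def)
    moreover have "{w, z, x, y} \<subseteq> S" using cover_in[OF that(1)] cover_in[OF that(2)] cover_in[OF that(3)] by simp
    ultimately show False using nY has_inducedI[of _ S Y_poset s] by blast
  qed
  have noY': False if "covered_by s w z" "covered_by s z x" "covered_by s z y" "x \<noteq> y" for w x y z
  proof -
    have "Y_shape {w, z, x, y} (Restr (s\<inverse>) {w, z, x, y})"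
      using antisym_s that by (intro Y_shape_covers) (simp_all add: covered_by_converse)
    then have "Y_poset {w, z, x, y} (Restr s {w, z, x, y})"
      unfolding Y_poset_def Restr_converse by blast
    moreover have "{w, z, x, y} \<subseteq> S" using cover_in[OF that(1)] cover_in[OF that(2)] cover_in[OF that(3)] by simp
    ultimately show False using nY has_inducedI[of _ S Y_poset s] by blast
  qed
  note K = kid_cover[OF k] kid_cover[OF k'(1)]
  note np = par_not_kid[OF c(1) ct k] par_not_kid[OF c(1) ct k'(1)]
  show False
  proof (cases "upt c")
    case True
    then have pc: "covered_by s (par c) c" using covered_upt c ct by blast
    have "covered_by s c k" using eq True K(1) by auto
    then show False using K(2) noY[of c k "par c" k'] noY'[of "par c" c k k'] pc np k' by (auto split: if_splits)
  next
    case False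
    then have pc: "covered_by s c (par c)" using covered_not_upt c ct by blast
    have "covered_by s k c" using eq False K(1) by auto
    then show False using K(2) noY[of c "par c" k k'] noY'[of k c "par c" k'] pc np k' by (auto split: if_splits)
  qed
qed

text \<open>If \<open>c\<close> lay below its parent, it would by \<open>no_Y_side\<close> lie below
  its children too, giving three upper covers. Hence every branching vertex is maximal and only the
  minimal elements of \<open>A\<close> enter.\<close>

lemma no_W_upper_star:
  assumes nW: "\<not> has_induced W_upper_star_poset S s" and nY: "\<not> has_induced Y_poset S s"
    and c: "c \<in> S" "2 \<le> card (ch c)"
  shows "upt c"
proof (rule ccontr)
  assume nu: "\<not> upt c"
  have ct: "c \<noteq> t" using branch_neq_root c by blast
  have "ch c \<noteq> {}" using c by auto
  then obtain k where k: "k \<in> ch c" by blast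
  obtain k' where k': "k' \<in> ch c" "k' \<noteq> k" using two_kids[OF c(2) k] .
  have cov: "covered_by s c (par c)" "covered_by s c k" "covered_by s c k'"
    using covered_not_upt[OF c(1) ct nu] kid_cover[OF k] kid_cover[OF k'(1)]
      no_Y_side[OF nY c k] no_Y_side[OF nY c k'(1)] nu by auto
  have "W_upper_star_poset {c, par c, k, k'} (Restr s {c, par c, k, k'})"
    using W_upper_star_covers[OF antisym_s cov] par_not_kid[OF c(1) ct k] par_not_kid[OF c(1) ct k'(1)] k' by blast
  moreover have "{c, par c, k, k'} \<subseteq> S" using cover_in[OF cov(1)] cover_in[OF cov(2)] cover_in[OF cov(3)] by simp
  ultimately show False using nW has_inducedI[of _ S _ s] by blast
qed

lemma no_W_lower_star:
  assumes nW: "\<not> has_induced W_lower_star_poset S s" and nY: "\<not> has_induced Y_poset S s"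
    and c: "c \<in> S" "2 \<le> card (ch c)"
  shows "\<not> upt c"
proof
  assume u: "upt c"
  have ct: "c \<noteq> t" using branch_neq_root c by blast
  have "ch c \<noteq> {}" using c by auto
  then obtain k where k: "k \<in> ch c" by blast
  obtain k' where k': "k' \<in> ch c" "k' \<noteq> k" using two_kids[OF c(2) k] .
  have cov: "covered_by s (par c) c" "covered_by s k c" "covered_by s k' c"
    using covered_upt[OF c(1) ct u] kid_cover[OF k] kid_cover[OF k'(1)]
      no_Y_side[OF nY c k] no_Y_side[OF nY c k'(1)] u by auto
  have "W_upper_star_poset {c, par c, k, k'} (Restr (s\<inverse>) {c, par c, k, k'})"
    using antisym_s cov par_not_kid[OF c(1) ct k] par_not_kid[OF c(1) ct k'(1)] k'
    by (intro W_upper_star_covers) (simp_all add: covered_by_converse)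
  then have "W_lower_star_poset {c, par c, k, k'} (Restr s {c, par c, k, k'})"
    unfolding W_lower_star_poset_def Restr_converse by blast
  moreover have "{c, par c, k, k'} \<subseteq> S" using cover_in[OF cov(1)] cover_in[OF cov(2)] cover_in[OF cov(3)] by simp
  ultimately show False using nW has_inducedI[of _ S _ s] by blast
qed

end

lemma hasse_parcs:
  "parcs (hasse_diagram S s) = {(x, y). x \<in> S \<and> y \<in> S \<and> (covered_by s x y \<or> covered_by s y x)}"
  by (auto simp: hasse_diagram_def)

lemma connected_nonempty: "Digraph_Component.connected (with_proj G) \<Longrightarrow> pverts G \<noteq> {}"
  by (simp add: connected_def strongly_connected_def mk_symmetric_def)

lemma class_W_poset_tree:
  assumes "finite S" "partial_order_on S s" "class_W S s"
  shows "\<exists>E t par dep. poset_tree S s E t par dep"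
proof -
  let ?H = "hasse_diagram S s"
  have T: "undirected_tree ?H" using assms by (simp add: class_W_def)
  have V: "pverts ?H = S" by (simp add: hasse_diagram_def)
  have "tree_on (pverts ?H) (parcs ?H)"
    by (rule undirected_tree_imp_tree_on[OF T])
      (auto simp: hasse_parcs V sym_def covered_by_def strictly_below_def)
  moreover have "S \<noteq> {}" using connected_nonempty[of ?H] T V by (auto simp: undirected_tree_def)
  ultimately have "\<exists>t par dep. rooted_at S (parcs ?H) t par dep \<and>
      (\<forall>x y. x \<in> S - {t} \<and> y \<in> S - {t} \<and> par x = t \<and> par y = t \<longrightarrow> x = y)"
    using assms V by (intro finite_tree_leaf_root) simp_all
  then obtain t par dep where R: "rooted_at S (parcs ?H) t par dep"
    and leaf: "\<forall>x y. x \<in> S - {t} \<and> y \<in> S - {t} \<and> par x = t \<and> par y = t \<longrightarrow> x = y"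
    by blast
  have "poset_tree S s (parcs ?H) t par dep"
  proof
    show "(x, y) \<in> parcs ?H \<longleftrightarrow> x \<in> S \<and> y \<in> S \<and> (covered_by s x y \<or> covered_by s y x)" for x y
      by (simp add: hasse_parcs)
    show "x = y" if "x \<in> S - {t}" "y \<in> S - {t}" "par x = t" "par y = t" for x y
      using leaf that by blast
  qed (use assms R in simp_all)
  then show ?thesis by blast
qed

section \<open>From synchronizability to frames\<close>

lemma minimal_below_in: "b \<in> minimal_below A r a \<Longrightarrow> b \<in> minimal_elements A r \<and> (b, a) \<in> r"
  by (simp add: minimal_below_def)

lemma minimal_below_subset: "minimal_below A r a \<subseteq> minimal_elements A r"
  by (auto simp: minimal_below_def)

lemma minimal_in: "minimal_elements A r \<subseteq> A"
  by (auto simp: minimal_elements_def)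

lemma minimal_below_self:
  "partial_order_on A r \<Longrightarrow> b \<in> minimal_elements A r \<Longrightarrow> b \<in> minimal_below A r b"
  using partial_order_onD(1) minimal_in by (fastforce simp: minimal_below_def refl_on_def)

lemma minimal_below_mono:
  "partial_order_on A r \<Longrightarrow> (a, a') \<in> r \<Longrightarrow> minimal_below A r a \<subseteq> minimal_below A r a'"
  using partial_order_onD(2) by (fastforce simp: minimal_below_def dest: transD)

text \<open>The arcs of the spanning tree serve as \<open>TD\<close>. Being arcs of
  \<open>sync_graph\<close>, they come with a common upper element, and local connectedness becomes
  \<open>conn_in\<close>.\<close>

lemma synchronizable_frame:
  assumes "synchronizable_lower_star A r" "finite A"
  obtains TD where "tree_on (minimal_elements A r) TD" "sym TD" "conn_in TD (minimal_elements A r)"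
    "\<And>b b'. (b, b') \<in> TD \<Longrightarrow> \<exists>a\<in>A. b \<in> minimal_below A r a \<and> b' \<in> minimal_below A r a"
    "\<And>a. a \<in> A \<Longrightarrow> minimal_below A r a \<noteq> {} \<and> conn_in TD (minimal_below A r a)"
proof -
  obtain H where H: "undirected_spanning_tree H (sync_graph A r)" "locally_connected A r H"
    using assms by (auto simp: synchronizable_lower_star_def)
  let ?D = "minimal_elements A r" and ?TD = "parcs H"
  have pg: "pair_graph H" and sp: "spanning (with_proj H) (with_proj (sync_graph A r))" and ut: "undirected_tree H"
    using H(1) by (auto simp: undirected_spanning_tree_def)
  interpret H: pair_graph H by (rule pg)
  have V: "pverts H = ?D" and sub: "?TD \<subseteq> parcs (sync_graph A r)"
    using sp by (auto simp: spanning_def subgraph_def sync_graph_def)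
  have wf: "?TD \<subseteq> pverts H \<times> pverts H" using H.in_arcsD1 H.in_arcsD2 by auto
  have symT: "sym ?TD" using H.pair_sym_arcs by (simp add: symmetric_def)
  have irr: "(u, u) \<notin> ?TD" for u using H.pair_no_loops[of "(u, u)"] by auto
  have "tree_on ?D ?TD" using undirected_tree_imp_tree_on[OF ut wf symT irr] V by simp
  moreover have "conn_in ?TD ?D"
    unfolding conn_in_def V[symmetric]
    using ut by (intro ballI rtrancl_on_imp_rtrancl connected_reachable symT) (simp_all add: undirected_tree_def)
  moreover have "\<exists>a\<in>A. b \<in> minimal_below A r a \<and> b' \<in> minimal_below A r a" if "(b, b') \<in> ?TD" for b b'
  proof -
    have "(b, b') \<in> parcs (sync_graph A r)" using sub that by blast
    then show ?thesis by (auto simp: sync_graph_def minimal_below_def strictly_below_def)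
  qed
  moreover have "minimal_below A r a \<noteq> {} \<and> conn_in ?TD (minimal_below A r a)" if a: "a \<in> A" for a
  proof -
    let ?X = "minimal_below A r a"
    have c: "Digraph_Component.connected (with_proj H \<restriction> ?X)"
      using H(2) a by (simp add: locally_connected_def)
    let ?G = "mk_symmetric (with_proj H \<restriction> ?X)"
    have GX: "pverts ?G = ?X" by (simp add: mk_symmetric_def)
    have GT: "parcs ?G \<subseteq> ?TD"
      using symT by (auto simp: mk_symmetric_def induce_subgraph_def sym_def)
    have "(u, v) \<in> (?TD \<inter> ?X \<times> ?X)\<^sup>*" if "u \<in> ?X" "v \<in> ?X" for u v
    proof -
      have "(u, v) \<in> rtrancl_on ?X (parcs ?G)"
        using c that GX by (simp add: connected_def strongly_connected_def reachable_def)
      then have "(u, v) \<in> (parcs ?G \<inter> ?X \<times> ?X)\<^sup>*" by (rule rtrancl_on_imp_rtrancl)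
      then show ?thesis using GT rtrancl_mono[of "parcs ?G \<inter> ?X \<times> ?X" "?TD \<inter> ?X \<times> ?X"] by blast
    qed
    \<comment> \<open>Connectedness in the graph library excludes the empty graph.\<close>
    moreover have "?X \<noteq> {}" using c GX by (simp add: connected_def strongly_connected_def)
    ultimately show ?thesis by (simp add: conn_in_def)
  qed
  ultimately show ?thesis using symT by (intro that[of ?TD]) simp_all
qed

lemma tree_on_singleton: "tree_on {x} {}"
  by (auto simp: tree_on_def rooted_at_def sym_def)

lemma conn_in_singleton: "conn_in E {x}"
  by (simp add: conn_in_def)

text \<open>The \<open>b\<close> incident with a maximal \<open>g\<close> are the minimal elements
  below \<open>g\<close>, which form a connected set. The common index along an edge of
  \<open>TD\<close> is \<open>g\<close> itself, and along an edge of \<open>TG\<close> it is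
  \<open>b\<close>.\<close>

lemma frame_both:
  assumes po: "partial_order_on A r" and fin: "finite A" "A \<noteq> {}"
    and q: "partial_order_on A q" "\<And>x y. (x, y) \<in> q \<longleftrightarrow> (y, x) \<in> r"
    and sync: "synchronizable_lower_star A r" "synchronizable_lower_star A q"
  shows "\<exists>TD TG. sync_frame A (minimal_elements A r) (minimal_elements A q)
           (minimal_below A r) (minimal_below A q) TD TG"
proof -
  obtain TD where D: "tree_on (minimal_elements A r) TD" "sym TD" "conn_in TD (minimal_elements A r)"
    "\<And>b b'. (b, b') \<in> TD \<Longrightarrow> \<exists>a\<in>A. b \<in> minimal_below A r a \<and> b' \<in> minimal_below A r a"
    "\<And>a. a \<in> A \<Longrightarrow> minimal_below A r a \<noteq> {} \<and> conn_in TD (minimal_below A r a)"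
    by (rule synchronizable_frame[OF sync(1) fin(1)]) (rule that)
  obtain TG where G: "tree_on (minimal_elements A q) TG" "sym TG" "conn_in TG (minimal_elements A q)"
    "\<And>b b'. (b, b') \<in> TG \<Longrightarrow> \<exists>a\<in>A. b \<in> minimal_below A q a \<and> b' \<in> minimal_below A q a"
    "\<And>a. a \<in> A \<Longrightarrow> minimal_below A q a \<noteq> {} \<and> conn_in TG (minimal_below A q a)"
    by (rule synchronizable_frame[OF sync(2) fin(1)]) (rule that)
  have minD: "b \<in> A" if "b \<in> minimal_elements A r" for b using that minimal_in by (rule rev_subsetD)
  have minG: "g \<in> A" if "g \<in> minimal_elements A q" for g using that minimal_in by (rule rev_subsetD)
  have selfD: "b \<in> minimal_below A r b" if "b \<in> minimal_elements A r" for b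
    using minimal_below_self[OF po that] .
  have selfG: "g \<in> minimal_below A q g" if "g \<in> minimal_elements A q" for g
    using minimal_below_self[OF q(1) that] .
  have below_g: "b \<in> minimal_below A r g" if "b \<in> minimal_below A r a" "g \<in> minimal_below A q a" for a b g
  proof -
    have "(a, g) \<in> r" using minimal_below_in[OF that(2)] q(2) by simp
    then show ?thesis using minimal_below_mono[OF po] that(1) by blast
  qed
  have above_b: "g \<in> minimal_below A q b" if "b \<in> minimal_below A r a" "g \<in> minimal_below A q a" for a b g
  proof -
    have "(a, b) \<in> q" using minimal_below_in[OF that(1)] q(2) by simp
    then show ?thesis using minimal_below_mono[OF q(1)] that(2) by blast
  qed
  have Dg: "{b. \<exists>a\<in>A. b \<in> minimal_below A r a \<and> g \<in> minimal_below A q a} = minimal_below A r g"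
    if "g \<in> minimal_elements A q" for g
    using below_g selfG[OF that] minG[OF that] by blast
  have "sync_frame A (minimal_elements A r) (minimal_elements A q)
           (minimal_below A r) (minimal_below A q) TD TG"
  proof
    show "finite (minimal_elements A r)" "finite (minimal_elements A q)"
      using finite_subset[OF minimal_in fin(1)] by blast+
    obtain a where "a \<in> A" using fin by blast
    then show "minimal_elements A q \<noteq> {}" using G(5)[of a] minimal_below_in by fastforce
    show "conn_in TD {b. \<exists>a\<in>A. b \<in> minimal_below A r a \<and> g \<in> minimal_below A q a}"
      if "g \<in> minimal_elements A q" for g
      unfolding Dg[OF that] using D(5)[OF minG[OF that]] by blast
    show "\<exists>a\<in>A. g \<in> minimal_below A q a" if "g \<in> minimal_elements A q" for g
      using selfG[OF that] minG[OF that] by blast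
    show "minimal_below A r a \<subseteq> minimal_elements A r \<and> minimal_below A r a \<noteq> {} \<and> conn_in TD (minimal_below A r a)"
      if "a \<in> A" for a using D(5)[OF that] by (simp add: minimal_below_subset)
    show "minimal_below A q a \<subseteq> minimal_elements A q \<and> minimal_below A q a \<noteq> {} \<and> conn_in TG (minimal_below A q a)"
      if "a \<in> A" for a using G(5)[OF that] by (simp add: minimal_below_subset)
    show "\<exists>a\<in>A. b \<in> minimal_below A r a \<and> b' \<in> minimal_below A r a \<and> g \<in> minimal_below A q a"
      if "a \<in> A" "b \<in> minimal_below A r a" "g \<in> minimal_below A q a"
        "a' \<in> A" "b' \<in> minimal_below A r a'" "g \<in> minimal_below A q a'" for b b' g a a'
    proof -
      have "g \<in> minimal_elements A q" using minimal_below_in[OF that(3)] by blast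
      then show ?thesis using below_g[OF that(2,3)] below_g[OF that(5,6)] selfG minG by blast
    qed
    show "\<exists>a\<in>A. b \<in> minimal_below A r a \<and> g \<in> minimal_below A q a \<and> g' \<in> minimal_below A q a"
      if "a \<in> A" "b \<in> minimal_below A r a" "g \<in> minimal_below A q a"
        "a' \<in> A" "b \<in> minimal_below A r a'" "g' \<in> minimal_below A q a'" for b g g' a a'
    proof -
      have "b \<in> minimal_elements A r" using minimal_below_in[OF that(2)] by blast
      then show ?thesis using above_b[OF that(2,3)] above_b[OF that(5,6)] selfD minD by blast
    qed
  qed (use D(1,2) G(1,2) in simp_all)
  then show ?thesis by blast
qed

text \<open>With the dummy \<open>g0\<close> every minimal element is incident, so the single column
  is the whole spanning tree, and the common index of an edge comes from
  \<open>sync_graph\<close>.\<close>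

lemma frame_lower:
  assumes po: "partial_order_on A r" and fin: "finite A" "g0 \<in> A"
    and sync: "synchronizable_lower_star A r"
  shows "\<exists>TD. sync_frame A (minimal_elements A r) {g0} (minimal_below A r) (\<lambda>_. {g0}) TD {}"
proof -
  obtain TD where D: "tree_on (minimal_elements A r) TD" "sym TD" "conn_in TD (minimal_elements A r)"
    "\<And>b b'. (b, b') \<in> TD \<Longrightarrow> \<exists>a\<in>A. b \<in> minimal_below A r a \<and> b' \<in> minimal_below A r a"
    "\<And>a. a \<in> A \<Longrightarrow> minimal_below A r a \<noteq> {} \<and> conn_in TD (minimal_below A r a)"
    by (rule synchronizable_frame[OF sync fin(1)]) (rule that)
  have Dg: "{b. \<exists>a\<in>A. b \<in> minimal_below A r a \<and> g \<in> {g0}} = minimal_elements A r" if "g \<in> {g0}" for g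
  proof
    show "minimal_elements A r \<subseteq> {b. \<exists>a\<in>A. b \<in> minimal_below A r a \<and> g \<in> {g0}}"
    proof
      fix b assume b: "b \<in> minimal_elements A r"
      then have "b \<in> A" using minimal_in by (rule rev_subsetD)
      then show "b \<in> {b. \<exists>a\<in>A. b \<in> minimal_below A r a \<and> g \<in> {g0}}"
        using minimal_below_self[OF po b] that by (intro CollectI bexI[of _ b]) simp_all
    qed
    show "{b. \<exists>a\<in>A. b \<in> minimal_below A r a \<and> g \<in> {g0}} \<subseteq> minimal_elements A r"
      using minimal_below_subset[of A r] by blast
  qed
  have "sync_frame A (minimal_elements A r) {g0} (minimal_below A r) (\<lambda>_. {g0}) TD {}"
  proof
    show "finite (minimal_elements A r)" using finite_subset[OF minimal_in fin(1)] .
    show "conn_in TD {b. \<exists>a\<in>A. b \<in> minimal_below A r a \<and> g \<in> {g0}}" if "g \<in> {g0}" for g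
      unfolding Dg[OF that] by (rule D(3))
    show "minimal_below A r a \<subseteq> minimal_elements A r \<and> minimal_below A r a \<noteq> {} \<and> conn_in TD (minimal_below A r a)"
      if "a \<in> A" for a using D(5)[OF that] by (simp add: minimal_below_subset)
    show "\<exists>a\<in>A. b \<in> minimal_below A r a \<and> b' \<in> minimal_below A r a \<and> g \<in> {g0}"
      if "(b, b') \<in> TD" "g \<in> {g0}" for b b' g using D(4)[OF that(1)] that by blast
    show "tree_on {g0} {}" by (rule tree_on_singleton)
    show "{g0} \<subseteq> {g0} \<and> {g0} \<noteq> {} \<and> conn_in {} {g0}" by (simp add: conn_in_singleton)
    show "\<exists>a\<in>A. g \<in> {g0}" if "g \<in> {g0}" for g using fin that by blast
  qed (use D(1,2) in \<open>simp_all add: sym_def\<close>)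
  then show ?thesis by blast
qed

text \<open>The mirror image, applied with \<open>q\<close> the dual order: each column is a single
  node, and all gluing takes place along \<open>TG\<close>.\<close>

lemma frame_upper:
  assumes po: "partial_order_on A q" and fin: "finite A" "g0 \<in> A"
    and sync: "synchronizable_lower_star A q"
  shows "\<exists>TG. sync_frame A {g0} (minimal_elements A q) (\<lambda>_. {g0}) (minimal_below A q) {} TG"
proof -
  obtain TG where G: "tree_on (minimal_elements A q) TG" "sym TG" "conn_in TG (minimal_elements A q)"
    "\<And>b b'. (b, b') \<in> TG \<Longrightarrow> \<exists>a\<in>A. b \<in> minimal_below A q a \<and> b' \<in> minimal_below A q a"
    "\<And>a. a \<in> A \<Longrightarrow> minimal_below A q a \<noteq> {} \<and> conn_in TG (minimal_below A q a)"
    by (rule synchronizable_frame[OF sync fin(1)]) (rule that)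
  have self: "\<exists>a\<in>A. g \<in> minimal_below A q a" if "g \<in> minimal_elements A q" for g
    using minimal_below_self[OF po that] minimal_in[of A q] that by blast
  have Dg: "{b. \<exists>a\<in>A. b \<in> {g0} \<and> g \<in> minimal_below A q a} = {g0}" if "g \<in> minimal_elements A q" for g
    using self[OF that] by blast
  have "sync_frame A {g0} (minimal_elements A q) (\<lambda>_. {g0}) (minimal_below A q) {} TG"
  proof
    show "finite (minimal_elements A q)" using finite_subset[OF minimal_in fin(1)] .
    show "minimal_elements A q \<noteq> {}" using G(5)[OF fin(2)] minimal_below_in by fastforce
    show "conn_in {} {b. \<exists>a\<in>A. b \<in> {g0} \<and> g \<in> minimal_below A q a}"
      if "g \<in> minimal_elements A q" for g
      unfolding Dg[OF that] by (rule conn_in_singleton)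
    show "minimal_below A q a \<subseteq> minimal_elements A q \<and> minimal_below A q a \<noteq> {} \<and> conn_in TG (minimal_below A q a)"
      if "a \<in> A" for a using G(5)[OF that] by (simp add: minimal_below_subset)
    show "\<exists>a\<in>A. b \<in> {g0} \<and> g \<in> minimal_below A q a \<and> g' \<in> minimal_below A q a"
      if "(g, g') \<in> TG" "b \<in> {g0}" for b g g' using G(4)[OF that(1)] that by blast
    show "tree_on {g0} {}" by (rule tree_on_singleton)
    show "{g0} \<subseteq> {g0} \<and> {g0} \<noteq> {} \<and> conn_in {} {g0}" by (simp add: conn_in_singleton)
    show "\<exists>a\<in>A. g \<in> minimal_below A q a" if "g \<in> minimal_elements A q" for g using self[OF that] .
  qed (use G(1,2) in \<open>simp_all add: sym_def\<close>)
  then show ?thesis by blast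
qed

section \<open>Back from realizations to stochastic monotonicity, and the three conditions\<close>

lemma realizably_imp_stochastically_monotone:
  fixes P :: "'a \<Rightarrow> 'b pmf"
  assumes "realizably_monotone A r S s P"
  shows "stochastically_monotone A r S s P"
proof -
  obtain M :: "('a \<Rightarrow> 'b) measure" and X where MX: "monotone_realization A r S s P M X"
    using assms by (auto simp: realizably_monotone_def)
  interpret prob_space M using MX by (simp add: monotone_realization_def)
  show ?thesis
    unfolding stochastically_monotone_def stochastically_le_def
  proof (intro ballI impI allI)
    fix a b U assume ab: "a \<in> A" "b \<in> A" "strictly_below r a b" and U: "up_set S s U"
    have meas: "X c \<in> M \<rightarrow>\<^sub>M count_space UNIV" and val: "\<And>\<omega>. \<omega> \<in> space M \<Longrightarrow> X c \<omega> \<in> S"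
      and P: "measure_pmf.prob (P c) U = prob (X c -` U \<inter> space M)" if c: "c \<in> A" for c
    proof -
      have m: "X c \<in> M \<rightarrow>\<^sub>M count_space S" and d: "distr M (count_space UNIV) (X c) = measure_pmf (P c)"
        using MX c by (simp_all add: monotone_realization_def)
      have "id \<in> count_space S \<rightarrow>\<^sub>M count_space UNIV" by simp
      from measurable_comp[OF m this] show m': "X c \<in> M \<rightarrow>\<^sub>M count_space UNIV" by (simp add: o_def)
      show "X c \<omega> \<in> S" if "\<omega> \<in> space M" for \<omega> using measurable_space[OF m that] by simp
      show "measure_pmf.prob (P c) U = prob (X c -` U \<inter> space M)"
        unfolding d[symmetric] using m' by (simp add: measure_distr)
    qed
    have "X a -` U \<inter> space M \<subseteq> X b -` U \<inter> space M"
    proof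
      fix \<omega> assume \<omega>: "\<omega> \<in> X a -` U \<inter> space M"
      then have "(X a \<omega>, X b \<omega>) \<in> s" using MX ab by (simp add: monotone_realization_def)
      then show "\<omega> \<in> X b -` U \<inter> space M" using U \<omega> val[OF ab(2)] by (auto simp: up_set_def)
    qed
    then have "prob (X a -` U \<inter> space M) \<le> prob (X b -` U \<inter> space M)"
      using meas[OF ab(2)] by (intro finite_measure_mono) (auto intro: measurable_sets)
    then show "measure_pmf.prob (P a) U \<le> measure_pmf.prob (P b) U" using P ab by simp
  qed
qed

lemma monotonicity_equivalenceI:
  assumes "\<And>P. measure_system A S P \<Longrightarrow> stochastically_monotone A r S s P \<Longrightarrow> realizably_monotone A r S s P"
  shows "monotonicity_equivalence A r S s"
  using assms realizably_imp_stochastically_monotone unfolding monotonicity_equivalence_def by blast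

theorem theorem3p1:
  fixes A :: "'a set" and r :: "'a rel" and S :: "'b set" and s :: "'b rel"
  assumes "finite A" and "partial_order_on A r"
    and "Digraph_Component.connected (with_proj (hasse_diagram A r))"
    and "finite S" and "partial_order_on S s"
    and "Digraph_Component.connected (with_proj (hasse_diagram S s))"
    and "class_W S s"
  shows "(synchronizable A r \<longrightarrow> monotonicity_equivalence A r S s) \<and>
    (class_W_lower_star S s \<and> synchronizable_lower_star A r \<longrightarrow>
       monotonicity_equivalence A r S s) \<and>
    (class_W_upper_star S s \<and> synchronizable_upper_star A r \<longrightarrow>
       monotonicity_equivalence A r S s)"
proof -
  note fin = assms(1) and poA = assms(2)
  define q where "q = r\<inverse>"
  have poq: "partial_order_on A q" and q: "\<And>x y. (x, y) \<in> q \<longleftrightarrow> (y, x) \<in> r"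
    using poA by (simp_all add: q_def)
  have nY: "\<not> has_induced Y_poset S s" using assms(7) by (simp add: class_W_def)
  obtain E t par dep where pt: "poset_tree S s E t par dep"
    using class_W_poset_tree[OF assms(4,5,7)] by blast
  interpret poset_tree S s E t par dep by (rule pt)
  have "pverts (hasse_diagram A r) = A" by (simp add: hasse_diagram_def)
  then have "A \<noteq> {}" using connected_nonempty[OF assms(3)] by simp
  \<comment> \<open>The dummy maximal or minimal element of the one-sided cases.\<close>
  then obtain g0 where g0: "g0 \<in> A" by blast
  have lower: "minimal_below A r a \<subseteq> minimal_below A r a'" if "strictly_below r a a'" for a a'
    using that minimal_below_mono[OF poA] by (simp add: strictly_below_def)
  have upper: "minimal_below A q a' \<subseteq> minimal_below A q a" if "strictly_below r a a'" for a a'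
    using that minimal_below_mono[OF poq, of a' a] q by (simp add: strictly_below_def)
  have le: "(b, a) \<in> r" if "b \<in> minimal_below A r a" for a b using that by (simp add: minimal_below_def)
  have ge: "(a, g) \<in> r" if "g \<in> minimal_below A q a" for a g using that q by (simp add: minimal_below_def)
  note side = no_Y_side[OF nY]
  \<comment> \<open>Common to all three conditions, which differ only in whether \<open>D\<close>
    and \<open>G\<close> are both genuine or one of them is the dummy.\<close>
  have realize: "monotonicity_equivalence A r S s"
    if fr: "sync_frame A D G Dl Gl TD TG" and DG: "D \<subseteq> A" "G \<subseteq> A"
      and mono: "\<And>a a'. strictly_below r a a' \<Longrightarrow> Dl a \<subseteq> Dl a'"
        "\<And>a a'. strictly_below r a a' \<Longrightarrow> Gl a' \<subseteq> Gl a"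
      and low: "\<And>c a b. \<lbrakk>c \<in> S; 2 \<le> card (ch c); upt c; b \<in> Dl a\<rbrakk> \<Longrightarrow> (b, a) \<in> r"
      and upp: "\<And>c a g. \<lbrakk>c \<in> S; 2 \<le> card (ch c); \<not> upt c; g \<in> Gl a\<rbrakk> \<Longrightarrow> (a, g) \<in> r"
    for D G Dl Gl TD TG
  proof (rule monotonicity_equivalenceI)
    fix P assume P: "measure_system A S P" "stochastically_monotone A r S s P"
    have "coupled_system S s E t par dep A D G Dl Gl TD TG r P"
    proof (intro coupled_system.intro pt fr coupled_system_axioms.intro)
      show "set_pmf (P a) \<subseteq> S" if "a \<in> A" for a using P that by (simp add: measure_system_def)
      show "Dl a \<subseteq> Dl a'" "Gl a' \<subseteq> Gl a" if "strictly_below r a a'" for a a'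
        using mono that by blast+
      show "(b, a) \<in> r" if "c \<in> S" "2 \<le> card (ch c)" "upt c" "b \<in> Dl a" for c a b
        using low that by blast
      show "(a, g) \<in> r" if "c \<in> S" "2 \<le> card (ch c)" "\<not> upt c" "g \<in> Gl a" for c a g
        using upp that by blast
      show "upt k \<longleftrightarrow> \<not> upt c" if "c \<in> S" "2 \<le> card (ch c)" "k \<in> ch c" for c k
        using side that by blast
    qed (fact fin DG P)+
    then show "realizably_monotone A r S s P" by (rule coupled_system.realizable)
  qed
  show ?thesis
  proof (intro conjI impI)
    assume "synchronizable A r"
    then have "synchronizable_lower_star A r" "synchronizable_lower_star A q"
      by (simp_all add: synchronizable_def synchronizable_upper_star_def q_def)
    then obtain TD TG where fr: "sync_frame A (minimal_elements A r) (minimal_elements A q)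
           (minimal_below A r) (minimal_below A q) TD TG"
      using frame_both[OF poA fin \<open>A \<noteq> {}\<close> poq q] by blast
    show "monotonicity_equivalence A r S s"
      by (rule realize[OF fr minimal_in minimal_in lower upper le ge])
  next
    assume ii: "class_W_lower_star S s \<and> synchronizable_lower_star A r"
    then obtain TD where fr: "sync_frame A (minimal_elements A r) {g0} (minimal_below A r) (\<lambda>_. {g0}) TD {}"
      using frame_lower[OF poA fin g0] by blast
    have "\<not> has_induced W_upper_star_poset S s" using ii by (simp add: class_W_lower_star_def)
    \<comment> \<open>This makes the requirement on \<open>Gl\<close> vacuous, so that
      \<open>g0\<close> is admissible.\<close>
    note up = no_W_upper_star[OF this nY]
    show "monotonicity_equivalence A r S s"
      by (rule realize[OF fr minimal_in _ lower _ le]) (use g0 up in auto)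
  next
    assume iii: "class_W_upper_star S s \<and> synchronizable_upper_star A r"
    then have "synchronizable_lower_star A q" by (simp add: synchronizable_upper_star_def q_def)
    then obtain TG where fr: "sync_frame A {g0} (minimal_elements A q) (\<lambda>_. {g0}) (minimal_below A q) {} TG"
      using frame_upper[OF poq fin g0] by blast
    have "\<not> has_induced W_lower_star_poset S s" using iii by (simp add: class_W_upper_star_def)
    \<comment> \<open>This makes the requirement on \<open>Dl\<close> vacuous.\<close>
    note dn = no_W_lower_star[OF this nY]
    show "monotonicity_equivalence A r S s"
      by (rule realize[OF fr _ minimal_in _ upper _ ge]) (use g0 dn in auto)
  qed
qed

end
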